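(* Let $\Omega\subset\mathbb{R}^N$ be a connected, open and bounded set. Let $g:[0,+\infty)\to[0,+\infty)$ be a continuous function satisfying assumptions (L) and (G), let $\overline t$ be the number in (L), and suppose that on $(0,\overline t]$ $$g'(t)\ge0\quad\text{and}\quad g(t)+g'(t)t\le1 .$$ Assume that $$G(\xi)=\int_0^\xi\frac{g(\zeta^2/N)}{\zeta}\,d\zeta<+\infty ,$$ and suppose moreover that there exists $K>0$ such that, for every $\xi>0$ with $0<\xi^2/N\le\overline t$, $$\sqrt{g(\xi^2/N)}\le K\left(e^{G(\xi)}-1\right).$$ Let $u\in W^{1,2}(\Omega)\cap C(\overline\Omega)$ be a weak supersolution to $$\sum_{i=1}^{N-1}u_{x_ix_i}+g(u_{x_N}^2)\,u_{x_Nx_N}=0\quad\text{in }\Omega .$$ Then, if $u$ attains its minimum in $\Omega$, it is a constant.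
   Context: Throughout $N\ge 2$. Assumptions (L) for $g$: there exists $\overline t>0$ such that $0\le g(t)\le1$ on $[0,\overline t]$; $g$ is continuous on $[0,\overline t]$, and positive and differentiable on $(0,\overline t]$; and on $(0,\overline t]$ the function $t\mapsto g(t)+g'(t)t$ is non-decreasing. Assumption (G) for $g$: a solution $f$ on $[0,+\infty)$ of the differential equation $g(t)=f(t)+5tf'(t)+2t^2f''(t)$ is bounded, and the function $s\mapsto f(s^2)s^2$ is strictly convex on $\mathbb{R}$. Set $L(p)=\frac12\left(\sum_{i=1}^{N-1}p_i^2+f(p_N^2)p_N^2\right)$ for $p\in\mathbb{R}^N$; then formally $\operatorname{div}\nabla L(\nabla u)=\sum_{i=1}^{N-1}u_{x_ix_i}+g(u_{x_N}^2)u_{x_Nx_N}$. A function $u\in W^{1,2}(\Omega)$ is a weak supersolution to this equation if $\int_\Omega\langle\nabla L(\nabla u(x)),\nabla\eta(x)\rangle\,dx\ge0$ for every $\eta\in C_0^\infty(\Omega)$ with $\eta\ge0$. *)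

theory Defs
  imports "HOL-Analysis.Analysis"
begin

definition grad :: "(real ^ 'n \<Rightarrow> real) \<Rightarrow> real ^ 'n \<Rightarrow> real ^ 'n" where
  "grad F x = (THE D. GDERIV F x :> D)"

primrec Ck :: "nat \<Rightarrow> (real ^ 'n \<Rightarrow> real) \<Rightarrow> bool" where
  "Ck 0 F \<longleftrightarrow> continuous_on UNIV F"
| "Ck (Suc m) F \<longleftrightarrow> (\<forall>x. F differentiable at x) \<and> (\<forall>i. Ck m (\<lambda>x. grad F x $ i))"

definition test_functions :: "(real ^ 'n) set \<Rightarrow> (real ^ 'n \<Rightarrow> real) set" where
  "test_functions \<Omega> =
     {\<phi>. (\<forall>m. Ck m \<phi>) \<and> compact (closure {x. \<phi> x \<noteq> 0}) \<and> closure {x. \<phi> x \<noteq> 0} \<subseteq> \<Omega>}"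

definition L2 :: "(real ^ 'n) set \<Rightarrow> (real ^ 'n \<Rightarrow> 'b::euclidean_space) set" where
  "L2 \<Omega> = {v. v \<in> borel_measurable (lebesgue_on \<Omega>) \<and>
               integrable (lebesgue_on \<Omega>) (\<lambda>x. (norm (v x))\<^sup>2)}"

definition weak_gradient ::
    "(real ^ 'n) set \<Rightarrow> (real ^ 'n \<Rightarrow> real) \<Rightarrow> (real ^ 'n \<Rightarrow> real ^ 'n) \<Rightarrow> bool" where
  "weak_gradient \<Omega> u v \<longleftrightarrow>
     (\<forall>\<phi>\<in>test_functions \<Omega>. \<forall>i.
        integral\<^sup>L (lebesgue_on \<Omega>) (\<lambda>x. u x * grad \<phi> x $ i) =
        - integral\<^sup>L (lebesgue_on \<Omega>) (\<lambda>x. v x $ i * \<phi> x))"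

definition W12 :: "(real ^ 'n) set \<Rightarrow> (real ^ 'n \<Rightarrow> real) set" where
  "W12 \<Omega> = {u. u \<in> L2 \<Omega> \<and> (\<exists>v\<in>L2 \<Omega>. weak_gradient \<Omega> u v)}"

definition strictly_convex_on :: "real set \<Rightarrow> (real \<Rightarrow> real) \<Rightarrow> bool" where
  "strictly_convex_on S h \<longleftrightarrow> convex S \<and>
     (\<forall>x\<in>S. \<forall>y\<in>S. \<forall>t. x \<noteq> y \<longrightarrow> 0 < t \<longrightarrow> t < 1 \<longrightarrow>
        h ((1 - t) * x + t * y) < (1 - t) * h x + t * h y)"

text \<open>Functions on the half-line are total functions on the reals of which only the values at
  nonnegative arguments matter. The argument \<open>g'\<close> is the derivative of \<open>g\<close> on
  \<open>{0<..tbar}\<close>; at \<open>tbar\<close> only the left derivative is required.\<close>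

definition assumption_L :: "(real \<Rightarrow> real) \<Rightarrow> (real \<Rightarrow> real) \<Rightarrow> real \<Rightarrow> bool" where
  "assumption_L g g' tbar \<longleftrightarrow>
     0 < tbar \<and>
     (\<forall>t\<in>{0..tbar}. 0 \<le> g t \<and> g t \<le> 1) \<and>
     continuous_on {0..tbar} g \<and>
     (\<forall>t\<in>{0<..tbar}. 0 < g t \<and> (g has_real_derivative g' t) (at t within {0<..tbar})) \<and>
     mono_on {0<..tbar} (\<lambda>t. g t + g' t * t)"

text \<open>The equation \<open>g = f + 5 t f' + 2 t\<^sup>2 f''\<close> is singular at \<open>0\<close>. Its bounded solution extends
  continuously to \<open>0\<close>, but for degenerate \<open>g\<close> such as \<open>g t = 1 / (ln t)\<^sup>2\<close> near \<open>0\<close> it is not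
  differentiable there. Hence a solution on the closed half-line is continuous up to \<open>0\<close> and
  satisfies the equation at every \<open>t > 0\<close>.\<close>

definition ode_solution :: "(real \<Rightarrow> real) \<Rightarrow> (real \<Rightarrow> real) \<Rightarrow> bool" where
  "ode_solution g f \<longleftrightarrow>
     continuous_on {0..} f \<and>
     (\<exists>f' f''. \<forall>t>0. (f has_real_derivative f' t) (at t) \<and>
                     (f' has_real_derivative f'' t) (at t) \<and>
                     g t = f t + 5 * t * f' t + 2 * t\<^sup>2 * f'' t)"

definition assumption_G :: "(real \<Rightarrow> real) \<Rightarrow> (real \<Rightarrow> real) \<Rightarrow> bool" where
  "assumption_G g f \<longleftrightarrow>
     ode_solution g f \<and> bounded (f ` {0..}) \<and>
     strictly_convex_on UNIV (\<lambda>s. f (s\<^sup>2) * s\<^sup>2)"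

text \<open>The index \<open>k\<close> plays the role of the distinguished last coordinate.\<close>

definition Lagr :: "'n \<Rightarrow> (real \<Rightarrow> real) \<Rightarrow> real ^ 'n \<Rightarrow> real" where
  "Lagr k f p = 1 / 2 * ((\<Sum>i\<in>UNIV - {k}. (p $ i)\<^sup>2) + f ((p $ k)\<^sup>2) * (p $ k)\<^sup>2)"

text \<open>The weak gradient is unique up to null sets, so the choice of \<open>v\<close> is immaterial.\<close>

definition weak_supersolution ::
    "'n \<Rightarrow> (real \<Rightarrow> real) \<Rightarrow> (real ^ 'n) set \<Rightarrow> (real ^ 'n \<Rightarrow> real) \<Rightarrow> bool" where
  "weak_supersolution k f \<Omega> u \<longleftrightarrow>
     u \<in> L2 \<Omega> \<and>
     (\<exists>v\<in>L2 \<Omega>. weak_gradient \<Omega> u v \<and>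
        (\<forall>\<eta>\<in>test_functions \<Omega>. (\<forall>x. 0 \<le> \<eta> x) \<longrightarrow>
           0 \<le> integral\<^sup>L (lebesgue_on \<Omega>) (\<lambda>x. grad (Lagr k f) (v x) \<bullet> grad \<eta> x)))"

definition G_integrand :: "nat \<Rightarrow> (real \<Rightarrow> real) \<Rightarrow> real \<Rightarrow> real" where
  "G_integrand N g \<zeta> = g (\<zeta>\<^sup>2 / real N) / \<zeta>"

definition G_fun :: "nat \<Rightarrow> (real \<Rightarrow> real) \<Rightarrow> real \<Rightarrow> real" where
  "G_fun N g \<xi> = set_lebesgue_integral lborel {0<..<\<xi>} (G_integrand N g)"

end

theory Submission
  imports Defs
begin

text \<open>
  Put \<open>h s = f (s\<^sup>2) s\<^sup>2\<close>. The differential equation for \<open>f\<close> says \<open>h'' = 2 g (s\<^sup>2)\<close>, so the gradient of the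
  energy density acts componentwise and monotonically: it is the identity except in the distinguished
  component, where it is \<open>H = h' / 2\<close>, a nondecreasing function of linear growth with
  \<open>H' = g (s\<^sup>2)\<close> (\<open>one_dim_flux\<close>, \<open>grad_Lagr\<close>). Hence weak supersolutions lie above strict classical
  subsolutions lying below them on the boundary (\<open>comparison_principle\<close>). Test functions have to be smooth while
  \<open>u\<close> is only weakly differentiable; \<open>truncation_approximation\<close> bridges the gap, by mollifying \<open>w - u\<close>
  and then composing with a smooth function that vanishes on the negative half-line.

  Let \<open>m\<close> be the minimum of \<open>u\<close>. The set where \<open>u > m\<close> is open, and the point is that
  membership propagates along segments parallel to the coordinate axes inside \<open>\<Omega>\<close>. It is then relatively closed as well, since
  any two points of a ball are joined by such segments within the ball, and connectedness makes it
  empty or all of \<open>\<Omega>\<close>; it does not contain a minimum point.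

  In the nondegenerate directions propagation follows from Hopf's exponential barrier, a strict
  subsolution as soon as the slopes are so small that \<open>0 \<le> g \<le> 1\<close> there
  (\<open>positivity_horizontal\<close>). In the degenerate direction the barrier is a product of a fixed bump in the other variables and a profile \<open>\<phi>\<close> of the degenerate one
  (\<open>positivity_vertical\<close>). The bump costs a multiple of \<open>\<phi>\<close>, so \<open>\<phi>\<close> has to satisfy
  \<open>\<gamma> (\<phi>') \<phi>'' = M \<phi>\<close>, where \<open>\<gamma> s\<close> is \<open>g (s\<^sup>2)\<close> up to scaling, and to remain positive and increasing over the
  whole length of the segment however small it is at the top. This is possible
  for every length because the integral of \<open>sqrt (g (s\<^sup>2)) / s\<close> diverges at \<open>0\<close> (\<open>profile_exists\<close>).

  The hypothesis on \<open>G\<close> yields that divergence (\<open>sqrt_integral_diverges\<close>). With \<open>r \<zeta> = g (\<zeta>\<^sup>2 / N)\<close>, a convergent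
  integral of \<open>sqrt r / \<zeta>\<close> with tail \<open>E\<close> would give \<open>G \<le> sqrt r E\<close>, as \<open>r\<close> is nondecreasing; but
  \<open>sqrt r \<le> K (exp G - 1)\<close> bounds \<open>sqrt r\<close> by \<open>2 K G\<close> near \<open>0\<close>, and \<open>E\<close> tends to \<open>0\<close>.
\<close>

section \<open>Smooth functions\<close>

lemma GDERIV_unique_grad:
  fixes F :: "real ^ 'n \<Rightarrow> real"
  assumes "GDERIV F x :> D" shows "grad F x = D"
  unfolding grad_def
proof (rule the_equality, rule assms)
  fix D' assume "GDERIV F x :> D'"
  then have "(\<lambda>h. h \<bullet> D') = (\<lambda>h. h \<bullet> D)"
    using assms unfolding gderiv_def by (rule has_derivative_unique)
  then show "D' = D" by (metis inner_commute vector_eq_ldot)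
qed

lemma GDERIV_grad:
  fixes F :: "real ^ 'n \<Rightarrow> real"
  assumes "F differentiable at x" shows "GDERIV F x :> grad F x"
proof -
  obtain F' where F': "(F has_derivative F') (at x)"
    using assms unfolding differentiable_def by blast
  then have lin: "linear F'" by (simp add: has_derivative_linear)
  have "F' = (\<lambda>h. h \<bullet> adjoint F' 1)"
    using adjoint_works[OF lin] by (auto simp: fun_eq_iff inner_commute)
  then have "GDERIV F x :> adjoint F' 1" using F' unfolding gderiv_def by simp
  then show ?thesis using GDERIV_unique_grad by metis
qed

lemma GDERIV_differentiable: "GDERIV F x :> D \<Longrightarrow> F differentiable at x"
  unfolding gderiv_def differentiable_def by blast

text \<open>The class \<^const>\<open>Ck\<close> is a recursion over \<^const>\<open>grad\<close>, a definite description. This rule and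
  \<open>Ck_Suc_GDERIV\<close> replace it by explicit gradients, which is how the closure properties below are proved.\<close>

lemma Ck_SucI:
  fixes F :: "real ^ 'n \<Rightarrow> real"
  assumes "\<And>x. GDERIV F x :> D x" "\<And>i. Ck m (\<lambda>x. D x $ i)"
  shows "Ck (Suc m) F"
proof -
  have "grad F = D" using assms(1) GDERIV_unique_grad by blast
  then show ?thesis using assms by (auto intro: GDERIV_differentiable)
qed

lemma Ck_SucD: "Ck (Suc m) F \<Longrightarrow> Ck m F"
proof (induction m arbitrary: F)
  case 0
  then show ?case
    by (auto simp: continuous_on_eq_continuous_at differentiable_imp_continuous_within)
next
  case (Suc m)
  then show ?case by simp
qed

lemma Ck_imp_continuous: "Ck m F \<Longrightarrow> continuous_on UNIV F"
  by (induction m) (use Ck_SucD in auto)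

lemma Ck_Suc_GDERIV: "Ck (Suc m) F \<Longrightarrow> GDERIV F x :> grad F x"
  by (auto intro: GDERIV_grad)

lemma Ck_const: "Ck m (\<lambda>x. c)"
proof (induction m arbitrary: c)
  case (Suc m)
  show ?case by (rule Ck_SucI[where D="\<lambda>_. 0"]) (simp_all add: GDERIV_const Suc)
qed simp

lemma Ck_add: "Ck m F \<Longrightarrow> Ck m G \<Longrightarrow> Ck m (\<lambda>x. F x + G x)"
proof (induction m arbitrary: F G)
  case (Suc m)
  have "GDERIV (\<lambda>x. F x + G x) x :> grad F x + grad G x" for x
    using Suc.prems by (intro GDERIV_add Ck_Suc_GDERIV)
  then show ?case
    by (rule Ck_SucI) (use Suc in simp)
qed (simp add: continuous_on_add)

lemma Ck_mult: "Ck m F \<Longrightarrow> Ck m G \<Longrightarrow> Ck m (\<lambda>x. F x * G x)"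
proof (induction m arbitrary: F G)
  case (Suc m)
  have "GDERIV (\<lambda>x. F x * G x) x :> F x *\<^sub>R grad G x + G x *\<^sub>R grad F x" for x
    using Suc.prems by (intro GDERIV_mult Ck_Suc_GDERIV)
  moreover have "Ck m (\<lambda>x. (F x *\<^sub>R grad G x + G x *\<^sub>R grad F x) $ i)" for i
    using Suc.IH Suc.prems Ck_SucD[OF Suc.prems(1)] Ck_SucD[OF Suc.prems(2)]
    by (simp add: Ck_add)
  ultimately show ?case by (rule Ck_SucI)
qed (simp add: continuous_on_mult)

lemma Ck_diff_const: "Ck m F \<Longrightarrow> Ck m (\<lambda>x. F x - c)"
  using Ck_add[OF _ Ck_const[of m "- c"], of F] by simp

lemma GDERIV_coordinate: "GDERIV (\<lambda>x::real^'n. x $ i) x :> axis i 1"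
  unfolding gderiv_def inner_axis
  using bounded_linear_imp_has_derivative[OF bounded_linear_vec_nth[of i]] by simp

lemma Ck_coordinate: "Ck m (\<lambda>x::real^'n. x $ i)"
proof (cases m)
  case (Suc l)
  show ?thesis unfolding Suc by (rule Ck_SucI[OF GDERIV_coordinate]) (rule Ck_const)
qed (simp add: continuous_intros)

lemma GDERIV_norm_sq: "GDERIV (\<lambda>x. (norm (x - a))\<^sup>2) x :> 2 *\<^sub>R (x - a)"
  unfolding gderiv_def power2_norm_eq_inner
  by (auto intro!: derivative_eq_intros simp: inner_commute)

lemma Ck_norm_sq: "Ck m (\<lambda>x::real^'n. (norm (x - a))\<^sup>2)"
proof (cases m)
  case (Suc l)
  have "Ck l (\<lambda>x::real^'n. 2 * (x $ i - a $ i))" for i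
    by (intro Ck_mult Ck_diff_const Ck_coordinate Ck_const)
  then show ?thesis unfolding Suc by (intro Ck_SucI[OF GDERIV_norm_sq]) simp
qed (auto intro!: continuous_intros)

text \<open>The powers of \<open>1 / s\<close> are included because differentiating \<open>exp (- 1 / s)\<close> produces them: the
  family is closed under differentiation, so one induction shows that all its members are smooth.\<close>

definition bump :: "nat \<Rightarrow> real \<Rightarrow> real" where
  "bump n s = (if 0 < s then exp (- (1 / s)) / s ^ n else 0)"

lemma bump_nonneg: "0 \<le> bump n s" by (simp add: bump_def)

lemma bump_pos: "0 < s \<Longrightarrow> 0 < bump n s" by (simp add: bump_def)

lemma bump_eq_0: "s \<le> 0 \<Longrightarrow> bump n s = 0" by (simp add: bump_def)

text \<open>Quadratic decay at \<open>0\<close> gives differentiability there; the bound comes from the term of order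
  \<open>n + 2\<close> in the exponential series of \<open>1 / s\<close>.\<close>

lemma bump_le: "bump n s \<le> fact (n + 2) * s\<^sup>2"
proof (cases "0 < s")
  case True
  have "(1 / s) ^ (n + 2) / fact (n + 2) \<le> exp (1 / s)"
  proof -
    have sums: "(\<lambda>k. (1/s) ^ k /\<^sub>R fact k) sums exp (1/s)" by (rule exp_converges)
    have "(\<Sum>k\<in>{n+2}. (1/s) ^ k /\<^sub>R fact k) \<le> (\<Sum>k. (1/s) ^ k /\<^sub>R fact k)"
      by (rule sum_le_suminf) (use True sums in \<open>auto simp: sums_iff\<close>)
    then have "(\<Sum>k\<in>{n+2}. (1/s) ^ k /\<^sub>R fact k) \<le> exp (1/s)"
      using sums by (simp add: sums_iff del: sum.insert)
    then show ?thesis by (simp add: field_simps)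
  qed
  then have "1 \<le> exp (1/s) * (fact (n+2) * s ^ (n + 2))"
    using True by (simp add: field_simps del: fact_Suc)
  then have "exp (-(1/s)) \<le> fact (n+2) * s ^ (n+2)"
    by (simp add: exp_minus field_simps del: fact_Suc)
  then show ?thesis using True
    by (simp add: bump_def divide_le_eq power_add field_simps power2_eq_square del: fact_Suc)
qed (simp add: bump_def)

lemma bump_deriv:
  "(bump n has_real_derivative bump (n + 2) s - real n * bump (n + 1) s) (at s)"
proof -
  consider "0 < s" | "s < 0" | "s = 0" by linarith
  then show ?thesis
  proof cases
    case 1
    have "((\<lambda>s. exp (- (1 / s)) / s ^ n) has_real_derivative
        bump (n + 2) s - real n * bump (n + 1) s) (at s)"
    proof (cases n)
      case 0
      show ?thesis using 1 unfolding 0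
        by (auto intro!: derivative_eq_intros simp: bump_def power2_eq_square)
    next
      case (Suc l)
      have "((\<lambda>s. exp (- (1 / s)) / s ^ Suc l) has_real_derivative
          (exp (- (1/s)) * (1 / s\<^sup>2) * s ^ Suc l - exp (- (1/s)) * (real (Suc l) * s ^ l)) / (s ^ Suc l * s ^ Suc l)) (at s)"
        using 1 by (auto intro!: derivative_eq_intros simp: power2_eq_square simp del: power_Suc of_nat_Suc)
      moreover have "(exp (- (1/s)) * (1 / s\<^sup>2) * s ^ Suc l - exp (- (1/s)) * (real (Suc l) * s ^ l)) / (s ^ Suc l * s ^ Suc l)
          = bump (Suc l + 2) s - real (Suc l) * bump (Suc l + 1) s"
        using 1 by (simp add: bump_def field_simps power2_eq_square)
      ultimately show ?thesis unfolding Suc by simp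
    qed
    then show ?thesis
      by (rule has_field_derivative_transform_within[of _ _ _ _ s])
        (use 1 in \<open>auto simp: bump_def dist_real_def\<close>)
  next
    case 2
    have "((\<lambda>s. 0) has_real_derivative bump (n + 2) s - real n * bump (n + 1) s) (at s)"
      using 2 by (simp add: bump_eq_0)
    then show ?thesis
      by (rule has_field_derivative_transform_within[of _ _ _ _ "-s"])
        (use 2 in \<open>auto simp: bump_def dist_real_def\<close>)
  next
    case 3
    have "((\<lambda>h. bump n h / h) \<longlongrightarrow> 0) (at 0)"
    proof (rule Lim_null_comparison[where g="\<lambda>h. fact (n+2) * \<bar>h\<bar>"])
      have "norm (bump n h / h) \<le> fact (n+2) * \<bar>h\<bar>" if "h \<noteq> 0" for h
      proof -
        have "bump n h \<le> fact (n+2) * \<bar>h\<bar> * \<bar>h\<bar>"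
          using bump_le[of n h] by (simp add: power2_eq_square mult.assoc del: fact_Suc)
        then show ?thesis using that bump_nonneg[of n h]
          by (simp add: divide_le_eq del: fact_Suc)
      qed
      then show "\<forall>\<^sub>F h in at 0. norm (bump n h / h) \<le> fact (n+2) * \<bar>h\<bar>"
        by (simp add: eventually_at_filter del: fact_Suc)
      show "((\<lambda>h. fact (n+2) * \<bar>h\<bar>) \<longlongrightarrow> 0) (at (0::real))"
        by (auto intro!: tendsto_eq_intros simp del: fact_Suc)
    qed
    then show ?thesis using 3 by (simp add: DERIV_def bump_eq_0)
  qed
qed

lemma bump_continuous: "continuous_on A (bump n)"
  by (meson DERIV_isCont bump_deriv continuous_at_imp_continuous_on)

lemma Ck_bump: "Ck m Z \<Longrightarrow> Ck m (\<lambda>x. bump n (Z x))"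
proof (induction m arbitrary: n)
  case 0
  then have "continuous_on UNIV (bump n \<circ> Z)"
    by (intro continuous_on_compose bump_continuous) simp
  then show ?case by (simp add: o_def)
next
  case (Suc m)
  have "GDERIV (\<lambda>x. bump n (Z x)) x :>
      (bump (n + 2) (Z x) - real n * bump (n + 1) (Z x)) *\<^sub>R grad Z x" for x
    by (rule GDERIV_DERIV_compose[OF Ck_Suc_GDERIV[OF Suc.prems] bump_deriv])
  moreover have "Ck m (\<lambda>x. ((bump (n + 2) (Z x) - real n * bump (n + 1) (Z x)) *\<^sub>R grad Z x) $ i)" for i
  proof -
    have "Ck m (\<lambda>x. (bump (n + 2) (Z x) + (- real n) * bump (n + 1) (Z x)) * grad Z x $ i)"
      using Suc.prems by (intro Ck_mult Ck_add Ck_const Suc.IH[OF Ck_SucD[OF Suc.prems]]) auto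
    then show ?thesis by simp
  qed
  ultimately show ?case by (rule Ck_SucI)
qed

section \<open>Integration by parts and mollification\<close>

lemma lborel_integral_translate:
  fixes f :: "'a::euclidean_space \<Rightarrow> real"
  assumes "f \<in> borel_measurable borel"
  shows "(LBINT x. f (x + h)) = (LBINT x. f x)"
    and "integrable lborel f \<Longrightarrow> integrable lborel (\<lambda>x. f (x + h))"
proof -
  have eq: "lborel = distr lborel borel (\<lambda>x::'a. x + h)"
    using lborel_distr_plus[of h, symmetric]
    by (metis (no_types, lifting) add.commute ext)
  show "(LBINT x. f (x + h)) = (LBINT x. f x)"
    by (subst (2) eq, subst integral_distr) (use assms in auto)
  assume "integrable lborel f"
  then have "integrable (distr lborel borel (\<lambda>x. x + h)) f" using eq by simp
  then show "integrable lborel (\<lambda>x. f (x + h))"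
    by (subst (asm) integrable_distr_eq) (use assms in auto)
qed

lemma integrable_indicator_cball:
  "integrable lborel (indicator (cball c r) :: 'a::euclidean_space \<Rightarrow> real)"
  using emeasure_bounded_finite[of "cball c r"] by (intro integrable_real_indicator) auto

text \<open>A continuous function vanishing off a compact set is uniformly continuous on the whole space: away
  from a large ball both values are \<open>0\<close>.\<close>

lemma continuous_bounded_support:
  fixes f :: "'a::euclidean_space \<Rightarrow> real"
  assumes "continuous_on UNIV f" "\<And>x. x \<notin> K \<Longrightarrow> f x = 0" "compact K"
  shows "integrable lborel f" "uniformly_continuous_on UNIV f" "\<exists>C\<ge>0. \<forall>x. \<bar>f x\<bar> \<le> C"
proof -
  have "integrable lborel (\<lambda>x. indicator K x *\<^sub>R f x)"
    using borel_integrable_compact[OF assms(3) continuous_on_subset[OF assms(1)]] by simp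
  moreover have "(\<lambda>x. indicator K x *\<^sub>R f x) = f"
    using assms(2) by (auto simp: indicator_def fun_eq_iff)
  ultimately show "integrable lborel f" by simp
  have "compact (f ` K)"
    using assms by (meson compact_continuous_image continuous_on_subset subset_UNIV)
  then obtain C where "\<And>x. x \<in> K \<Longrightarrow> \<bar>f x\<bar> \<le> C"
    by (metis bounded_real compact_imp_bounded imageI)
  then have "\<bar>f x\<bar> \<le> max C 0" for x using assms(2)[of x] by (cases "x \<in> K") force+
  then show "\<exists>C\<ge>0. \<forall>x. \<bar>f x\<bar> \<le> C" by (intro exI[of _ "max C 0"]) auto
  obtain R where R: "\<And>x. x \<in> K \<Longrightarrow> norm x \<le> R"
    using compact_imp_bounded[OF assms(3)] bounded_iff by metis
  have uc: "uniformly_continuous_on (cball 0 (R + 2)) f"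
    using assms(1) by (intro compact_uniformly_continuous continuous_on_subset[OF assms(1)]) auto
  show "uniformly_continuous_on UNIV f"
    unfolding uniformly_continuous_on_def
  proof (intro allI impI)
    fix e :: real assume "0 < e"
    then obtain d where d: "0 < d"
      "\<And>x x'. x \<in> cball 0 (R+2) \<Longrightarrow> x' \<in> cball 0 (R+2) \<Longrightarrow> dist x' x < d \<Longrightarrow> dist (f x') (f x) < e"
      using uc unfolding uniformly_continuous_on_def by metis
    have "dist (f x') (f x) < e" if "dist x' x < min d 1" for x x'
    proof (cases "norm x \<le> R + 1")
      case True
      have "norm x' \<le> norm x + dist x' x"
        by (metis dist_norm norm_triangle_sub)
      then show ?thesis using d(2)[of x x'] that True by auto
    next
      case False
      have "norm x \<le> norm x' + dist x' x"
        by (metis dist_norm norm_triangle_sub norm_minus_commute)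
      then have "norm x' > R" using False that by auto
      then show ?thesis using False R assms(2) \<open>0 < e\<close> by (smt (verit) dist_self)
    qed
    then show "\<exists>d>0. \<forall>x\<in>UNIV. \<forall>x'\<in>UNIV. dist x' x < d \<longrightarrow> dist (f x') (f x) < e"
      using d(1) by (intro exI[of _ "min d 1"]) auto
  qed
qed

text \<open>Derivative along one coordinate axis only. The flux of a barrier is regular along the axis on which
  the divergence differentiates each component, and the integration by parts asks for nothing more.\<close>

definition partial :: "'n::finite \<Rightarrow> (real ^ 'n \<Rightarrow> real) \<Rightarrow> real ^ 'n \<Rightarrow> real \<Rightarrow> bool" where
  "partial i F x d \<longleftrightarrow> ((\<lambda>t. F (x + t *\<^sub>R axis i 1)) has_real_derivative d) (at 0)"

lemma GDERIV_line:
  assumes "GDERIV F (x + t *\<^sub>R h) :> D"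
  shows "((\<lambda>t. F (x + t *\<^sub>R h)) has_real_derivative h \<bullet> D) (at t)"
proof -
  have "((\<lambda>t. F (x + t *\<^sub>R h)) has_derivative (\<lambda>s. (s *\<^sub>R h) \<bullet> D)) (at t)"
    by (rule has_derivative_compose[where f="\<lambda>t. x + t *\<^sub>R h"])
      (use assms in \<open>auto simp: gderiv_def intro!: derivative_eq_intros\<close>)
  then show ?thesis unfolding has_field_derivative_def
    by (simp add: mult.commute[of _ "h \<bullet> D"])
qed

lemma GDERIV_partial: "GDERIV F x :> D \<Longrightarrow> partial i F x (D $ i)"
  using GDERIV_line[of F x 0 "axis i 1" D] by (simp add: partial_def inner_axis')

lemma partial_line:
  assumes "partial i F (x + t *\<^sub>R axis i 1) d"
  shows "((\<lambda>t. F (x + t *\<^sub>R axis i 1)) has_real_derivative d) (at t)"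
proof -
  have "((\<lambda>s. F (x + (t + s) *\<^sub>R axis i 1)) has_real_derivative d) (at 0)"
    using assms by (simp add: partial_def algebra_simps)
  then show ?thesis by (simp add: DERIV_def)
qed

text \<open>By translation invariance the difference quotients of \<open>P\<close> have integral \<open>0\<close>; by the mean value
  theorem they converge uniformly to \<open>P'\<close>, which is uniformly continuous. This avoids iterated integrals.\<close>

lemma integral_partial_eq_0:
  fixes P P' :: "real ^ 'n \<Rightarrow> real"
  assumes P: "continuous_on UNIV P" and P': "continuous_on UNIV P'"
    and part: "\<And>x. partial i P x (P' x)"
    and K: "compact K" "\<And>x. x \<notin> K \<Longrightarrow> P x = 0" "\<And>x. x \<notin> K \<Longrightarrow> P' x = 0"
  shows "(LBINT x. P' x) = 0"
proof -
  let ?e = "axis i 1 :: real ^ 'n"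
  obtain R where R: "\<And>x. x \<in> K \<Longrightarrow> norm x \<le> R"
    using compact_imp_bounded[OF K(1)] bounded_iff by metis
  define \<mu> where "\<mu> = measure lborel (cball (0::real^'n) (R+1))"
  have Pm: "P \<in> borel_measurable borel" using P borel_measurable_continuous_onI by blast
  have iP: "integrable lborel P" "integrable lborel P'"
    using continuous_bounded_support(1) P P' K by blast+
  have key: "\<bar>\<integral>x. P' x \<partial>lborel\<bar> \<le> \<epsilon> * \<mu>" if "0 < \<epsilon>" for \<epsilon>
  proof -
    have "uniformly_continuous_on UNIV P'"
      by (rule continuous_bounded_support(2)[OF P' _ K(1)]) (rule K(3))
    then obtain d where d: "0 < d" "\<And>x x'. dist x' x < d \<Longrightarrow> dist (P' x') (P' x) < \<epsilon>"
      using \<open>0 < \<epsilon>\<close> unfolding uniformly_continuous_on_def by (metis UNIV_I)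
    define t where "t = min (d/2) 1"
    have t: "0 < t" "t < d" "t \<le> 1" using d(1) by (auto simp: t_def)
    have bd: "\<bar>P (x + t *\<^sub>R ?e) - P x - t * P' x\<bar> \<le> t * \<epsilon> * indicator (cball 0 (R+1)) x" for x
    proof (cases "norm x \<le> R + 1")
      case True
      obtain s where s: "0 < s" "s < t" "P (x + t *\<^sub>R ?e) - P (x + 0 *\<^sub>R ?e) = (t - 0) * P' (x + s *\<^sub>R ?e)"
        using MVT2[OF t(1), of "\<lambda>s. P (x + s *\<^sub>R ?e)" "\<lambda>s. P' (x + s *\<^sub>R ?e)"]
          partial_line[OF part] by blast
      have "dist (x + s *\<^sub>R ?e) x < d" using s t by (simp add: dist_norm)
      then have "\<bar>P' (x + s *\<^sub>R ?e) - P' x\<bar> \<le> \<epsilon>" using d(2) by (force simp: dist_real_def)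
      then have "t * \<bar>P' (x + s *\<^sub>R ?e) - P' x\<bar> \<le> t * \<epsilon>" using t by simp
      moreover have "P (x + t *\<^sub>R ?e) - P x - t * P' x = t * (P' (x + s *\<^sub>R ?e) - P' x)"
        using s(3) by (simp add: algebra_simps)
      ultimately show ?thesis using True t by (simp add: abs_mult)
    next
      case False
      have "norm x \<le> norm (x + t *\<^sub>R ?e) + norm (t *\<^sub>R ?e)"
        by (metis add_diff_cancel_right' norm_triangle_ineq4)
      then have "norm (x + t *\<^sub>R ?e) > R" using False t by simp
      then have "x \<notin> K" "x + t *\<^sub>R ?e \<notin> K" using R False by fastforce+
      then show ?thesis using K(2,3) t(1) \<open>0 < \<epsilon>\<close> by simp
    qed
    have i1: "integrable lborel (\<lambda>x. P (x + t *\<^sub>R ?e))"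
      using lborel_integral_translate(2)[OF Pm iP(1)] .
    have "\<bar>t * (LBINT x. P' x)\<bar> = \<bar>\<integral>x. P (x + t *\<^sub>R ?e) - P x - t * P' x \<partial>lborel\<bar>"
      using i1 iP lborel_integral_translate(1)[OF Pm] by simp
    also have "\<dots> \<le> (LBINT x. \<bar>P (x + t *\<^sub>R ?e) - P x - t * P' x\<bar>)"
      by (rule integral_abs_bound)
    also have "\<dots> \<le> (\<integral>x. t * \<epsilon> * indicator (cball 0 (R+1)) x \<partial>(lborel :: (real^'n) measure))"
    proof (rule integral_mono)
      show "integrable lborel (\<lambda>x::real^'n. t * \<epsilon> * indicator (cball 0 (R+1)) x)"
        by (intro integrable_mult_right integrable_indicator_cball)
    qed (use i1 iP bd in auto)
    also have "\<dots> = t * (\<epsilon> * \<mu>)" by (simp add: \<mu>_def)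
    finally show ?thesis using t by (simp add: abs_mult)
  qed
  have "\<mu> \<ge> 0" by (simp add: \<mu>_def)
  have "\<bar>\<integral>x. P' x \<partial>lborel\<bar> \<le> 0 + e" if "0 < e" for e
  proof -
    have "\<bar>\<integral>x. P' x \<partial>lborel\<bar> \<le> e / (\<mu> + 1) * \<mu>"
      using that \<open>\<mu> \<ge> 0\<close> by (intro key) simp
    also have "\<dots> \<le> e" using that \<open>\<mu> \<ge> 0\<close> by (simp add: field_simps)
    finally show ?thesis by simp
  qed
  then have "\<bar>\<integral>x. P' x \<partial>lborel\<bar> \<le> 0" by (rule field_le_epsilon)
  then show ?thesis by simp
qed

lemma GDERIV_eq_0_off_support:
  assumes "closed K" "\<And>x. x \<notin> K \<Longrightarrow> \<eta> x = 0" "x \<notin> K" "GDERIV \<eta> x :> D"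
  shows "D = 0"
proof -
  have "GDERIV (\<lambda>x. 0) x :> D"
    unfolding gderiv_def
  proof (rule has_derivative_transform_within_open[of \<eta>])
    show "(\<eta> has_derivative (\<lambda>h. h \<bullet> D)) (at x)" using assms(4) unfolding gderiv_def .
    show "open (- K)" "x \<in> - K" using assms by auto
  qed (use assms in auto)
  then show ?thesis
    using GDERIV_const[of 0 x] unfolding gderiv_def
    by (metis has_derivative_unique inner_eq_zero_iff inner_zero_right)
qed

text \<open>The cutoff makes the product continuous across the boundary of \<open>U\<close>, although \<open>F\<close> is arbitrary outside.\<close>

lemma continuous_on_times_cutoff:
  fixes F \<eta> :: "'a::euclidean_space \<Rightarrow> real"
  assumes "open U" "compact K" "K \<subseteq> U" "continuous_on U F" "continuous_on UNIV \<eta>"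
    and "\<And>x. x \<notin> K \<Longrightarrow> \<eta> x = 0"
  shows "continuous_on UNIV (\<lambda>x. F x * \<eta> x)"
proof -
  have "continuous_on U (\<lambda>x. F x * \<eta> x)"
    using assms by (intro continuous_intros continuous_on_subset[OF assms(5)]) auto
  moreover have "continuous_on (- K) (\<lambda>x. F x * \<eta> x)"
    using assms(6) by (subst continuous_on_cong[of _ "-K" _ "\<lambda>_. 0"]) auto
  ultimately have "continuous_on (U \<union> - K) (\<lambda>x. F x * \<eta> x)"
    using assms by (intro continuous_on_open_Un) (auto simp: compact_imp_closed)
  moreover have "U \<union> - K = UNIV" using assms by auto
  ultimately show ?thesis by simp
qed

lemma integration_by_parts:
  fixes F d \<eta> :: "real ^ 'n \<Rightarrow> real"
  assumes U: "open U" "compact K" "K \<subseteq> U"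
    and F: "continuous_on U F" "continuous_on U d" "\<And>x. x \<in> U \<Longrightarrow> partial i F x (d x)"
    and \<eta>: "Ck 1 \<eta>" "\<And>x. x \<notin> K \<Longrightarrow> \<eta> x = 0"
  shows "integrable lborel (\<lambda>x. F x * grad \<eta> x $ i)" "integrable lborel (\<lambda>x. d x * \<eta> x)"
    and "(LBINT x. F x * grad \<eta> x $ i) = - (LBINT x. d x * \<eta> x)"
proof -
  have g\<eta>: "GDERIV \<eta> x :> grad \<eta> x" for x
    using \<eta>(1) Ck_Suc_GDERIV[of 0 \<eta>] by simp
  have g0: "grad \<eta> x = 0" if "x \<notin> K" for x
    using GDERIV_eq_0_off_support[OF compact_imp_closed[OF U(2)] \<eta>(2) that g\<eta>] .
  have cont: "continuous_on UNIV \<eta>" "continuous_on UNIV (\<lambda>x. grad \<eta> x $ i)"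
    using \<eta>(1) Ck_imp_continuous[of 1 \<eta>] by auto
  have c1: "continuous_on UNIV (\<lambda>x. F x * \<eta> x)"
    and c2: "continuous_on UNIV (\<lambda>x. F x * grad \<eta> x $ i)"
    and c3: "continuous_on UNIV (\<lambda>x. d x * \<eta> x)"
    using continuous_on_times_cutoff[OF U] F cont \<eta>(2) g0 by (auto simp del: Ck.simps)
  show i: "integrable lborel (\<lambda>x. F x * grad \<eta> x $ i)" "integrable lborel (\<lambda>x. d x * \<eta> x)"
    using continuous_bounded_support(1)[OF c2 _ U(2)] continuous_bounded_support(1)[OF c3 _ U(2)]
      \<eta>(2) g0 by auto
  have "(LBINT x. F x * grad \<eta> x $ i + d x * \<eta> x) = 0"
  proof (rule integral_partial_eq_0[OF c1 _ _ U(2)])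
    show "continuous_on UNIV (\<lambda>x. F x * grad \<eta> x $ i + d x * \<eta> x)"
      using c2 c3 by (rule continuous_on_add)
    show "partial i (\<lambda>x. F x * \<eta> x) x (F x * grad \<eta> x $ i + d x * \<eta> x)" for x
    proof (cases "x \<in> U")
      case True
      show ?thesis
        using DERIV_mult[OF F(3)[OF True, unfolded partial_def] GDERIV_partial[OF g\<eta>, unfolded partial_def]]
        by (simp add: partial_def algebra_simps)
    next
      case False
      then have "x \<notin> K" using U by auto
      have "\<forall>\<^sub>F t in nhds 0. x + t *\<^sub>R axis i 1 \<in> - K"
      proof (rule topological_tendstoD)
        show "((\<lambda>t. x + t *\<^sub>R axis i 1) \<longlongrightarrow> x) (nhds (0::real))"
          by (auto intro!: tendsto_eq_intros simp: filterlim_ident)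
      qed (use \<open>x \<notin> K\<close> U compact_imp_closed in auto)
      then have ev: "\<forall>\<^sub>F t in nhds 0. 0 = F (x + t *\<^sub>R axis i 1) * \<eta> (x + t *\<^sub>R axis i 1)"
        by (rule eventually_mono) (use \<eta>(2) in simp)
      have "((\<lambda>t. 0) has_real_derivative 0) (at 0)" by simp
      then have "partial i (\<lambda>x. F x * \<eta> x) x 0" unfolding partial_def
        using DERIV_cong_ev[OF refl ev refl] by blast
      then show ?thesis using \<open>x \<notin> K\<close> \<eta>(2) g0 by simp
    qed
  qed (use \<eta>(2) g0 in auto)
  then show "(LBINT x. F x * grad \<eta> x $ i) = - (LBINT x. d x * \<eta> x)"
    using i by simp
qed

definition conv :: "(real ^ 'n \<Rightarrow> real) \<Rightarrow> (real ^ 'n \<Rightarrow> real) \<Rightarrow> real ^ 'n \<Rightarrow> real" where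
  "conv \<kappa> z x = (LBINT y. \<kappa> (x - y) * z y)"

lemma test_functionI:
  assumes "\<And>m. Ck m \<phi>" "compact K" "K \<subseteq> U" "\<And>x. x \<notin> K \<Longrightarrow> \<phi> x = 0"
  shows "\<phi> \<in> test_functions U"
proof -
  have "closure {x. \<phi> x \<noteq> 0} \<subseteq> K"
    using assms(2,4) by (intro closure_minimal) (auto simp: compact_imp_closed)
  moreover from this have "compact (closure {x. \<phi> x \<noteq> 0})"
    using assms(2) by (metis closed_closure compact_Int_closed inf.absorb2)
  ultimately show ?thesis using assms by (auto simp: test_functions_def)
qed

lemma test_function_support:
  assumes "\<phi> \<in> test_functions U"
  obtains S where "compact S" "S \<subseteq> U" "\<And>x. x \<notin> S \<Longrightarrow> \<phi> x = 0" "\<And>x. x \<notin> S \<Longrightarrow> grad \<phi> x = 0"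
proof -
  let ?S = "closure {x. \<phi> x \<noteq> 0}"
  have S: "compact ?S" "?S \<subseteq> U" "\<And>x. x \<notin> ?S \<Longrightarrow> \<phi> x = 0"
    using assms closure_subset[of "{x. \<phi> x \<noteq> 0}"] by (auto simp: test_functions_def)
  have "Ck (Suc 0) \<phi>" using assms by (simp add: test_functions_def del: Ck.simps)
  then have g: "GDERIV \<phi> x :> grad \<phi> x" for x by (rule Ck_Suc_GDERIV)
  have "grad \<phi> x = 0" if "x \<notin> ?S" for x
    by (rule GDERIV_eq_0_off_support[OF closed_closure S(3) that g])
  with S show ?thesis by (rule that)
qed

lemma test_function_UNIV_D:
  assumes "\<kappa> \<in> test_functions UNIV"
  shows "Ck m \<kappa>" "GDERIV \<kappa> x :> grad \<kappa> x" "continuous_on UNIV \<kappa>" "uniformly_continuous_on UNIV \<kappa>"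
    "\<exists>C\<ge>0. \<forall>x. \<bar>\<kappa> x\<bar> \<le> C" "(\<lambda>x. grad \<kappa> x $ i) \<in> test_functions UNIV"
    "integrable lborel \<kappa>"
proof -
  show ck: "Ck m \<kappa>" for m using assms by (simp add: test_functions_def)
  show g: "GDERIV \<kappa> x :> grad \<kappa> x" for x using Ck_Suc_GDERIV[OF ck] .
  show c: "continuous_on UNIV \<kappa>" using Ck_imp_continuous[OF ck] .
  obtain K where K: "compact K" "K \<subseteq> UNIV" "\<And>x. x \<notin> K \<Longrightarrow> \<kappa> x = 0" "\<And>x. x \<notin> K \<Longrightarrow> grad \<kappa> x = 0"
    by (rule test_function_support[OF assms]) blast
  show "uniformly_continuous_on UNIV \<kappa>" "\<exists>C\<ge>0. \<forall>x. \<bar>\<kappa> x\<bar> \<le> C" "integrable lborel \<kappa>"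
    using continuous_bounded_support[OF c K(3,1)] by auto
  have "Ck m (\<lambda>x. grad \<kappa> x $ i)" for m using ck[of "Suc m"] by simp
  then show "(\<lambda>x. grad \<kappa> x $ i) \<in> test_functions UNIV"
    by (rule test_functionI[OF _ K(1,2)]) (simp_all add: K(4))
qed

lemma conv_integrable:
  assumes "\<kappa> \<in> test_functions UNIV" "integrable lborel z"
  shows "integrable lborel (\<lambda>y. \<kappa> (x - y) * z y)"
proof -
  obtain C where C: "\<And>x. \<bar>\<kappa> x\<bar> \<le> C" using test_function_UNIV_D(5)[OF assms(1)] by auto
  have [measurable]: "\<kappa> \<in> borel_measurable borel"
    using test_function_UNIV_D(3)[OF assms(1)] by (rule borel_measurable_continuous_onI)
  have [measurable]: "z \<in> borel_measurable borel" using assms(2) by simp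
  have iC: "integrable lborel (\<lambda>y. C * z y)" using assms(2) by simp
  show ?thesis
  proof (rule Bochner_Integration.integrable_bound[OF iC])
    show "AE y in lborel. norm (\<kappa> (x - y) * z y) \<le> norm (C * z y)"
    proof (rule AE_I2)
      fix y
      have "\<bar>\<kappa> (x-y)\<bar> \<le> \<bar>C\<bar>" using C[of "x-y"] by simp
      then show "norm (\<kappa> (x - y) * z y) \<le> norm (C * z y)" by (simp add: abs_mult mult_right_mono)
    qed
  qed measurable
qed

lemma conv_continuous:
  assumes "\<kappa> \<in> test_functions UNIV" "integrable lborel z"
  shows "continuous_on UNIV (conv \<kappa> z)"
  unfolding continuous_on_iff
proof (intro ballI allI impI)
  fix x :: "real ^ 'a" and e :: real assume "0 < e"
  define M where "M = (LBINT y. \<bar>z y\<bar>) + 1"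
  have M: "0 < M" by (simp add: M_def add_nonneg_pos)
  obtain d where d: "0 < d" "\<And>x x'. dist x' x < d \<Longrightarrow> dist (\<kappa> x') (\<kappa> x) < e / M"
    using test_function_UNIV_D(4)[OF assms(1)] \<open>0 < e\<close> M
    unfolding uniformly_continuous_on_def by (metis UNIV_I divide_pos_pos)
  have "dist (conv \<kappa> z x') (conv \<kappa> z x) < e" if "dist x' x < d" for x'
  proof -
    have "\<bar>conv \<kappa> z x' - conv \<kappa> z x\<bar> = \<bar>\<integral>y. \<kappa> (x' - y) * z y - \<kappa> (x - y) * z y \<partial>lborel\<bar>"
      unfolding conv_def using conv_integrable[OF assms] by simp
    also have "\<dots> \<le> (LBINT y. \<bar>\<kappa> (x' - y) * z y - \<kappa> (x - y) * z y\<bar>)"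
      by (rule integral_abs_bound)
    also have "\<dots> \<le> (LBINT y. e / M * \<bar>z y\<bar>)"
    proof (rule integral_mono)
      fix y
      have "dist (\<kappa> (x'-y)) (\<kappa> (x-y)) < e / M" using d(2)[of "x'-y" "x-y"] that by (simp add: dist_norm)
      then have "\<bar>\<kappa> (x'-y) - \<kappa> (x-y)\<bar> * \<bar>z y\<bar> \<le> e / M * \<bar>z y\<bar>"
        by (intro mult_right_mono) (auto simp: dist_real_def)
      then show "\<bar>\<kappa> (x' - y) * z y - \<kappa> (x - y) * z y\<bar> \<le> e / M * \<bar>z y\<bar>"
        by (simp add: abs_mult[symmetric] left_diff_distrib)
    qed (use conv_integrable[OF assms] assms in auto)
    also have "\<dots> = e * ((M - 1) / M)" by (simp add: M_def)
    also have "\<dots> < e * 1" using \<open>0 < e\<close> M by (intro mult_strict_left_mono) auto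
    finally show ?thesis by (simp add: dist_real_def)
  qed
  then show "\<exists>d>0. \<forall>x'\<in>UNIV. dist x' x < d \<longrightarrow> dist (conv \<kappa> z x') (conv \<kappa> z x) < e"
    using d(1) by blast
qed

text \<open>Only \<open>\<kappa>\<close> is differentiated, so \<open>z\<close> may be merely integrable; the first order Taylor remainder of
  \<open>\<kappa>\<close> is uniformly small because its gradient is uniformly continuous.\<close>

lemma conv_GDERIV:
  fixes \<kappa> :: "real ^ 'n \<Rightarrow> real"
  assumes "\<kappa> \<in> test_functions UNIV" "integrable lborel z"
  shows "GDERIV (conv \<kappa> z) x :> (\<chi> i. conv (\<lambda>x. grad \<kappa> x $ i) z x)"
proof -
  let ?D = "\<chi> i. conv (\<lambda>x. grad \<kappa> x $ i) z x"
  note gT = test_function_UNIV_D(6)[OF assms(1)]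
  define M where "M = (LBINT y. \<bar>z y\<bar>) + 1"
  have M: "0 < M" by (simp add: M_def add_nonneg_pos)
  have dot: "h \<bullet> ?D = (LBINT y. (h \<bullet> grad \<kappa> (x - y)) * z y)"
    and doti: "integrable lborel (\<lambda>y. (h \<bullet> grad \<kappa> (x - y)) * z y)" for h
  proof -
    have eq: "(h \<bullet> grad \<kappa> (x - y)) * z y = (\<Sum>i\<in>UNIV. h $ i * (grad \<kappa> (x - y) $ i * z y))" for y
      by (simp add: inner_vec_def sum_distrib_right mult.assoc)
    show "integrable lborel (\<lambda>y. (h \<bullet> grad \<kappa> (x - y)) * z y)"
      unfolding eq using conv_integrable[OF gT assms(2)] by (intro Bochner_Integration.integrable_sum) auto
    show "h \<bullet> ?D = (LBINT y. (h \<bullet> grad \<kappa> (x - y)) * z y)"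
      unfolding eq using conv_integrable[OF gT assms(2)]
      by (subst Bochner_Integration.integral_sum) (auto simp: inner_vec_def conv_def)
  qed
  have "uniformly_continuous_on UNIV (\<lambda>x. grad \<kappa> x $ i)" for i
    using test_function_UNIV_D(4)[OF gT] .
  then have uc: "uniformly_continuous_on UNIV (grad \<kappa>)"
    unfolding uniformly_continuous_on_sequentially
    by (auto intro!: vec_tendstoI simp: dist_norm tendsto_norm_zero_iff)
      (auto intro!: vec_tendstoI simp: dist_real_def tendsto_rabs_zero_iff)
  have "((\<lambda>h. norm (conv \<kappa> z (x + h) - conv \<kappa> z x - h \<bullet> ?D) / norm h) \<longlongrightarrow> 0) (at 0)"
    unfolding tendsto_iff
  proof (intro allI impI)
    fix e :: real assume "0 < e"
    obtain d where d: "0 < d" "\<And>x x'. dist x' x < d \<Longrightarrow> dist (grad \<kappa> x') (grad \<kappa> x) < e / M"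
      using uc \<open>0 < e\<close> M unfolding uniformly_continuous_on_def by (metis UNIV_I divide_pos_pos)
    have "norm (conv \<kappa> z (x + h) - conv \<kappa> z x - h \<bullet> ?D) / norm h < e" if h: "h \<noteq> 0" "norm h < d" for h
    proof -
      have mv: "\<bar>\<kappa> (p + h) - \<kappa> p - h \<bullet> grad \<kappa> p\<bar> \<le> norm h * (e / M)" for p
      proof -
        obtain s where s: "0 < s" "s < 1" "\<kappa> (p + 1 *\<^sub>R h) - \<kappa> (p + 0 *\<^sub>R h) = (1 - 0) * (h \<bullet> grad \<kappa> (p + s *\<^sub>R h))"
          using MVT2[of 0 1 "\<lambda>s. \<kappa> (p + s *\<^sub>R h)" "\<lambda>s. h \<bullet> grad \<kappa> (p + s *\<^sub>R h)"]
            GDERIV_line[OF test_function_UNIV_D(2)[OF assms(1)]] by auto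
        have "s * norm h \<le> 1 * norm h" using s by (intro mult_right_mono) auto
        then have "s * norm h < d" using h by linarith
        then have "norm (grad \<kappa> (p + s *\<^sub>R h) - grad \<kappa> p) \<le> e / M"
          using d(2)[of "p + s *\<^sub>R h" p] s by (simp add: dist_norm)
        then have "\<bar>h \<bullet> (grad \<kappa> (p + s *\<^sub>R h) - grad \<kappa> p)\<bar> \<le> norm h * (e / M)"
          using Cauchy_Schwarz_ineq2[of h "grad \<kappa> (p + s *\<^sub>R h) - grad \<kappa> p"]
          by (meson mult_left_mono norm_ge_zero order_trans)
        then show ?thesis using s(3) by (simp add: inner_diff_right)
      qed
      have "\<bar>conv \<kappa> z (x + h) - conv \<kappa> z x - h \<bullet> ?D\<bar>
          = \<bar>\<integral>y. \<kappa> (x + h - y) * z y - \<kappa> (x - y) * z y - (h \<bullet> grad \<kappa> (x - y)) * z y \<partial>lborel\<bar>"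
        unfolding dot unfolding conv_def using conv_integrable[OF assms] doti by simp
      also have "\<dots> \<le> (LBINT y. \<bar>\<kappa> (x + h - y) * z y - \<kappa> (x - y) * z y - (h \<bullet> grad \<kappa> (x - y)) * z y\<bar>)"
        by (rule integral_abs_bound)
      also have "\<dots> \<le> (LBINT y. norm h * (e / M) * \<bar>z y\<bar>)"
      proof (rule integral_mono)
        fix y
        have "\<bar>\<kappa> (x - y + h) - \<kappa> (x - y) - h \<bullet> grad \<kappa> (x - y)\<bar> * \<bar>z y\<bar> \<le> norm h * (e / M) * \<bar>z y\<bar>"
          using mv by (intro mult_right_mono) auto
        moreover have "x - y + h = x + h - y" by simp
        ultimately show "\<bar>\<kappa> (x + h - y) * z y - \<kappa> (x - y) * z y - (h \<bullet> grad \<kappa> (x - y)) * z y\<bar>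
            \<le> norm h * (e / M) * \<bar>z y\<bar>"
          by (simp only: abs_mult[symmetric] left_diff_distrib)
      qed (use conv_integrable[OF assms] assms doti in auto)
      also have "\<dots> = norm h * (e * ((M - 1) / M))" by (simp add: M_def)
      also have "\<dots> < norm h * (e * 1)"
        using \<open>0 < e\<close> M h by (intro mult_strict_left_mono) auto
      finally show ?thesis using h by (simp add: divide_less_eq mult.commute)
    qed
    then show "\<forall>\<^sub>F h in at 0. dist (norm (conv \<kappa> z (x + h) - conv \<kappa> z x - h \<bullet> ?D) / norm h) 0 < e"
      unfolding eventually_at using d(1) by (intro exI[of _ d]) auto
  qed
  then show ?thesis unfolding gderiv_def has_derivative_at
    by (auto intro: bounded_linear_inner_left)
qed

lemma conv_Ck: "\<kappa> \<in> test_functions UNIV \<Longrightarrow> integrable lborel z \<Longrightarrow> Ck m (conv \<kappa> z)"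
proof (induction m arbitrary: \<kappa>)
  case 0
  then show ?case by (simp add: conv_continuous)
next
  case (Suc m)
  then show ?case
    by (intro Ck_SucI[OF conv_GDERIV]) (auto intro: test_function_UNIV_D(6))
qed

section \<open>Mollification in the mean square\<close>

definition square_integrable :: "('a::euclidean_space \<Rightarrow> real) \<Rightarrow> bool" where
  "square_integrable V \<longleftrightarrow> V \<in> borel_measurable borel \<and> integrable lborel (\<lambda>x. (V x)\<^sup>2)"

lemma square_integrable_mult:
  assumes "square_integrable B" "square_integrable V"
  shows "integrable lborel (\<lambda>x. B x * V x)"
proof (rule Bochner_Integration.integrable_bound)
  show "integrable lborel (\<lambda>x. (B x)\<^sup>2 + (V x)\<^sup>2)"
    using assms by (simp add: square_integrable_def)
  show "(\<lambda>x. B x * V x) \<in> borel_measurable lborel"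
    using assms by (auto simp: square_integrable_def intro!: borel_measurable_times)
  show "AE x in lborel. norm (B x * V x) \<le> norm ((B x)\<^sup>2 + (V x)\<^sup>2)"
  proof (rule AE_I2)
    fix x
    have "0 \<le> (\<bar>B x\<bar> - \<bar>V x\<bar>)\<^sup>2" "0 \<le> \<bar>B x\<bar> * \<bar>V x\<bar>" by simp_all
    then have "\<bar>B x\<bar> * \<bar>V x\<bar> \<le> (B x)\<^sup>2 + (V x)\<^sup>2"
      unfolding power2_diff power2_abs by linarith
    then show "norm (B x * V x) \<le> norm ((B x)\<^sup>2 + (V x)\<^sup>2)"
      by (simp add: abs_mult)
  qed
qed

lemma square_integrable_add:
  assumes "square_integrable B" "square_integrable V"
  shows "square_integrable (\<lambda>x. B x + V x)"
  unfolding square_integrable_def power2_sum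
  using assms square_integrable_mult[OF assms]
  by (auto simp: square_integrable_def mult.assoc)

lemma square_integrable_cmult:
  "square_integrable V \<Longrightarrow> square_integrable (\<lambda>x. c * V x)"
  by (auto simp: square_integrable_def power_mult_distrib)

lemma square_integrable_diff:
  assumes "square_integrable B" "square_integrable V"
  shows "square_integrable (\<lambda>x. B x - V x)"
  using square_integrable_add[OF assms(1) square_integrable_cmult[OF assms(2), of "-1"]] by simp

lemma square_integrable_bounded_support:
  assumes "V \<in> borel_measurable borel" "\<And>x. \<bar>V x\<bar> \<le> C" "\<And>x. x \<notin> cball 0 R \<Longrightarrow> V x = 0"
  shows "square_integrable V"
  unfolding square_integrable_def
proof (intro conjI assms(1))
  show "integrable lborel (\<lambda>x. (V x)\<^sup>2)"
  proof (rule Bochner_Integration.integrable_bound)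
    show "integrable lborel (\<lambda>x::'a. C\<^sup>2 * indicator (cball 0 R) x)"
      by (intro integrable_mult_right integrable_indicator_cball)
    show "AE x in lborel. norm ((V x)\<^sup>2) \<le> norm (C\<^sup>2 * indicator (cball 0 R) x)"
    proof (rule AE_I2)
      fix x show "norm ((V x)\<^sup>2) \<le> norm (C\<^sup>2 * indicator (cball 0 R) x)"
        using assms(3)[of x] power_mono[OF assms(2)[of x], of 2] by (cases "x \<in> cball 0 R") auto
    qed
  qed (use assms(1) in simp)
qed

lemma square_integrable_translate:
  assumes "square_integrable V"
  shows "square_integrable (\<lambda>x. V (x + h))"
proof -
  have "(\<lambda>x. (V x)\<^sup>2) \<in> borel_measurable borel"
    using assms by (intro borel_measurable_power) (simp add: square_integrable_def)
  from lborel_integral_translate(2)[OF this] show ?thesis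
    using assms by (auto simp: square_integrable_def)
qed

text \<open>Cut off large arguments and large values, write the result as an almost everywhere limit of
  continuous functions, and clamp these; both limits are controlled by dominated convergence.\<close>

lemma square_integrable_approx_continuous:
  fixes V :: "'a::euclidean_space \<Rightarrow> real"
  assumes V: "square_integrable V" and e: "0 < e"
  obtains W R where "continuous_on UNIV W" "\<And>x. x \<notin> cball 0 R \<Longrightarrow> W x = 0"
    "(LBINT x. (V x - W x)\<^sup>2) < e"
proof -
  have [measurable]: "V \<in> borel_measurable borel" using V by (simp add: square_integrable_def)
  have iV: "integrable lborel (\<lambda>x. (V x)\<^sup>2)" using V by (simp add: square_integrable_def)
  define T where "T m x = (if norm x \<le> real m \<and> \<bar>V x\<bar> \<le> real m then V x else 0)" for m x
  have [measurable]: "T m \<in> borel_measurable borel" for m unfolding T_def by measurable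
  have "(\<lambda>m. \<integral>x. (V x - T m x)\<^sup>2 \<partial>lborel) \<longlonglongrightarrow> (\<integral>x. 0 \<partial>(lborel::'a measure))"
  proof (rule integral_dominated_convergence[OF _ _ iV])
    show "AE x in lborel. (\<lambda>m. (V x - T m x)\<^sup>2) \<longlonglongrightarrow> 0"
    proof (rule AE_I2, rule tendsto_eventually)
      fix x
      obtain m0 where "max (norm x) \<bar>V x\<bar> \<le> real m0" using real_arch_simple by blast
      then have "(V x - T m x)\<^sup>2 = 0" if "m0 \<le> m" for m
        using that by (simp add: T_def)
      then show "\<forall>\<^sub>F m in sequentially. (V x - T m x)\<^sup>2 = 0"
        unfolding eventually_sequentially by blast
    qed
    show "AE x in lborel. norm ((V x - T m x)\<^sup>2) \<le> (V x)\<^sup>2" for m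
      by (rule AE_I2) (simp add: T_def)
  qed simp_all
  then have "\<forall>\<^sub>F m in sequentially. (LBINT x. (V x - T m x)\<^sup>2) < e / 4"
    using e by (intro order_tendstoD(2)[where y=0]) auto
  then obtain m where m: "(LBINT x. (V x - T m x)\<^sup>2) < e / 4"
    unfolding eventually_sequentially by blast
  have "T m measurable_on UNIV"
    by (rule lebesgue_measurable_imp_measurable_on) (auto intro: measurable_completion)
  then obtain N g where N: "negligible N" and g: "\<And>n. continuous_on UNIV (g n)"
      "\<And>x. x \<notin> N \<Longrightarrow> (\<lambda>n. g n x) \<longlonglongrightarrow> T m x"
    unfolding measurable_on_def by (auto simp del: if_image_distrib)
  define W where "W n x = max 0 (min 1 (real m + 1 - norm x)) * max (- real m) (min (real m) (g n x))" for n x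
  have Wc: "continuous_on UNIV (W n)" for n
    unfolding W_def using g(1) by (intro continuous_intros)
  then have [measurable]: "W n \<in> borel_measurable borel" for n
    by (rule borel_measurable_continuous_onI)
  have Wb: "\<bar>W n x\<bar> \<le> real m" for n x
  proof -
    have "\<bar>max (- real m) (min (real m) (g n x))\<bar> \<le> real m" by (simp add: abs_le_iff)
    then have "\<bar>W n x\<bar> \<le> 1 * real m" unfolding W_def abs_mult by (intro mult_mono) auto
    then show ?thesis by simp
  qed
  have W0: "W n x = 0" if "x \<notin> cball 0 (real m + 1)" for n x
    using that by (simp add: W_def)
  have T0: "\<bar>T m x\<bar> \<le> real m" "x \<notin> cball 0 (real m + 1) \<Longrightarrow> T m x = 0" for x
    by (auto simp: T_def)
  have "(\<lambda>n. \<integral>x. (T m x - W n x)\<^sup>2 \<partial>lborel) \<longlonglongrightarrow> (\<integral>x. 0 \<partial>(lborel::'a measure))"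
  proof (rule integral_dominated_convergence)
    show "integrable lborel (\<lambda>x::'a. (2 * real m)\<^sup>2 * indicator (cball 0 (real m + 1)) x)"
      by (intro integrable_mult_right integrable_indicator_cball)
    show "AE x in lborel. norm ((T m x - W n x)\<^sup>2) \<le> (2 * real m)\<^sup>2 * indicator (cball 0 (real m + 1)) x" for n
    proof (rule AE_I2)
      fix x
      have "\<bar>T m x - W n x\<bar> \<le> 2 * real m" using T0(1)[of x] Wb[of n x] by linarith
      then have "(T m x - W n x)\<^sup>2 \<le> (2 * real m)\<^sup>2"
        using power_mono[of "\<bar>T m x - W n x\<bar>" "2 * real m" 2] by simp
      then show "norm ((T m x - W n x)\<^sup>2) \<le> (2 * real m)\<^sup>2 * indicator (cball 0 (real m + 1)) x"
        using W0[of x n] T0(2)[of x] by (cases "x \<in> cball 0 (real m + 1)") auto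
    qed
    have "N \<in> null_sets lebesgue" using N negligible_iff_null_sets by blast
    then have "AE x in lebesgue. x \<notin> N" by (rule AE_not_in)
    then have "AE x in lborel. x \<notin> N" by (simp add: AE_completion_iff)
    then show "AE x in lborel. (\<lambda>n. (T m x - W n x)\<^sup>2) \<longlonglongrightarrow> 0"
    proof eventually_elim
      case (elim x)
      have "(\<lambda>n. W n x) \<longlonglongrightarrow> max 0 (min 1 (real m + 1 - norm x)) * max (- real m) (min (real m) (T m x))"
        unfolding W_def by (intro tendsto_intros g(2) elim)
      moreover have "max 0 (min 1 (real m + 1 - norm x)) * max (- real m) (min (real m) (T m x)) = T m x"
      proof (cases "norm x \<le> real m")
        case True then show ?thesis using T0(1)[of x] by (simp add: abs_le_iff max_def min_def)
      qed (simp add: T_def)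
      ultimately have "(\<lambda>n. (T m x - W n x)\<^sup>2) \<longlonglongrightarrow> (T m x - T m x)\<^sup>2"
        by (intro tendsto_intros) auto
      then show ?case by simp
    qed
  qed simp_all
  then have "\<forall>\<^sub>F n in sequentially. (LBINT x. (T m x - W n x)\<^sup>2) < e / 4"
    using e by (intro order_tendstoD(2)[where y=0]) auto
  then obtain n where n: "(LBINT x. (T m x - W n x)\<^sup>2) < e / 4"
    unfolding eventually_sequentially by blast
  have sT: "square_integrable (T m)" by (rule square_integrable_bounded_support[OF _ T0]) simp_all
  have sW: "square_integrable (W n)" by (rule square_integrable_bounded_support[OF _ Wb W0]) simp_all
  have i: "integrable lborel (\<lambda>x. (V x - T m x)\<^sup>2)" "integrable lborel (\<lambda>x. (T m x - W n x)\<^sup>2)"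
    "integrable lborel (\<lambda>x. (V x - W n x)\<^sup>2)"
    using square_integrable_diff[OF V sT] square_integrable_diff[OF sT sW] square_integrable_diff[OF V sW]
    by (auto simp: square_integrable_def)
  have "(LBINT x. (V x - W n x)\<^sup>2) \<le> (LBINT x. 2 * (V x - T m x)\<^sup>2 + 2 * (T m x - W n x)\<^sup>2)"
  proof (rule integral_mono)
    fix x
    have "0 \<le> ((V x - T m x) - (T m x - W n x))\<^sup>2" by simp
    then show "(V x - W n x)\<^sup>2 \<le> 2 * (V x - T m x)\<^sup>2 + 2 * (T m x - W n x)\<^sup>2"
      by (simp add: power2_eq_square algebra_simps)
  qed (use i in auto)
  also have "\<dots> < e" using i m n by simp
  finally show ?thesis using that[of "W n" "real m + 1"] Wc W0 by blast
qed

text \<open>For continuous functions of bounded support this is uniform continuity; the general case follows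
  since translation preserves the distance in the mean square.\<close>

lemma square_integrable_translation_continuous:
  fixes V :: "'a::euclidean_space \<Rightarrow> real"
  assumes V: "square_integrable V" and e: "0 < e"
  obtains d where "0 < d" "\<And>h. norm h < d \<Longrightarrow> (LBINT x. (V (x + h) - V x)\<^sup>2) < e"
proof -
  obtain W R where W: "continuous_on UNIV W" "\<And>x. x \<notin> cball 0 R \<Longrightarrow> W x = 0"
    "(LBINT x. (V x - W x)\<^sup>2) < e / 12"
    using square_integrable_approx_continuous[OF V, of "e/12"] e by auto
  have Wm: "W \<in> borel_measurable borel" using W(1) by (rule borel_measurable_continuous_onI)
  obtain C where C: "\<And>x. \<bar>W x\<bar> \<le> C"
    using continuous_bounded_support(3)[OF W(1,2) compact_cball] by blast
  have sW: "square_integrable W" by (rule square_integrable_bounded_support[OF Wm C W(2)])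
  define \<mu> where "\<mu> = measure lborel (cball (0::'a) (R+1))"
  have \<mu>: "0 \<le> \<mu>" by (simp add: \<mu>_def)
  \<comment> \<open>Three error terms, each entering with factor \<open>3\<close>; \<open>\<mu> + 1\<close> avoids division by \<open>0\<close>.\<close>
  define r where "r = sqrt (e / (6 * (\<mu> + 1)))"
  have r: "0 < r" "r\<^sup>2 = e / (6 * (\<mu> + 1))" using e \<mu> by (auto simp: r_def)
  have "uniformly_continuous_on UNIV W" using continuous_bounded_support(2)[OF W(1,2) compact_cball] .
  then obtain d where d: "0 < d" "\<And>x x'. dist x' x < d \<Longrightarrow> dist (W x') (W x) < r"
    using r unfolding uniformly_continuous_on_def by (metis UNIV_I)
  have "(LBINT x. (V (x + h) - V x)\<^sup>2) < e" if h: "norm h < min d 1" for h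
  proof -
    have sD: "square_integrable (\<lambda>x. V x - W x)" by (rule square_integrable_diff[OF V sW])
    have i: "integrable lborel (\<lambda>x. (V (x + h) - W (x + h))\<^sup>2)" "integrable lborel (\<lambda>x. (V x - W x)\<^sup>2)"
      "integrable lborel (\<lambda>x. (W (x + h) - W x)\<^sup>2)" "integrable lborel (\<lambda>x. (V (x + h) - V x)\<^sup>2)"
      using square_integrable_translate[OF sD, of h] sD
        square_integrable_diff[OF square_integrable_translate[OF sW, of h] sW]
        square_integrable_diff[OF square_integrable_translate[OF V, of h] V]
      by (auto simp: square_integrable_def)
    have tr: "(LBINT x. (V (x + h) - W (x + h))\<^sup>2) = (LBINT x. (V x - W x)\<^sup>2)"
      using sD by (intro lborel_integral_translate(1)[of "\<lambda>x. (V x - W x)\<^sup>2" h] borel_measurable_power)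
        (simp add: square_integrable_def)
    have "(LBINT x. (W (x + h) - W x)\<^sup>2) \<le> (\<integral>x. r\<^sup>2 * indicator (cball 0 (R+1)) x \<partial>(lborel :: 'a measure))"
    proof (rule integral_mono)
      show "integrable lborel (\<lambda>x::'a. r\<^sup>2 * indicator (cball 0 (R+1)) x)"
        by (intro integrable_mult_right integrable_indicator_cball)
      fix x
      show "(W (x + h) - W x)\<^sup>2 \<le> r\<^sup>2 * indicator (cball 0 (R+1)) x"
      proof (cases "norm x \<le> R + 1")
        case True
        have "\<bar>W (x + h) - W x\<bar> < r" using d(2)[of "x + h" x] h by (simp add: dist_norm)
        then show ?thesis using True power_mono[of "\<bar>W (x + h) - W x\<bar>" r 2] by simp
      next
        case False
        have "norm x \<le> norm (x + h) + norm h"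
          by (metis add_diff_cancel_right' norm_triangle_ineq4)
        then show ?thesis using False h W(2)[of x] W(2)[of "x + h"] by simp
      qed
    qed (use i in simp)
    also have "\<dots> = r\<^sup>2 * \<mu>" by (simp add: \<mu>_def)
    also have "\<dots> \<le> r\<^sup>2 * (\<mu> + 1)" by (intro mult_left_mono) auto
    also have "\<dots> = e / 6" using r \<mu> by (simp add: field_simps)
    finally have w: "(LBINT x. (W (x + h) - W x)\<^sup>2) \<le> e / 6" .
    have "(LBINT x. (V (x + h) - V x)\<^sup>2)
        \<le> (LBINT x. 3 * (V (x + h) - W (x + h))\<^sup>2 + 3 * (W (x + h) - W x)\<^sup>2 + 3 * (V x - W x)\<^sup>2)"
    proof (rule integral_mono)
      fix x
      define a b c where "a = V (x + h) - W (x + h)" and "b = W (x + h) - W x" and "c = W x - V x"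
      have "0 \<le> (a - b)\<^sup>2 + (b - c)\<^sup>2 + (a - c)\<^sup>2" by simp
      then have "(a + b + c)\<^sup>2 \<le> 3 * a\<^sup>2 + 3 * b\<^sup>2 + 3 * c\<^sup>2"
        by (simp add: power2_eq_square algebra_simps)
      then show "(V (x + h) - V x)\<^sup>2 \<le> 3 * (V (x + h) - W (x + h))\<^sup>2 + 3 * (W (x + h) - W x)\<^sup>2 + 3 * (V x - W x)\<^sup>2"
        by (simp add: a_def b_def c_def power2_commute[of "W x"])
    qed (use i in auto)
    also have "\<dots> = 3 * (LBINT x. (V (x + h) - W (x + h))\<^sup>2) + 3 * (LBINT x. (W (x + h) - W x)\<^sup>2)
        + 3 * (LBINT x. (V x - W x)\<^sup>2)"
      using i by simp
    also have "\<dots> < e" using w W(3) tr e by simp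
    finally show ?thesis .
  qed
  then show ?thesis using that[of "min d 1"] d(1) by auto
qed

text \<open>For an even kernel the convolution averages the translates of \<open>V\<close>, the form used in the estimates.\<close>

lemma conv_even_eq:
  assumes \<kappa>: "\<kappa> \<in> borel_measurable borel" "\<And>y. \<kappa> (- y) = \<kappa> y" and V: "V \<in> borel_measurable borel"
  shows "conv \<kappa> V x = (LBINT h. \<kappa> h * V (x + h))"
proof -
  have m: "(\<lambda>y. \<kappa> (y - x) * V y) \<in> borel_measurable borel"
    using \<kappa>(1) V by measurable
  have "conv \<kappa> V x = (LBINT y. \<kappa> (y - x) * V y)"
    unfolding conv_def using \<kappa>(2) by (metis minus_diff_eq)
  also have "\<dots> = (LBINT h. \<kappa> (h + x - x) * V (h + x))"
    using lborel_integral_translate(1)[OF m, of x] by simp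
  finally show ?thesis by (simp add: add.commute)
qed

text \<open>Tonelli reduces the claim to one translate at a time, where \<open>2 b v \<le> s b\<^sup>2 + v\<^sup>2 / s\<close> and continuity
  of translations apply. The estimate is uniform in the kernel; weighting by a fixed \<open>B\<close> is all that
  testing the equation requires.\<close>

lemma mollification_converges:
  fixes B V :: "real ^ 'n \<Rightarrow> real"
  assumes B: "square_integrable B" and V: "square_integrable V" "integrable lborel V" and e: "0 < e"
  obtains d where "0 < d"
    "\<And>\<kappa>. \<kappa> \<in> test_functions UNIV \<Longrightarrow> (\<And>y. 0 \<le> \<kappa> y) \<Longrightarrow> (\<And>y. \<kappa> (- y) = \<kappa> y) \<Longrightarrow>
       (LBINT y. \<kappa> y) = 1 \<Longrightarrow> (\<And>y. d \<le> norm y \<Longrightarrow> \<kappa> y = 0) \<Longrightarrow>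
       (\<integral>\<^sup>+x. ennreal (\<bar>B x\<bar> * \<bar>conv \<kappa> V x - V x\<bar>) \<partial>lborel) \<le> ennreal e"
proof -
  define b where "b = (LBINT x. (B x)\<^sup>2)"
  have b: "0 \<le> b" by (simp add: b_def)
  \<comment> \<open>The weight in the inequality between products and squares; \<open>b + 1\<close> keeps it finite when \<open>B\<close> vanishes.\<close>
  define s where "s = e / (b + 1)"
  have s: "0 < s" "s * b \<le> e" using e b by (auto simp: s_def field_simps)
  obtain d where d: "0 < d" "\<And>h. norm h < d \<Longrightarrow> (LBINT x. (V (x + h) - V x)\<^sup>2) < e * s"
    using square_integrable_translation_continuous[OF V(1), of "e * s"] e s by auto
  have [measurable]: "B \<in> borel_measurable borel" "V \<in> borel_measurable borel"
    using B V by (auto simp: square_integrable_def)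
  have iB: "integrable lborel (\<lambda>x. (B x)\<^sup>2)" using B by (simp add: square_integrable_def)
  have inner: "(\<integral>\<^sup>+x. ennreal (\<bar>B x\<bar> * \<bar>V (x + h) - V x\<bar>) \<partial>lborel) \<le> ennreal e" if h: "norm h < d" for h
  proof -
    have "square_integrable (\<lambda>x. V (x + h) - V x)"
      by (rule square_integrable_diff[OF square_integrable_translate[OF V(1)] V(1)])
    then have i: "integrable lborel (\<lambda>x. (V (x + h) - V x)\<^sup>2)" by (simp add: square_integrable_def)
    have "(\<integral>\<^sup>+x. ennreal (\<bar>B x\<bar> * \<bar>V (x + h) - V x\<bar>) \<partial>lborel)
        \<le> (\<integral>\<^sup>+x. ennreal (s / 2 * (B x)\<^sup>2 + 1 / (2 * s) * (V (x + h) - V x)\<^sup>2) \<partial>lborel)"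
    proof (rule nn_integral_mono, rule ennreal_leI)
      fix x
      have "0 \<le> (s * \<bar>B x\<bar> - \<bar>V (x + h) - V x\<bar>)\<^sup>2" by simp
      then have "2 * s * (\<bar>B x\<bar> * \<bar>V (x + h) - V x\<bar>) \<le> s\<^sup>2 * (B x)\<^sup>2 + (V (x + h) - V x)\<^sup>2"
        by (simp add: power2_diff power_mult_distrib mult_ac)
      then have "\<bar>B x\<bar> * \<bar>V (x + h) - V x\<bar> \<le> (s\<^sup>2 * (B x)\<^sup>2 + (V (x + h) - V x)\<^sup>2) / (2 * s)"
        using s by (simp add: pos_le_divide_eq mult_ac)
      also have "\<dots> = s / 2 * (B x)\<^sup>2 + 1 / (2 * s) * (V (x + h) - V x)\<^sup>2"
        using s by (simp add: field_simps power2_eq_square)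
      finally show "\<bar>B x\<bar> * \<bar>V (x + h) - V x\<bar> \<le> s / 2 * (B x)\<^sup>2 + 1 / (2 * s) * (V (x + h) - V x)\<^sup>2" .
    qed
    also have "\<dots> = ennreal (LBINT x. s / 2 * (B x)\<^sup>2 + 1 / (2 * s) * (V (x + h) - V x)\<^sup>2)"
      using i iB s by (intro nn_integral_eq_integral) auto
    also have "\<dots> = ennreal (s / 2 * b + 1 / (2 * s) * (LBINT x. (V (x + h) - V x)\<^sup>2))"
      using i iB by (simp add: b_def)
    also have "\<dots> \<le> ennreal e"
    proof (rule ennreal_leI)
      have "1 / (2 * s) * (LBINT x. (V (x + h) - V x)\<^sup>2) \<le> 1 / (2 * s) * (e * s)"
        using d(2)[OF h] s by (intro mult_left_mono) auto
      also have "\<dots> = e / 2" using s by simp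
      finally show "s / 2 * b + 1 / (2 * s) * (LBINT x. (V (x + h) - V x)\<^sup>2) \<le> e" using s by simp
    qed
    finally show ?thesis .
  qed
  show ?thesis
  proof (rule that[OF d(1)])
    fix \<kappa> :: "real ^ 'n \<Rightarrow> real"
    assume \<kappa>: "\<kappa> \<in> test_functions UNIV" "\<And>y. 0 \<le> \<kappa> y" "\<And>y. \<kappa> (- y) = \<kappa> y"
      "(LBINT y. \<kappa> y) = 1" "\<And>y. d \<le> norm y \<Longrightarrow> \<kappa> y = 0"
    have [measurable]: "\<kappa> \<in> borel_measurable borel"
      using test_function_UNIV_D(3)[OF \<kappa>(1)] by (rule borel_measurable_continuous_onI)
    have i\<kappa>: "integrable lborel \<kappa>" by (rule test_function_UNIV_D(7)[OF \<kappa>(1)])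
    obtain C where C: "\<And>x. \<bar>\<kappa> x\<bar> \<le> C" using test_function_UNIV_D(5)[OF \<kappa>(1)] by auto
    have s\<kappa>: "square_integrable \<kappa>"
      by (rule square_integrable_bounded_support[where R=d, OF _ C]) (use \<kappa>(5) in auto)
    have "ennreal (\<bar>B x\<bar> * \<bar>conv \<kappa> V x - V x\<bar>)
        \<le> (\<integral>\<^sup>+h. ennreal (\<kappa> h * (\<bar>B x\<bar> * \<bar>V (x + h) - V x\<bar>)) \<partial>lborel)" for x
    proof -
      have i1: "integrable lborel (\<lambda>h. \<kappa> h * V (x + h))"
        using square_integrable_mult[OF s\<kappa> square_integrable_translate[OF V(1), of x]]
        by (simp add: add.commute)
      have "conv \<kappa> V x - V x = (LBINT h. \<kappa> h * V (x + h)) - (LBINT h. \<kappa> h * V x)"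
        using \<kappa>(4) by (simp add: conv_even_eq \<kappa>(3))
      also have "\<dots> = (LBINT h. \<kappa> h * (V (x + h) - V x))"
        using i1 i\<kappa> by (simp add: right_diff_distrib)
      finally have "ennreal (\<bar>B x\<bar> * \<bar>conv \<kappa> V x - V x\<bar>)
          = ennreal (norm (LBINT h. \<bar>B x\<bar> * (\<kappa> h * (V (x + h) - V x))))"
        by (simp add: abs_mult)
      also have "\<dots> \<le> (\<integral>\<^sup>+h. ennreal (norm (\<bar>B x\<bar> * (\<kappa> h * (V (x + h) - V x)))) \<partial>lborel)"
      proof (rule integral_norm_bound_ennreal)
        show "integrable lborel (\<lambda>h. \<bar>B x\<bar> * (\<kappa> h * (V (x + h) - V x)))"
          using i1 i\<kappa> by (simp add: right_diff_distrib)
      qed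
      also have "\<dots> = (\<integral>\<^sup>+h. ennreal (\<kappa> h * (\<bar>B x\<bar> * \<bar>V (x + h) - V x\<bar>)) \<partial>lborel)"
        using \<kappa>(2) by (simp add: abs_mult mult_ac)
      finally show ?thesis .
    qed
    then have "(\<integral>\<^sup>+x. ennreal (\<bar>B x\<bar> * \<bar>conv \<kappa> V x - V x\<bar>) \<partial>lborel)
        \<le> (\<integral>\<^sup>+x. \<integral>\<^sup>+h. ennreal (\<kappa> h * (\<bar>B x\<bar> * \<bar>V (x + h) - V x\<bar>)) \<partial>lborel \<partial>lborel)"
      by (intro nn_integral_mono)
    also have "\<dots> = (\<integral>\<^sup>+h. \<integral>\<^sup>+x. ennreal (\<kappa> h * (\<bar>B x\<bar> * \<bar>V (x + h) - V x\<bar>)) \<partial>lborel \<partial>lborel)"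
      by (rule lborel_pair.Fubini') measurable
    also have "\<dots> \<le> (\<integral>\<^sup>+h. ennreal (\<kappa> h) * ennreal e \<partial>lborel)"
    proof (rule nn_integral_mono)
      fix h
      have "(\<integral>\<^sup>+x. ennreal (\<kappa> h * (\<bar>B x\<bar> * \<bar>V (x + h) - V x\<bar>)) \<partial>lborel)
          = ennreal (\<kappa> h) * (\<integral>\<^sup>+x. ennreal (\<bar>B x\<bar> * \<bar>V (x + h) - V x\<bar>) \<partial>lborel)"
        using \<kappa>(2) by (simp add: ennreal_mult nn_integral_cmult)
      also have "\<dots> \<le> ennreal (\<kappa> h) * ennreal e"
        using inner[of h] \<kappa>(5)[of h] by (cases "norm h < d") (auto intro: mult_left_mono)
      finally show "(\<integral>\<^sup>+x. ennreal (\<kappa> h * (\<bar>B x\<bar> * \<bar>V (x + h) - V x\<bar>)) \<partial>lborel) \<le> ennreal (\<kappa> h) * ennreal e" .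
    qed
    also have "\<dots> = ennreal e"
      using nn_integral_eq_integral[OF i\<kappa>] \<kappa>(2,4) by (simp add: nn_integral_multc)
    finally show "(\<integral>\<^sup>+x. ennreal (\<bar>B x\<bar> * \<bar>conv \<kappa> V x - V x\<bar>) \<partial>lborel) \<le> ennreal e" .
  qed
qed

section \<open>Approximating truncations of weakly differentiable functions\<close>

lemma bump_0_mono: "0 < s \<Longrightarrow> s \<le> t \<Longrightarrow> bump 0 s \<le> bump 0 t"
  by (auto simp: bump_def intro!: divide_left_mono mult_pos_pos)

lemma mollifier_exists:
  assumes "0 < d"
  obtains \<kappa> :: "real ^ 'n \<Rightarrow> real" where "\<kappa> \<in> test_functions UNIV" "\<And>y. 0 \<le> \<kappa> y"
    "\<And>y. \<kappa> (- y) = \<kappa> y" "(LBINT y. \<kappa> y) = 1" "\<And>y. d \<le> norm y \<Longrightarrow> \<kappa> y = 0"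
proof -
  define \<beta> :: "real ^ 'n \<Rightarrow> real" where "\<beta> y = bump 0 (d\<^sup>2 - (norm y)\<^sup>2)" for y
  have "Ck m (\<lambda>y::real^'n. bump 0 (d\<^sup>2 + (-1) * (norm (y - 0))\<^sup>2))" for m
    by (intro Ck_bump Ck_add Ck_mult Ck_const Ck_norm_sq)
  then have ck: "Ck m \<beta>" for m by (simp add: \<beta>_def[abs_def])
  have nn: "0 \<le> \<beta> y" for y by (simp add: \<beta>_def bump_nonneg)
  have z: "\<beta> y = 0" if "d \<le> norm y" for y
    using power_mono[OF that, of 2] assms by (simp add: \<beta>_def bump_eq_0)
  have c: "continuous_on UNIV \<beta>" using Ck_imp_continuous[OF ck] .
  have i: "integrable lborel \<beta>"
    by (rule continuous_bounded_support(1)[OF c _ compact_cball[of 0 d]]) (use z in auto)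
  \<comment> \<open>The normalising constant: \<open>\<beta>\<close> is bounded below on the ball of half the radius.\<close>
  have pos: "0 < (LBINT y. \<beta> y)"
  proof -
    define c where "c = bump 0 (3 * d\<^sup>2 / 4)"
    have "0 < c" using assms by (simp add: c_def bump_pos)
    then have "0 < c * measure lborel (cball (0::real^'n) (d/2))"
      using assms content_cball_pos[of "d/2" "0::real^'n"] by simp
    also have "\<dots> = (\<integral>y. c * indicator (cball 0 (d/2)) y \<partial>(lborel :: (real^'n) measure))" by simp
    also have "\<dots> \<le> (LBINT y. \<beta> y)"
    proof (rule integral_mono)
      fix y :: "real ^ 'n"
      show "c * indicator (cball 0 (d/2)) y \<le> \<beta> y"
      proof (cases "norm y \<le> d / 2")
        case True
        have "(norm y)\<^sup>2 \<le> d\<^sup>2 / 4" using power_mono[OF True, of 2] by (simp add: power_divide)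
        then have "c \<le> \<beta> y" unfolding c_def \<beta>_def using assms by (intro bump_0_mono) auto
        then show ?thesis using True by simp
      qed (use nn in simp)
    qed (use i integrable_indicator_cball in auto)
    finally show ?thesis .
  qed
  define I where "I = (LBINT y. \<beta> y)"
  show ?thesis
  proof (rule that[of "\<lambda>y. inverse I * \<beta> y"])
    show "(\<lambda>y. inverse I * \<beta> y) \<in> test_functions UNIV"
      by (rule test_functionI[OF _ compact_cball[of 0 d]]) (use ck z in \<open>auto intro!: Ck_mult Ck_const\<close>)
    show "(LBINT y. inverse I * \<beta> y) = 1" using pos by (simp add: I_def)
  qed (use nn pos z in \<open>auto simp: I_def \<beta>_def\<close>)
qed

lemma Ck_reflect: "Ck m \<kappa> \<Longrightarrow> Ck m (\<lambda>y. \<kappa> (x - y))"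
  and GDERIV_reflect: "GDERIV \<kappa> (x - y) :> D \<Longrightarrow> GDERIV (\<lambda>y. \<kappa> (x - y)) y :> - D"
proof -
  show gd: "GDERIV (\<lambda>y. \<kappa> (x - y)) y :> - D" if "GDERIV \<kappa> (x - y) :> D" for \<kappa> y D
  proof -
    have "((\<lambda>y. \<kappa> (x - y)) has_derivative (\<lambda>h. (- h) \<bullet> D)) (at y)"
      by (rule has_derivative_compose[where f="\<lambda>y. x - y"])
        (use that in \<open>auto simp: gderiv_def intro!: derivative_eq_intros\<close>)
    then show ?thesis by (simp add: gderiv_def)
  qed
  show "Ck m \<kappa> \<Longrightarrow> Ck m (\<lambda>y. \<kappa> (x - y))"
  proof (induction m arbitrary: \<kappa>)
    case 0
    then have "continuous_on UNIV (\<kappa> \<circ> (\<lambda>y. x - y))"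
      by (intro continuous_on_compose continuous_intros) (auto intro: continuous_on_subset)
    then show ?case by (simp add: o_def)
  next
    case (Suc m)
    have "Ck m (\<lambda>y. (-1) * grad \<kappa> (x - y) $ i)" for i
      using Suc.prems by (intro Ck_mult Ck_const Suc.IH) simp
    then show ?case
      by (intro Ck_SucI[where D="\<lambda>y. - grad \<kappa> (x - y)"] gd Ck_Suc_GDERIV[OF Suc.prems]) auto
  qed
qed

lemma test_function_mono: "\<phi> \<in> test_functions U \<Longrightarrow> U \<subseteq> U' \<Longrightarrow> \<phi> \<in> test_functions U'"
  by (auto simp: test_functions_def)

text \<open>The nonlinear function \<open>bump 0 (z x)\<close> is the test function that the comparison argument wants, and
  its gradient should be \<open>bump 2 (z x) V x\<close>, since \<open>bump 2\<close> is the derivative of \<open>bump 0\<close>. As \<open>z\<close> is only weakly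
  differentiable, mollify first and compose afterwards: the result is smooth, nonnegative and, because
  \<open>z \<le> 0\<close> off \<open>K\<close>, supported near \<open>K\<close>. On its support the gradient of the mollified \<open>z\<close> is the mollified \<open>V\<close>.\<close>

lemma truncation_approximation:
  fixes z :: "real ^ 'n \<Rightarrow> real" and V B :: "'n \<Rightarrow> real ^ 'n \<Rightarrow> real"
  assumes D: "open D" "compact K" "K \<subseteq> D" "K \<noteq> {}"
    and z: "continuous_on D z" "z \<in> borel_measurable borel" "\<And>x. \<bar>z x\<bar> \<le> C"
      "\<And>x. x \<notin> K \<Longrightarrow> z x \<le> 0" "integrable lborel z"
    and V: "\<And>i. square_integrable (V i)" "\<And>i. integrable lborel (V i)"
    and weak: "\<And>\<phi> i. \<phi> \<in> test_functions D \<Longrightarrow>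
      (LBINT x. z x * grad \<phi> x $ i) = - (LBINT x. V i x * \<phi> x)"
    and B: "\<And>i. square_integrable (B i)" and e: "0 < e"
  obtains \<eta> where "\<eta> \<in> test_functions D" "\<And>x. 0 \<le> \<eta> x" "\<And>x. \<bar>\<eta> x - bump 0 (z x)\<bar> \<le> e"
    "\<And>i. (LBINT x. B i x * grad \<eta> x $ i) \<le> (LBINT x. B i x * (bump 2 (z x) * V i x)) + e"
proof -
  define Kr where "Kr r = {x. infdist x K \<le> r}" for r :: real
  have Kc: "compact (Kr r)" if "0 < r" for r
    unfolding Kr_def using compact_infdist_le[OF D(4,2) that] .
  obtain r3 where r3: "0 < r3" "(\<Union>x\<in>K. cball x r3) \<subseteq> D"
    using compact_subset_open_imp_cball_epsilon_subset[OF D(2,1,3)] by blast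
  \<comment> \<open>\<open>Kr r\<close> will contain the support of the test function, and one more step \<open>r\<close> on each side is lost to the
    mollifier; all of \<open>Kr (3 * r)\<close> lies in \<open>D\<close>.\<close>
  define r where "r = r3 / 4"
  have r: "0 < r" using r3 by (simp add: r_def)
  have KrD: "Kr (3 * r) \<subseteq> D"
  proof
    fix x assume "x \<in> Kr (3 * r)"
    then have lt: "infdist x K < r3" using r3 by (simp add: Kr_def r_def)
    obtain y where "y \<in> K" "infdist x K = dist x y"
      using infdist_attains_inf[OF compact_imp_closed[OF D(2)] D(4)] by metis
    then show "x \<in> D" using r3(2) lt by (force simp: dist_commute)
  qed
  have Kadd: "y \<in> Kr (s + t)" if "x \<in> Kr s" "dist x y \<le> t" for x y s t
    using infdist_triangle[of y K x] that by (simp add: Kr_def dist_commute)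
  have K0: "K \<subseteq> Kr s" if "0 \<le> s" for s using that by (auto simp: Kr_def)
  have Kmono: "Kr s \<subseteq> Kr t" if "s \<le> t" for s t using that by (auto simp: Kr_def)
  have C0: "0 \<le> C" using z(3)[of undefined] by linarith
  define C2 where "C2 = fact 4 * C\<^sup>2"
  have C2: "\<bar>bump 2 s\<bar> \<le> C2" if "\<bar>s\<bar> \<le> C" for s
  proof -
    have "bump 2 s \<le> fact 4 * s\<^sup>2" using bump_le[of 2 s] by simp
    also have "\<dots> \<le> fact 4 * C\<^sup>2" using that power_mono[of "\<bar>s\<bar>" C 2] by simp
    finally show ?thesis using bump_nonneg[of 2 s] by (simp add: C2_def)
  qed
  have C2nn: "0 \<le> C2" by (simp add: C2_def)
  define M where "M = (\<Sum>i\<in>UNIV. \<integral>x. \<bar>B i x * V i x\<bar> \<partial>lborel)"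
  have Mi: "(LBINT x. \<bar>B i x * V i x\<bar>) \<le> M" for i
    unfolding M_def by (rule member_le_sum) auto
  have M: "0 \<le> M" by (auto simp: M_def intro!: sum_nonneg)
  define \<rho> where "\<rho> = min e (e / (2 * (M + 1)))"
  have \<rho>: "0 < \<rho>" "\<rho> \<le> e" "\<rho> * M \<le> e / 2"
  proof -
    show "0 < \<rho>" "\<rho> \<le> e" using e M by (auto simp: \<rho>_def)
    have "\<rho> * M \<le> e / (2 * (M + 1)) * M" using M by (intro mult_right_mono) (auto simp: \<rho>_def)
    also have "\<dots> \<le> e / 2" using e M by (simp add: field_simps)
    finally show "\<rho> * M \<le> e / 2" .
  qed
  have "\<exists>\<sigma>>0. \<forall>s\<in>{-C..C}. \<forall>t\<in>{-C..C}. dist t s < \<sigma> \<longrightarrow> dist (bump n t) (bump n s) < \<rho>" for n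
  proof -
    have "uniformly_continuous_on {-C..C} (bump n)"
      by (intro compact_uniformly_continuous bump_continuous) simp
    then show ?thesis using \<rho>(1) unfolding uniformly_continuous_on_def by blast
  qed
  then obtain \<sigma> where \<sigma>: "\<And>n. 0 < \<sigma> n"
    "\<And>n s t. \<lbrakk>\<bar>s\<bar> \<le> C; \<bar>t\<bar> \<le> C; \<bar>t - s\<bar> < \<sigma> n\<rbrakk> \<Longrightarrow> \<bar>bump n t - bump n s\<bar> < \<rho>"
    unfolding dist_real_def by (metis abs_le_iff atLeastAtMost_iff minus_le_iff)
  define \<tau> where "\<tau> = min (\<sigma> 0) (\<sigma> 2)"
  have \<tau>: "0 < \<tau>" using \<sigma>(1) by (simp add: \<tau>_def)
  have "uniformly_continuous_on (Kr (3 * r)) z"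
    using r by (intro compact_uniformly_continuous Kc continuous_on_subset[OF z(1) KrD]) auto
  then obtain d0 where d0: "0 < d0"
    "\<And>x x'. \<lbrakk>x \<in> Kr (3 * r); x' \<in> Kr (3 * r); dist x' x < d0\<rbrakk> \<Longrightarrow> \<bar>z x' - z x\<bar> < \<tau> / 2"
    using \<tau> unfolding uniformly_continuous_on_def dist_real_def by (metis half_gt_zero)
  define e' where "e' = e / (2 * (C2 + 1))"
  have e': "0 < e'" "C2 * e' \<le> e / 2" using e C2nn by (auto simp: e'_def field_simps)
  define close where "close i d \<longleftrightarrow> (\<forall>\<kappa>. \<kappa> \<in> test_functions UNIV \<longrightarrow> (\<forall>y. 0 \<le> \<kappa> y) \<longrightarrow> (\<forall>y. \<kappa> (- y) = \<kappa> y) \<longrightarrow>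
       (LBINT y. \<kappa> y) = 1 \<longrightarrow> (\<forall>y. d \<le> norm y \<longrightarrow> \<kappa> y = 0) \<longrightarrow>
       (\<integral>\<^sup>+x. ennreal (\<bar>B i x\<bar> * \<bar>conv \<kappa> (V i) x - V i x\<bar>) \<partial>lborel) \<le> ennreal e')" for i d
  have "\<exists>d>0. close i d" for i
    unfolding close_def
    by (rule mollification_converges[OF B[of i] V(1)[of i] V(2)[of i] e'(1)]) blast
  then obtain d1 where d1: "\<And>i. 0 < d1 i" "\<And>i. close i (d1 i)"
    by metis
  define d where "d = min (min d0 r) (Min (range d1))"
  have d: "0 < d" "d \<le> d0" "d \<le> r" "\<And>i. d \<le> d1 i"
    using d0(1) r d1(1) by (auto simp: d_def min.coboundedI2)
  obtain \<kappa> :: "real ^ 'n \<Rightarrow> real" where \<kappa>: "\<kappa> \<in> test_functions UNIV" "\<And>y. 0 \<le> \<kappa> y"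
    "\<And>y. \<kappa> (- y) = \<kappa> y" "(LBINT y. \<kappa> y) = 1" "\<And>y. d \<le> norm y \<Longrightarrow> \<kappa> y = 0"
    using mollifier_exists[OF d(1)] by metis
  have \<kappa>m [measurable]: "\<kappa> \<in> borel_measurable borel"
    using test_function_UNIV_D(3)[OF \<kappa>(1)] by (rule borel_measurable_continuous_onI)
  have i\<kappa>: "integrable lborel \<kappa>" by (rule test_function_UNIV_D(7)[OF \<kappa>(1)])
  have zm [measurable]: "z \<in> borel_measurable borel" by (rule z(2))
  \<comment> \<open>\<open>Z x\<close> is an average of values of \<open>z\<close> near \<open>x\<close>, which gives all the pointwise bounds on it.\<close>
  define Z where "Z = conv \<kappa> z"
  have iz: "integrable lborel (\<lambda>h. \<kappa> h * z (x + h))" for x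
  proof (rule Bochner_Integration.integrable_bound)
    show "integrable lborel (\<lambda>h. C * \<kappa> h)" using i\<kappa> by simp
    show "AE h in lborel. norm (\<kappa> h * z (x + h)) \<le> norm (C * \<kappa> h)"
      using mult_left_mono[OF z(3) \<kappa>(2)] C0 \<kappa>(2) by (auto simp: abs_mult mult.commute)
  qed measurable
  have Zeq: "Z x = (LBINT h. \<kappa> h * z (x + h))" for x
    unfolding Z_def by (rule conv_even_eq[OF \<kappa>m \<kappa>(3) zm])
  have avg: "Z x \<le> c" if "\<And>h. norm h < d \<Longrightarrow> z (x + h) \<le> c" for x c
  proof -
    have "Z x \<le> (LBINT h. \<kappa> h * c)" unfolding Zeq
    proof (rule integral_mono)
      fix h show "\<kappa> h * z (x + h) \<le> \<kappa> h * c"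
        using that[of h] \<kappa>(2)[of h] \<kappa>(5)[of h] by (cases "norm h < d") (auto intro: mult_left_mono)
    qed (use iz i\<kappa> in auto)
    then show ?thesis using \<kappa>(4) by simp
  qed
  have avg': "c \<le> Z x" if "\<And>h. norm h < d \<Longrightarrow> c \<le> z (x + h)" for x c
  proof -
    have "(LBINT h. \<kappa> h * c) \<le> Z x" unfolding Zeq
    proof (rule integral_mono)
      fix h show "\<kappa> h * c \<le> \<kappa> h * z (x + h)"
        using that[of h] \<kappa>(2)[of h] \<kappa>(5)[of h] by (cases "norm h < d") (auto intro: mult_left_mono)
    qed (use iz i\<kappa> in auto)
    then show ?thesis using \<kappa>(4) by simp
  qed
  have ZC: "\<bar>Z x\<bar> \<le> C" for x
    using avg[of x C] avg'[of "-C" x] z(3) by (metis abs_le_iff minus_le_iff)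
  have Zoff: "Z x \<le> 0" if "x \<notin> Kr r" for x
  proof (rule avg)
    fix h :: "real ^ 'n" assume "norm h < d"
    have "x + h \<notin> K"
    proof
      assume "x + h \<in> K"
      then have "x + h \<in> Kr 0" using K0[of 0] by auto
      then have "x \<in> Kr (0 + r)" using \<open>norm h < d\<close> d(3) by (intro Kadd) (auto simp: dist_norm)
      then show False using that by simp
    qed
    then show "z (x + h) \<le> 0" by (rule z(4))
  qed
  have Znear: "\<bar>Z x - z x\<bar> < \<tau>" if "x \<in> Kr r" for x
  proof -
    have "\<bar>z (x + h) - z x\<bar> < \<tau> / 2" if "norm h < d" for h
    proof (rule d0(2))
      show "x \<in> Kr (3 * r)" using Kmono[of r "3 * r"] r \<open>x \<in> Kr r\<close> by auto
      have "x + h \<in> Kr (r + r)" using that d(3) \<open>x \<in> Kr r\<close> by (intro Kadd) (auto simp: dist_norm)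
      then show "x + h \<in> Kr (3 * r)" using Kmono[of "r + r" "3 * r"] r by auto
      show "dist (x + h) x < d0" using that d(2) by (simp add: dist_norm)
    qed
    then have "\<And>h. norm h < d \<Longrightarrow> z (x + h) \<le> z x + \<tau> / 2" "\<And>h. norm h < d \<Longrightarrow> z x - \<tau> / 2 \<le> z (x + h)"
      by (smt (verit))+
    then have "Z x \<le> z x + \<tau> / 2" "z x - \<tau> / 2 \<le> Z x" using avg avg' by blast+
    then show ?thesis using \<tau> by linarith
  qed
  have zoff: "z x \<le> 0" if "x \<notin> Kr r" for x using z(4) K0[of r] r that by auto
  have bnear: "\<bar>bump n (Z x) - bump n (z x)\<bar> \<le> \<rho>" if "n = 0 \<or> n = 2" for x n
  proof (cases "x \<in> Kr r")
    case True
    have "\<bar>Z x - z x\<bar> < \<sigma> n" using Znear[OF True] that by (auto simp: \<tau>_def)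
    then show ?thesis using \<sigma>(2)[OF z(3) ZC] by (meson less_imp_le)
  next
    case False
    then show ?thesis using Zoff zoff \<rho>(1) by (simp add: bump_eq_0)
  qed
  define \<eta> where "\<eta> x = bump 0 (Z x)" for x
  have ckZ: "Ck m Z" for m unfolding Z_def by (rule conv_Ck[OF \<kappa>(1) z(5)])
  have \<eta>0: "\<eta> x = 0" if "x \<notin> Kr r" for x using Zoff[OF that] by (simp add: \<eta>_def bump_eq_0)
  have \<eta>T: "\<eta> \<in> test_functions D"
  proof (rule test_functionI[of _ "Kr r"])
    show "Ck m \<eta>" for m unfolding \<eta>_def[abs_def] by (rule Ck_bump[OF ckZ])
    show "Kr r \<subseteq> D" using Kmono[of r "3 * r"] r KrD by auto
  qed (use Kc r \<eta>0 in auto)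
  have gradZ: "grad Z x $ i = conv \<kappa> (V i) x" if "x \<in> Kr r" for x i
  proof -
    define \<phi> where "\<phi> y = \<kappa> (x - y)" for y
    have \<phi>: "\<phi> \<in> test_functions D"
    proof (rule test_functionI[of _ "cball x d"])
      show "Ck m \<phi>" for m unfolding \<phi>_def[abs_def] by (rule Ck_reflect[OF test_function_UNIV_D(1)[OF \<kappa>(1)]])
      show "cball x d \<subseteq> D"
      proof
        fix y assume "y \<in> cball x d"
        then have "y \<in> Kr (r + r)" using d(3) by (intro Kadd[OF that]) auto
        then show "y \<in> D" using Kmono[of "r + r" "3 * r"] r KrD by auto
      qed
      fix y assume "y \<notin> cball x d"
      then show "\<phi> y = 0" using \<kappa>(5)[of "x - y"] by (simp add: \<phi>_def dist_norm)
    qed simp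
    have g\<phi>: "grad \<phi> y = - grad \<kappa> (x - y)" for y
      unfolding \<phi>_def[abs_def]
      by (rule GDERIV_unique_grad[OF GDERIV_reflect[OF test_function_UNIV_D(2)[OF \<kappa>(1)]]])
    have "grad Z x $ i = conv (\<lambda>x. grad \<kappa> x $ i) z x"
      unfolding Z_def by (simp add: GDERIV_unique_grad[OF conv_GDERIV[OF \<kappa>(1) z(5)]])
    also have "\<dots> = - (LBINT y. z y * grad \<phi> y $ i)"
      unfolding conv_def g\<phi> by (simp add: mult.commute)
    also have "\<dots> = (LBINT y. V i y * \<phi> y)" using weak[OF \<phi>] by simp
    finally show ?thesis by (simp add: conv_def \<phi>_def mult.commute)
  qed
  have grad\<eta>: "grad \<eta> x $ i = bump 2 (Z x) * conv \<kappa> (V i) x" for x i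
  proof -
    have "grad \<eta> x = bump 2 (Z x) *\<^sub>R grad Z x"
      unfolding \<eta>_def[abs_def]
      using GDERIV_DERIV_compose[OF Ck_Suc_GDERIV[OF ckZ[of "Suc 0"]] bump_deriv[of 0]]
      by (intro GDERIV_unique_grad) (simp add: numeral_2_eq_2)
    then show ?thesis using gradZ[of x i] Zoff[of x] by (cases "x \<in> Kr r") (auto simp: bump_eq_0)
  qed
  show ?thesis
  proof (rule that[OF \<eta>T])
    show "0 \<le> \<eta> x" for x by (simp add: \<eta>_def bump_nonneg)
    show "\<bar>\<eta> x - bump 0 (z x)\<bar> \<le> e" for x using bnear[of 0 x] \<rho>(2) by (simp add: \<eta>_def)
    fix i
    have [measurable]: "B i \<in> borel_measurable borel" "V i \<in> borel_measurable borel"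
      using B V by (auto simp: square_integrable_def)
    have bm [measurable]: "bump n \<in> borel_measurable borel" for n
      by (rule borel_measurable_continuous_onI[OF bump_continuous])
    have cg: "continuous_on UNIV (\<lambda>x. grad \<eta> x $ i)"
      using test_function_UNIV_D(3)[OF test_function_UNIV_D(6)[OF test_function_mono[OF \<eta>T subset_UNIV]]] .
    have gz: "grad \<eta> x $ i = 0" if "x \<notin> Kr r" for x using Zoff[OF that] by (simp add: grad\<eta> bump_eq_0)
    obtain R where "\<forall>x\<in>Kr r. norm x \<le> R"
      using compact_imp_bounded[OF Kc[OF r]] unfolding bounded_iff by blast
    then have R: "Kr r \<subseteq> cball 0 R" by auto
    obtain Cg where Cg: "\<And>x. \<bar>grad \<eta> x $ i\<bar> \<le> Cg"
      using continuous_bounded_support(3)[OF cg gz Kc[OF r]] by blast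
    have sg: "square_integrable (\<lambda>x. grad \<eta> x $ i)"
    proof (rule square_integrable_bounded_support[where R=R, OF _ Cg])
      show "grad \<eta> x $ i = 0" if "x \<notin> cball 0 R" for x using that R gz by blast
    qed (rule borel_measurable_continuous_onI[OF cg])
    have i1: "integrable lborel (\<lambda>x. B i x * grad \<eta> x $ i)" by (rule square_integrable_mult[OF B sg])
    have iBV: "integrable lborel (\<lambda>x. B i x * V i x)" by (rule square_integrable_mult[OF B V(1)])
    have i2: "integrable lborel (\<lambda>x. B i x * (bump 2 (z x) * V i x))"
    proof (rule Bochner_Integration.integrable_bound)
      show "integrable lborel (\<lambda>x. C2 * (B i x * V i x))" using iBV by simp
      show "AE x in lborel. norm (B i x * (bump 2 (z x) * V i x)) \<le> norm (C2 * (B i x * V i x))"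
      proof (rule AE_I2)
        fix x
        have "\<bar>bump 2 (z x)\<bar> * \<bar>B i x * V i x\<bar> \<le> \<bar>C2\<bar> * \<bar>B i x * V i x\<bar>"
          using C2[OF z(3)[of x]] by (intro mult_right_mono) auto
        then show "norm (B i x * (bump 2 (z x) * V i x)) \<le> norm (C2 * (B i x * V i x))"
          by (simp add: abs_mult mult_ac)
      qed
    qed measurable
    have [measurable]: "conv \<kappa> (V i) \<in> borel_measurable borel"
      by (rule borel_measurable_continuous_onI[OF conv_continuous[OF \<kappa>(1) V(2)]])
    have "(\<integral>\<^sup>+x. ennreal (\<bar>B i x\<bar> * \<bar>conv \<kappa> (V i) x - V i x\<bar>) \<partial>lborel) \<le> ennreal e'"
    proof -
      have "\<forall>y. d1 i \<le> norm y \<longrightarrow> \<kappa> y = 0" using d(4)[of i] \<kappa>(5) by (auto intro: order_trans)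
      then show ?thesis using d1(2)[of i] \<kappa> unfolding close_def by blast
    qed
    then have i3: "integrable lborel (\<lambda>x. \<bar>B i x\<bar> * \<bar>conv \<kappa> (V i) x - V i x\<bar>)"
      and b3: "(LBINT x. \<bar>B i x\<bar> * \<bar>conv \<kappa> (V i) x - V i x\<bar>) \<le> e'"
    proof -
      assume le: "(\<integral>\<^sup>+x. ennreal (\<bar>B i x\<bar> * \<bar>conv \<kappa> (V i) x - V i x\<bar>) \<partial>lborel) \<le> ennreal e'"
      show "integrable lborel (\<lambda>x. \<bar>B i x\<bar> * \<bar>conv \<kappa> (V i) x - V i x\<bar>)"
        unfolding integrable_iff_bounded using le ennreal_less_top[of e']
        by (auto simp: abs_mult intro: le_less_trans)
      then show "(LBINT x. \<bar>B i x\<bar> * \<bar>conv \<kappa> (V i) x - V i x\<bar>) \<le> e'"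
        using le nn_integral_eq_integral[of lborel "\<lambda>x. \<bar>B i x\<bar> * \<bar>conv \<kappa> (V i) x - V i x\<bar>"] e'(1)
        by simp
    qed
    have "(LBINT x. B i x * grad \<eta> x $ i)
        \<le> (LBINT x. B i x * (bump 2 (z x) * V i x) + (C2 * (\<bar>B i x\<bar> * \<bar>conv \<kappa> (V i) x - V i x\<bar>) + \<rho> * \<bar>B i x * V i x\<bar>))"
    proof (rule integral_mono)
      fix x
      have "B i x * grad \<eta> x $ i - B i x * (bump 2 (z x) * V i x)
          = B i x * (bump 2 (Z x) * (conv \<kappa> (V i) x - V i x)) + (bump 2 (Z x) - bump 2 (z x)) * (B i x * V i x)"
        by (simp add: grad\<eta> algebra_simps)
      also have "\<dots> \<le> \<bar>B i x * (bump 2 (Z x) * (conv \<kappa> (V i) x - V i x))\<bar> + \<bar>(bump 2 (Z x) - bump 2 (z x)) * (B i x * V i x)\<bar>"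
        by linarith
      also have "\<dots> = \<bar>bump 2 (Z x)\<bar> * (\<bar>B i x\<bar> * \<bar>conv \<kappa> (V i) x - V i x\<bar>) + \<bar>bump 2 (Z x) - bump 2 (z x)\<bar> * \<bar>B i x * V i x\<bar>"
        by (simp add: abs_mult mult_ac)
      also have "\<dots> \<le> C2 * (\<bar>B i x\<bar> * \<bar>conv \<kappa> (V i) x - V i x\<bar>) + \<rho> * \<bar>B i x * V i x\<bar>"
        using C2[OF ZC[of x]] bnear[of 2 x] by (intro add_mono mult_right_mono) auto
      finally show "B i x * grad \<eta> x $ i \<le> B i x * (bump 2 (z x) * V i x) + (C2 * (\<bar>B i x\<bar> * \<bar>conv \<kappa> (V i) x - V i x\<bar>) + \<rho> * \<bar>B i x * V i x\<bar>)"
        by linarith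
    qed (use i1 i2 i3 iBV in auto)
    also have "\<dots> = (LBINT x. B i x * (bump 2 (z x) * V i x))
        + (C2 * (LBINT x. \<bar>B i x\<bar> * \<bar>conv \<kappa> (V i) x - V i x\<bar>) + \<rho> * (LBINT x. \<bar>B i x * V i x\<bar>))"
      using i2 i3 iBV by simp
    also have "\<dots> \<le> (LBINT x. B i x * (bump 2 (z x) * V i x)) + (C2 * e' + \<rho> * M)"
      using b3 C2nn Mi[of i] \<rho>(1) by (intro add_mono mult_left_mono) auto
    also have "\<dots> \<le> (LBINT x. B i x * (bump 2 (z x) * V i x)) + e"
      using e'(2) \<rho>(3) by linarith
    finally show "(LBINT x. B i x * grad \<eta> x $ i) \<le> (LBINT x. B i x * (bump 2 (z x) * V i x)) + e" .
  qed
qed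

section \<open>The comparison principle\<close>

text \<open>The gradient of the energy density when \<open>H\<close> is half the derivative of \<open>s \<mapsto> f (s\<^sup>2) s\<^sup>2\<close>.\<close>

definition flux :: "'n \<Rightarrow> (real \<Rightarrow> real) \<Rightarrow> real ^ 'n \<Rightarrow> real ^ 'n" where
  "flux k H p = (\<chi> i. if i = k then H (p $ k) else p $ i)"

lemma integral_lebesgue_on_eq_lborel:
  fixes F F' :: "'a::euclidean_space \<Rightarrow> real"
  assumes "open \<Omega>" "F \<in> borel_measurable (lebesgue_on \<Omega>)" "F' \<in> borel_measurable borel"
    and "AE x in lborel. x \<in> \<Omega> \<longrightarrow> F x = F' x" "\<And>x. x \<notin> \<Omega> \<Longrightarrow> F' x = 0"
  shows "integral\<^sup>L (lebesgue_on \<Omega>) F = (LBINT x. F' x)"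
    and "integrable (lebesgue_on \<Omega>) F \<longleftrightarrow> integrable lborel F'"
proof -
  have \<Omega>: "\<Omega> \<inter> space lebesgue \<in> sets lebesgue" using assms(1) by simp
  have m: "(\<lambda>x. indicator \<Omega> x *\<^sub>R F x) \<in> borel_measurable lebesgue"
    using assms(2) borel_measurable_restrict_space_iff[OF \<Omega>] by blast
  have m': "F' \<in> borel_measurable lebesgue"
    using assms(3) by (intro measurable_completion) simp
  have ae: "AE x in lebesgue. indicator \<Omega> x *\<^sub>R F x = F' x"
    using assms(4) by (intro AE_completion) (auto elim!: eventually_mono simp: indicator_def assms(5))
  have "integral\<^sup>L (lebesgue_on \<Omega>) F = integral\<^sup>L lebesgue F'"
    unfolding integral_restrict_space[OF \<Omega>] by (rule integral_cong_AE[OF m m' ae])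
  then show "integral\<^sup>L (lebesgue_on \<Omega>) F = (LBINT x. F' x)"
    using integral_completion[of F' lborel] assms(3) by simp
  show "integrable (lebesgue_on \<Omega>) F \<longleftrightarrow> integrable lborel F'"
    unfolding integrable_restrict_space[OF \<Omega>] integrable_cong_AE[OF m m' ae]
    using integrable_completion[of F' lborel] assms(3) by simp
qed

text \<open>Passing to a Borel function defined everywhere allows Lebesgue--Borel measure to be used throughout,
  where Tonelli and translation invariance are at hand.\<close>

lemma L2_borel_representative:
  fixes v :: "real ^ 'n \<Rightarrow> real ^ 'n"
  assumes "open \<Omega>" "v \<in> L2 \<Omega>"
  obtains v' where "\<And>i. square_integrable (\<lambda>x. v' x $ i)" "AE x in lborel. x \<in> \<Omega> \<longrightarrow> v x = v' x"
    "\<And>x. x \<notin> \<Omega> \<Longrightarrow> v' x = 0" "\<And>i. (\<lambda>x. v x $ i) \<in> borel_measurable (lebesgue_on \<Omega>)"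
proof -
  have vm: "v \<in> borel_measurable (lebesgue_on \<Omega>)"
    and vi: "integrable (lebesgue_on \<Omega>) (\<lambda>x. (norm (v x))\<^sup>2)"
    using assms(2) by (auto simp: L2_def)
  have vmi: "(\<lambda>x. v x $ i) \<in> borel_measurable (lebesgue_on \<Omega>)" for i
    by (rule measurable_compose[OF vm borel_measurable_continuous_onI[OF linear_continuous_on[OF bounded_linear_vec_nth]]])
  have "\<exists>f. f \<in> borel_measurable lborel \<and> (AE x in lborel. (if x \<in> \<Omega> then v x $ i else 0) = f x)" for i
    using completion_ex_borel_measurable_real[OF borel_measurable_if_I[OF vmi[of i]]] assms(1) by auto
  then have "\<exists>f. \<forall>i. f i \<in> borel_measurable lborel \<and> (AE x in lborel. (if x \<in> \<Omega> then v x $ i else 0) = f i x)"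
    by (intro choice allI)
  then obtain f where f: "\<And>i. f i \<in> borel_measurable lborel"
    "\<And>i. AE x in lborel. (if x \<in> \<Omega> then v x $ i else 0) = f i x" by blast
  define v' where "v' x = (\<chi> i. indicator \<Omega> x * f i x)" for x
  have ae: "AE x in lborel. x \<in> \<Omega> \<longrightarrow> v x = v' x"
  proof -
    have "AE x in lborel. \<forall>i\<in>UNIV. (if x \<in> \<Omega> then v x $ i else 0) = f i x"
      using f(2) by (intro AE_finite_allI) auto
    then show ?thesis by eventually_elim (auto simp: v'_def vec_eq_iff)
  qed
  have [measurable]: "\<Omega> \<in> sets borel" using assms(1) by simp
  have v'm: "(\<lambda>x. v' x $ i) \<in> borel_measurable borel" for i
    using f(1)[of i] unfolding v'_def by simp
  have "integrable (lebesgue_on \<Omega>) (\<lambda>x. (v x $ i)\<^sup>2)" for i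
  proof (rule Bochner_Integration.integrable_bound[OF vi])
    show "AE x in lebesgue_on \<Omega>. norm ((v x $ i)\<^sup>2) \<le> norm ((norm (v x))\<^sup>2)"
      using component_le_norm_cart by (auto intro!: AE_I2 power_mono simp: abs_le_square_iff[symmetric])
  qed (use vmi in simp)
  moreover have "integrable (lebesgue_on \<Omega>) (\<lambda>x. (v x $ i)\<^sup>2) \<longleftrightarrow> integrable lborel (\<lambda>x. (v' x $ i)\<^sup>2)" for i
    by (rule integral_lebesgue_on_eq_lborel(2)[OF assms(1)])
      (use vmi v'm ae in \<open>auto simp: v'_def elim!: eventually_mono\<close>)
  ultimately have "square_integrable (\<lambda>x. v' x $ i)" for i
    using v'm by (simp add: square_integrable_def)
  then show ?thesis using that[of v'] ae vmi by (simp add: v'_def zero_vec_def)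
qed

lemma square_integrable_indicator_mult:
  assumes "square_integrable V" "A \<in> sets borel"
  shows "square_integrable (\<lambda>x. indicator A x * V x)"
  unfolding square_integrable_def
proof
  have [measurable]: "V \<in> borel_measurable borel" "A \<in> sets borel" using assms by (auto simp: square_integrable_def)
  show "(\<lambda>x. indicator A x * V x) \<in> borel_measurable borel" by measurable
  show "integrable lborel (\<lambda>x. (indicator A x * V x)\<^sup>2)"
    by (rule Bochner_Integration.integrable_bound[of lborel "\<lambda>x. (V x)\<^sup>2"])
      (use assms in \<open>auto simp: square_integrable_def indicator_def\<close>)
qed

text \<open>Suppose \<open>w > u\<close> somewhere, and let \<open>z = w - u - \<epsilon>\<close> for a small \<open>\<epsilon>\<close>, so that \<open>z\<close> is positive only on a
  compact part of \<open>D\<close>. Testing the equation of \<open>u\<close> with (an approximation of) \<open>bump 0 (z x)\<close>, and integrating by parts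
  in the equation of \<open>w\<close>, one finds that the integral of
  \<open>bump 2 (z x)\<close> times the product of the differences of the fluxes and of the gradients is at least
  that of the strictly positive divergence times \<open>bump 0 (z x)\<close>. Monotonicity of \<open>H\<close> makes the former \<open>\<le> 0\<close>. Strictness
  of the subsolution makes the latter positive.\<close>

lemma comparison_principle:
  fixes \<Omega> D :: "(real ^ 'n) set"
  assumes \<Omega>: "open \<Omega>" "continuous_on \<Omega> u"
    and v: "v \<in> L2 \<Omega>" "weak_gradient \<Omega> u v"
    and super: "\<And>\<eta>. \<lbrakk>\<eta> \<in> test_functions \<Omega>; \<And>x. 0 \<le> \<eta> x\<rbrakk>
      \<Longrightarrow> 0 \<le> integral\<^sup>L (lebesgue_on \<Omega>) (\<lambda>x. flux k H (v x) \<bullet> grad \<eta> x)"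
    and H: "mono H" "\<And>s. (H has_real_derivative H' s) (at s)" "continuous_on UNIV H'"
      "\<And>s. \<bar>H s\<bar> \<le> C * \<bar>s\<bar>"
    and D: "open D" "bounded D" "closure D \<subseteq> \<Omega>"
    and w: "continuous_on (closure D) w" "\<And>x. \<lbrakk>x \<in> closure D; x \<notin> D\<rbrakk> \<Longrightarrow> w x \<le> u x"
    and Dw: "\<And>x. x \<in> D \<Longrightarrow> GDERIV w x :> Dw x" "\<And>i. continuous_on D (\<lambda>x. Dw x $ i)"
    and D2: "\<And>i x. x \<in> D \<Longrightarrow> partial i (\<lambda>x. Dw x $ i) x (D2 i x)" "\<And>i. continuous_on D (D2 i)"
    and sub: "\<And>x. x \<in> D \<Longrightarrow> 0 < (\<Sum>i\<in>UNIV - {k}. D2 i x) + H' (Dw x $ k) * D2 k x"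
    and x: "x \<in> D"
  shows "w x \<le> u x"
proof (rule ccontr)
  assume "\<not> w x \<le> u x"
  define \<epsilon> where "\<epsilon> = (w x - u x) / 2"
  have \<epsilon>: "0 < \<epsilon>" "w x - u x = 2 * \<epsilon>" using \<open>\<not> w x \<le> u x\<close> by (auto simp: \<epsilon>_def)
  have D\<Omega>: "D \<subseteq> \<Omega>" using D(3) closure_subset by blast
  define K where "K = {y \<in> closure D. \<epsilon> \<le> w y - u y}"
  have cwu: "continuous_on (closure D) (\<lambda>y. w y - u y)"
    by (intro continuous_intros w continuous_on_subset[OF \<Omega>(2) D(3)])
  have K: "compact K" "K \<subseteq> D" "x \<in> K"
  proof -
    have "K = closure D \<inter> (\<lambda>y. w y - u y) -` {\<epsilon>..}" by (auto simp: K_def)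
    then have "closed K" using continuous_closed_preimage[OF cwu] by simp
    moreover have "bounded K" using D(2) by (auto simp: K_def intro: bounded_subset bounded_closure)
    ultimately show "compact K" by (simp add: compact_eq_bounded_closed)
    show "K \<subseteq> D"
    proof
      fix y assume "y \<in> K"
      then show "y \<in> D" using w(2)[of y] \<epsilon>(1) by (force simp: K_def)
    qed
    show "x \<in> K" using x \<epsilon> closure_subset by (auto simp: K_def)
  qed
  obtain r where r: "0 < r" "(\<Union>y\<in>K. cball y r) \<subseteq> D"
    using compact_subset_open_imp_cball_epsilon_subset[OF K(1) D(1) K(2)] by blast
  \<comment> \<open>The data are regular on \<open>D\<close> but may be unbounded near its boundary; on the smaller set \<open>D'\<close> they are bounded.\<close>
  define D' where "D' = (\<Union>y\<in>K. ball y (r/2))"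
  have D': "open D'" "K \<subseteq> D'" using r(1) by (auto simp: D'_def)
  have clD': "closure D' \<subseteq> D"
  proof
    fix y assume "y \<in> closure D'"
    then obtain y' where y': "y' \<in> D'" "dist y' y < r/2"
      using r(1) unfolding closure_approachable by (meson half_gt_zero)
    then obtain p where p: "p \<in> K" "dist p y' < r/2" by (auto simp: D'_def)
    have "dist p y < r" using dist_triangle[of p y y'] y'(2) p(2) by simp
    then show "y \<in> D" using r(2) p(1) by force
  qed
  have D'D: "D' \<subseteq> D" using clD' closure_subset by blast
  have cD': "compact (closure D')"
    using D(2) D'D by (meson bounded_closure bounded_subset closed_closure compact_eq_bounded_closed)
  have D'm [measurable]: "D' \<in> sets borel" using D'(1) by simp
  obtain R where R: "\<And>y. y \<in> closure D' \<Longrightarrow> norm y \<le> R"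
    using compact_imp_bounded[OF cD'] unfolding bounded_iff by blast
  have bounded_on: "square_integrable (\<lambda>y. indicator D' y * f y)" "\<exists>c. \<forall>y. \<bar>indicator D' y * f y\<bar> \<le> c"
    if "continuous_on D f" for f :: "real ^ 'n \<Rightarrow> real"
  proof -
    have "compact (f ` closure D')"
      by (rule compact_continuous_image[OF continuous_on_subset[OF that clD'] cD'])
    then obtain c where c: "\<And>y. y \<in> closure D' \<Longrightarrow> \<bar>f y\<bar> \<le> c"
      by (metis bounded_real compact_imp_bounded imageI)
    have b: "\<bar>indicator D' y * f y\<bar> \<le> max c 0" for y
      using c[of y] closure_subset[of D'] by (auto simp: indicator_def)
    then show "\<exists>c. \<forall>y. \<bar>indicator D' y * f y\<bar> \<le> c" by blast
    show "square_integrable (\<lambda>y. indicator D' y * f y)"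
    proof (rule square_integrable_bounded_support[where R=R, OF _ b])
      show "(\<lambda>y. indicator D' y * f y) \<in> borel_measurable borel"
        using borel_measurable_continuous_on_indicator[OF D'm continuous_on_subset[OF that D'D]] by simp
      fix y :: "real ^ 'n" assume "y \<notin> cball 0 R"
      then show "indicator D' y * f y = 0" using R[of y] closure_subset[of D'] by (auto simp: indicator_def)
    qed
  qed
  have ind: "square_integrable (indicator D' :: real ^ 'n \<Rightarrow> real)"
    using bounded_on(1)[of "\<lambda>_. 1"] by simp
  obtain v' where v': "\<And>i. square_integrable (\<lambda>x. v' x $ i)" "AE x in lborel. x \<in> \<Omega> \<longrightarrow> v x = v' x"
    "\<And>x. x \<notin> \<Omega> \<Longrightarrow> v' x = 0" and vm: "\<And>i. (\<lambda>x. v x $ i) \<in> borel_measurable (lebesgue_on \<Omega>)"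
    by (rule L2_borel_representative[OF \<Omega>(1) v(1)]) blast
  have v'm [measurable]: "(\<lambda>x. v' x $ i) \<in> borel_measurable borel" for i
    using v'(1) by (simp add: square_integrable_def)
  define z where "z y = indicator D' y * (w y - u y - \<epsilon>)" for y
  define V where "V i y = indicator D' y * (Dw y $ i - v' y $ i)" for i y
  define B where "B i y = indicator D' y * (flux k H (v' y) $ i - flux k H (Dw y) $ i)" for i y
  have Hc: "continuous_on S H" for S
    by (meson H(2) DERIV_isCont continuous_at_imp_continuous_on)
  have [measurable]: "H \<in> borel_measurable borel" by (rule borel_measurable_continuous_onI[OF Hc])
  have cwuD: "continuous_on D (\<lambda>y. w y - u y - \<epsilon>)"
    by (intro continuous_intros continuous_on_subset[OF cwu closure_subset])
  have zc: "continuous_on D' z"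
    using continuous_on_subset[OF cwuD D'D] by (rule continuous_on_eq) (simp add: z_def)
  have zs: "square_integrable z" unfolding z_def[abs_def] by (rule bounded_on(1)[OF cwuD])
  obtain Cz where Cz: "\<And>y. \<bar>z y\<bar> \<le> Cz" using bounded_on(2)[OF cwuD] unfolding z_def[symmetric] by blast
  have zi: "integrable lborel z"
    using square_integrable_mult[OF ind zs] by (simp add: z_def[abs_def] mult.assoc[symmetric] flip: indicator_inter_arith)
  have z0: "z y \<le> 0" if "y \<notin> K" for y
    using that D'D closure_subset[of D] by (auto simp: z_def K_def indicator_def)
  have Vs: "square_integrable (V i)" for i
    unfolding V_def[abs_def] right_diff_distrib
    by (intro square_integrable_diff bounded_on(1) Dw(2) square_integrable_indicator_mult v'(1) D'm)
  have Vi: "integrable lborel (V i)" for i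
    using square_integrable_mult[OF ind Vs[of i]]
    by (simp add: V_def[abs_def] mult.assoc[symmetric] flip: indicator_inter_arith)
  have fs: "square_integrable (\<lambda>y. flux k H (v' y) $ i)" for i
  proof (cases "i = k")
    case True
    have "integrable lborel (\<lambda>y. (H (v' y $ k))\<^sup>2)"
    proof (rule Bochner_Integration.integrable_bound)
      show "integrable lborel (\<lambda>y. C\<^sup>2 * (v' y $ k)\<^sup>2)" using v'(1)[of k] by (simp add: square_integrable_def)
      show "AE y in lborel. norm ((H (v' y $ k))\<^sup>2) \<le> norm (C\<^sup>2 * (v' y $ k)\<^sup>2)"
      proof (rule AE_I2)
        fix y
        show "norm ((H (v' y $ k))\<^sup>2) \<le> norm (C\<^sup>2 * (v' y $ k)\<^sup>2)"
          using power_mono[OF H(4)[of "v' y $ k"], of 2] by (simp add: power_mult_distrib)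
      qed
    qed measurable
    then show ?thesis using True by (simp add: flux_def square_integrable_def)
  qed (use v'(1) in \<open>simp add: flux_def\<close>)
  have fwc: "continuous_on D (\<lambda>y. flux k H (Dw y) $ i)" for i
    using Dw(2) by (cases "i = k") (auto simp: flux_def intro: continuous_on_compose2[OF Hc])
  have Bs: "square_integrable (B i)" for i
    unfolding B_def[abs_def] right_diff_distrib
    by (intro square_integrable_diff bounded_on(1) fwc square_integrable_indicator_mult fs D'm)
  define E where "E i y = (if i = k then H' (Dw y $ k) * D2 k y else D2 i y)" for i y
  have Ec: "continuous_on D (E i)" for i
  proof (cases "i = k")
    case True
    have "continuous_on D (\<lambda>y. H' (Dw y $ k))" by (rule continuous_on_compose2[OF H(3) Dw(2)]) simp
    then show ?thesis using True D2(2) by (simp add: E_def continuous_on_mult)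
  qed (use D2(2) in \<open>simp add: E_def\<close>)
  have Ep: "partial i (\<lambda>y. flux k H (Dw y) $ i) y (E i y)" if "y \<in> D" for i y
  proof (cases "i = k")
    case True
    have "((\<lambda>t. H (Dw (y + t *\<^sub>R axis k 1) $ k)) has_real_derivative H' (Dw (y + 0 *\<^sub>R axis k 1) $ k) * D2 k y) (at 0)"
      by (rule DERIV_chain2[OF H(2)]) (use D2(1)[OF that, of k] in \<open>simp add: partial_def\<close>)
    then show ?thesis using True by (simp add: partial_def flux_def E_def)
  qed (use D2(1)[OF that] in \<open>simp add: flux_def E_def\<close>)
  have Esum: "0 < (\<Sum>i\<in>UNIV. E i y)" if "y \<in> D" for y
    using sub[OF that] by (subst sum.remove[of _ k]) (auto simp: E_def)
  have weak: "(LBINT y. z y * grad \<phi> y $ i) = - (LBINT y. V i y * \<phi> y)"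
    if \<phi>: "\<phi> \<in> test_functions D'" for \<phi> i
  proof -
    obtain S where S: "compact S" "S \<subseteq> D'" "\<And>y. y \<notin> S \<Longrightarrow> \<phi> y = 0"
      and g0: "\<And>y. y \<notin> S \<Longrightarrow> grad \<phi> y = 0"
      by (rule test_function_support[OF \<phi>]) blast
    have \<phi>U: "\<phi> \<in> test_functions UNIV" "\<phi> \<in> test_functions \<Omega>"
      using \<phi> D'D D\<Omega> test_function_mono by blast+
    have c: "continuous_on UNIV \<phi>" "continuous_on UNIV (\<lambda>y. grad \<phi> y $ i)"
      using test_function_UNIV_D(3)[OF \<phi>U(1)] test_function_UNIV_D(3)[OF test_function_UNIV_D(6)[OF \<phi>U(1)]] by blast+
    have [measurable]: "\<phi> \<in> borel_measurable borel" by (rule borel_measurable_continuous_onI[OF c(1)])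
    have w1: "integrable lborel (\<lambda>y. (w y - \<epsilon>) * grad \<phi> y $ i)" "integrable lborel (\<lambda>y. Dw y $ i * \<phi> y)"
      "(LBINT y. (w y - \<epsilon>) * grad \<phi> y $ i) = - (LBINT y. Dw y $ i * \<phi> y)"
    proof -
      have 1: "continuous_on D' (\<lambda>y. w y - \<epsilon>)"
        using D'D closure_subset[of D] by (intro continuous_intros continuous_on_subset[OF w(1)]) auto
      have 2: "continuous_on D' (\<lambda>y. Dw y $ i)" by (rule continuous_on_subset[OF Dw(2) D'D])
      have 3: "partial i (\<lambda>y. w y - \<epsilon>) y (Dw y $ i)" if "y \<in> D'" for y
        using GDERIV_partial[OF GDERIV_diff[OF Dw(1) GDERIV_const]] that D'D by auto
      have 4: "Ck 1 \<phi>" by (rule test_function_UNIV_D(1)[OF \<phi>U(1)])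
      show "integrable lborel (\<lambda>y. (w y - \<epsilon>) * grad \<phi> y $ i)" "integrable lborel (\<lambda>y. Dw y $ i * \<phi> y)"
        "(LBINT y. (w y - \<epsilon>) * grad \<phi> y $ i) = - (LBINT y. Dw y $ i * \<phi> y)"
        using integration_by_parts[OF D'(1) S(1,2) 1 2 3 4 S(3)] by auto
    qed
    have S\<Omega>: "S \<subseteq> \<Omega>" using S(2) D'D D\<Omega> by blast
    have uc: "continuous_on UNIV (\<lambda>y. u y * grad \<phi> y $ i)"
      by (rule continuous_on_times_cutoff[OF \<Omega>(1) S(1) S\<Omega> \<Omega>(2) c(2)]) (simp add: g0)
    have ui: "integrable lborel (\<lambda>y. u y * grad \<phi> y $ i)"
      by (rule continuous_bounded_support(1)[OF uc _ S(1)]) (simp add: g0)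
    have um: "(\<lambda>y. u y * grad \<phi> y $ i) \<in> borel_measurable borel"
      by (rule borel_measurable_continuous_onI[OF uc])
    have L1: "integral\<^sup>L (lebesgue_on \<Omega>) (\<lambda>y. u y * grad \<phi> y $ i) = (LBINT y. u y * grad \<phi> y $ i)"
    proof (rule integral_lebesgue_on_eq_lborel(1)[OF \<Omega>(1) _ um])
      show "(\<lambda>y. u y * grad \<phi> y $ i) \<in> borel_measurable (lebesgue_on \<Omega>)"
        using um by (intro measurable_restrict_space1 measurable_completion) simp
      show "u y * grad \<phi> y $ i = 0" if "y \<notin> \<Omega>" for y
      proof -
        have "y \<notin> S" using that S\<Omega> by blast
        then show ?thesis by (simp add: g0)
      qed
    qed simp
    have L2: "integral\<^sup>L (lebesgue_on \<Omega>) (\<lambda>y. v y $ i * \<phi> y) = (LBINT y. v' y $ i * \<phi> y)"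
    proof (rule integral_lebesgue_on_eq_lborel(1)[OF \<Omega>(1)])
      have "\<phi> \<in> borel_measurable (lebesgue_on \<Omega>)"
        by (intro measurable_restrict_space1 measurable_completion) simp
      then show "(\<lambda>y. v y $ i * \<phi> y) \<in> borel_measurable (lebesgue_on \<Omega>)" using vm by simp
      show "AE y in lborel. y \<in> \<Omega> \<longrightarrow> v y $ i * \<phi> y = v' y $ i * \<phi> y"
        using v'(2) by eventually_elim auto
      show "v' y $ i * \<phi> y = 0" if "y \<notin> \<Omega>" for y using v'(3)[OF that] by simp
    qed measurable
    have weq: "(LBINT y. u y * grad \<phi> y $ i) = - (LBINT y. v' y $ i * \<phi> y)"
      using v(2) \<phi>U(2) L1 L2 unfolding weak_gradient_def by simp
    have \<phi>s: "square_integrable \<phi>"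
    proof -
      obtain c where c: "\<And>y. \<bar>\<phi> y\<bar> \<le> c" using test_function_UNIV_D(5)[OF \<phi>U(1)] by auto
      show ?thesis
      proof (rule square_integrable_bounded_support[where R=R, OF _ c])
        fix y :: "real ^ 'n" assume "y \<notin> cball 0 R"
        then have "y \<notin> S" using S(2) R[of y] closure_subset[of D'] by auto
        then show "\<phi> y = 0" by (rule S(3))
      qed simp
    qed
    have vi: "integrable lborel (\<lambda>y. v' y $ i * \<phi> y)" by (rule square_integrable_mult[OF v'(1) \<phi>s])
    have "(LBINT y. z y * grad \<phi> y $ i) = (LBINT y. (w y - \<epsilon>) * grad \<phi> y $ i - u y * grad \<phi> y $ i)"
    proof (intro Bochner_Integration.integral_cong refl)
      fix y show "z y * grad \<phi> y $ i = (w y - \<epsilon>) * grad \<phi> y $ i - u y * grad \<phi> y $ i"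
        using S(2) g0[of y] by (cases "y \<in> S") (auto simp: z_def algebra_simps)
    qed
    also have "\<dots> = - (LBINT y. Dw y $ i * \<phi> y - v' y $ i * \<phi> y)"
      using w1 ui vi weq by simp
    also have "(LBINT y. Dw y $ i * \<phi> y - v' y $ i * \<phi> y) = (LBINT y. V i y * \<phi> y)"
    proof (intro Bochner_Integration.integral_cong refl)
      fix y show "Dw y $ i * \<phi> y - v' y $ i * \<phi> y = V i y * \<phi> y"
        using S(2,3) by (cases "y \<in> S") (auto simp: V_def algebra_simps)
    qed
    finally show ?thesis .
  qed
  \<comment> \<open>The fluxes are diagonal, so monotonicity can be used component by component.\<close>
  have BV: "B i y * (bump 2 (z y) * V i y) \<le> 0" for i y
  proof -
    have mon: "(H a - H b) * (b - a) \<le> 0" for a b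
      using H(1) by (cases "a \<le> b") (auto simp: mult_le_0_iff mono_def)
    have "(flux k H (v' y) $ i - flux k H (Dw y) $ i) * (Dw y $ i - v' y $ i) \<le> 0"
    proof (cases "i = k")
      case True then show ?thesis using mon by (simp add: flux_def)
    next
      case False
      have "(v' y $ i - Dw y $ i) * (Dw y $ i - v' y $ i) = - (v' y $ i - Dw y $ i)\<^sup>2"
        by (simp add: power2_eq_square algebra_simps)
      then show ?thesis using False by (simp add: flux_def)
    qed
    then have "bump 2 (z y) * ((flux k H (v' y) $ i - flux k H (Dw y) $ i) * (Dw y $ i - v' y $ i)) \<le> 0"
      using bump_nonneg by (simp add: mult_le_0_iff)
    then show ?thesis by (simp add: B_def V_def indicator_def mult_ac)
  qed
  obtain c1 where c1: "0 < c1" "\<And>y. y \<in> closure D' \<Longrightarrow> c1 \<le> (\<Sum>i\<in>UNIV. E i y)"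
  proof -
    have "continuous_on (closure D') (\<lambda>y. \<Sum>i\<in>UNIV. E i y)"
      by (intro continuous_intros continuous_on_subset[OF Ec clD'])
    moreover have "closure D' \<noteq> {}" using K(3) D'(2) closure_subset by blast
    ultimately obtain y0 where "y0 \<in> closure D'" "\<And>y. y \<in> closure D' \<Longrightarrow> (\<Sum>i\<in>UNIV. E i y0) \<le> (\<Sum>i\<in>UNIV. E i y)"
      using continuous_attains_inf[OF cD'] by blast
    then show ?thesis using that[of "\<Sum>i\<in>UNIV. E i y0"] Esum clD' by blast
  qed
  obtain r1 where r1: "0 < r1" "\<And>y. y \<in> cball x r1 \<Longrightarrow> y \<in> D' \<and> \<epsilon> / 2 \<le> z y"
  proof -
    have xD': "x \<in> D'" using K(3) D'(2) by blast
    have "z x = \<epsilon>" using xD' \<epsilon> by (simp add: z_def)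
    have "isCont z x" using zc D'(1) xD' by (simp add: continuous_on_eq_continuous_at)
    then have "\<forall>\<^sub>F y in nhds x. \<epsilon> / 2 < z y"
      using \<open>z x = \<epsilon>\<close> \<epsilon>(1) by (intro order_tendstoD(1)[of z \<epsilon>]) (auto simp: isCont_def tendsto_at_iff_tendsto_nhds)
    moreover have "\<forall>\<^sub>F y in nhds x. y \<in> D'" using xD' D'(1) by (simp add: eventually_nhds) blast
    ultimately have "\<forall>\<^sub>F y in nhds x. y \<in> D' \<and> \<epsilon> / 2 \<le> z y" by eventually_elim auto
    then obtain d where "0 < d" "\<And>y. dist y x < d \<Longrightarrow> y \<in> D' \<and> \<epsilon> / 2 \<le> z y"
      unfolding eventually_nhds_metric by blast
    then show ?thesis using that[of "d/2"] by (auto simp: dist_commute)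
  qed
  define \<mu> where "\<mu> = measure lborel (cball x r1)"
  have \<mu>: "0 < \<mu>" using content_cball_pos[OF r1(1), of x] by (simp add: \<mu>_def)
  define b where "b = bump 0 (\<epsilon> / 2)"
  have b: "0 < b" using \<epsilon>(1) by (simp add: b_def bump_pos)
  define N where "N = real CARD('n)"
  have N: "0 < N" by (simp add: N_def)
  \<comment> \<open>The gain \<open>c1 (b / 2) \<mu>\<close> over the ball around \<open>x\<close> must exceed the total error \<open>N e\<close>.\<close>
  define e where "e = min (b / 2) (c1 * b * \<mu> / (4 * N))"
  have e: "0 < e" "e \<le> b / 2" "N * e \<le> c1 * b * \<mu> / 4"
  proof -
    show "0 < e" "e \<le> b / 2" using b c1 \<mu> N by (auto simp: e_def)
    have "N * e \<le> N * (c1 * b * \<mu> / (4 * N))" using N by (intro mult_left_mono) (auto simp: e_def)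
    then show "N * e \<le> c1 * b * \<mu> / 4" using N by simp
  qed
  obtain \<eta> where \<eta>: "\<eta> \<in> test_functions D'" "\<And>y. 0 \<le> \<eta> y" "\<And>y. \<bar>\<eta> y - bump 0 (z y)\<bar> \<le> e"
    "\<And>i. (LBINT y. B i y * grad \<eta> y $ i) \<le> (LBINT y. B i y * (bump 2 (z y) * V i y)) + e"
  proof (rule truncation_approximation[where B=B, OF D'(1) K(1) D'(2) _ zc _ Cz z0 zi Vs Vi weak Bs e(1)])
    show "K \<noteq> {}" using K(3) by blast
    show "z \<in> borel_measurable borel" using zs by (simp add: square_integrable_def)
    fix \<eta> assume "\<eta> \<in> test_functions D'" "\<And>y. 0 \<le> \<eta> y" "\<And>y. \<bar>\<eta> y - bump 0 (z y)\<bar> \<le> e"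
      "\<And>i. (LBINT y. B i y * grad \<eta> y $ i) \<le> (LBINT y. B i y * (bump 2 (z y) * V i y)) + e"
    then show thesis by (rule that)
  qed
  obtain S where S: "compact S" "S \<subseteq> D'" "\<And>y. y \<notin> S \<Longrightarrow> \<eta> y = 0"
    and g0: "\<And>y. y \<notin> S \<Longrightarrow> grad \<eta> y = 0"
    by (rule test_function_support[OF \<eta>(1)]) blast
  have \<eta>U: "\<eta> \<in> test_functions UNIV" "\<eta> \<in> test_functions \<Omega>"
    using \<eta>(1) D'D D\<Omega> test_function_mono by blast+
  have cg: "continuous_on UNIV (\<lambda>y. grad \<eta> y $ i)" for i
    using test_function_UNIV_D(3)[OF test_function_UNIV_D(6)[OF \<eta>U(1)]] .
  have [measurable]: "(\<lambda>y. grad \<eta> y $ i) \<in> borel_measurable borel" for i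
    by (rule borel_measurable_continuous_onI[OF cg])
  have gs: "square_integrable (\<lambda>y. grad \<eta> y $ i)" for i
  proof -
    obtain c where c: "\<And>y. \<bar>grad \<eta> y $ i\<bar> \<le> c"
      using test_function_UNIV_D(5)[OF test_function_UNIV_D(6)[OF \<eta>U(1)]] by auto
    show ?thesis
    proof (rule square_integrable_bounded_support[where R=R, OF _ c])
      fix y :: "real ^ 'n" assume "y \<notin> cball 0 R"
      then have "y \<notin> S" using S(2) R[of y] closure_subset[of D'] by auto
      then show "grad \<eta> y $ i = 0" by (simp add: g0)
    qed simp
  qed
  have parts: "integrable lborel (\<lambda>y. flux k H (Dw y) $ i * grad \<eta> y $ i)" "integrable lborel (\<lambda>y. E i y * \<eta> y)"
    "(LBINT y. flux k H (Dw y) $ i * grad \<eta> y $ i) = - (LBINT y. E i y * \<eta> y)" for i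
    using integration_by_parts[OF D(1) S(1) _ fwc Ec Ep test_function_UNIV_D(1)[OF \<eta>U(1)] S(3)] S(2) D'D by auto
  have fi: "integrable lborel (\<lambda>y. flux k H (v' y) $ i * grad \<eta> y $ i)" for i
    by (rule square_integrable_mult[OF fs gs])
  have [measurable]: "(\<lambda>y. flux k H (v' y) $ i) \<in> borel_measurable borel" for i
    using fs by (simp add: square_integrable_def)
  have "0 \<le> integral\<^sup>L (lebesgue_on \<Omega>) (\<lambda>y. flux k H (v y) \<bullet> grad \<eta> y)"
    by (rule super[OF \<eta>U(2) \<eta>(2)])
  also have "\<dots> = (LBINT y. (\<Sum>i\<in>UNIV. flux k H (v' y) $ i * grad \<eta> y $ i))"
  proof (rule integral_lebesgue_on_eq_lborel(1)[OF \<Omega>(1)])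
    have "(\<lambda>y. flux k H (v y) $ i * grad \<eta> y $ i) \<in> borel_measurable (lebesgue_on \<Omega>)" for i
    proof -
      have "(\<lambda>y. grad \<eta> y $ i) \<in> borel_measurable (lebesgue_on \<Omega>)"
        by (intro measurable_restrict_space1 measurable_completion) simp
      moreover have "(\<lambda>y. H (v y $ k)) \<in> borel_measurable (lebesgue_on \<Omega>)"
        using vm[of k] by (rule measurable_compose) simp
      then have "(\<lambda>y. flux k H (v y) $ i) \<in> borel_measurable (lebesgue_on \<Omega>)"
        using vm[of i] by (cases "i = k") (auto simp: flux_def)
      ultimately show ?thesis by simp
    qed
    then show "(\<lambda>y. flux k H (v y) \<bullet> grad \<eta> y) \<in> borel_measurable (lebesgue_on \<Omega>)"
      unfolding inner_vec_def by (simp add: borel_measurable_sum)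
    show "AE y in lborel. y \<in> \<Omega> \<longrightarrow> flux k H (v y) \<bullet> grad \<eta> y = (\<Sum>i\<in>UNIV. flux k H (v' y) $ i * grad \<eta> y $ i)"
      using v'(2) by eventually_elim (auto simp: inner_vec_def)
    show "(\<Sum>i\<in>UNIV. flux k H (v' y) $ i * grad \<eta> y $ i) = 0" if "y \<notin> \<Omega>" for y
    proof -
      have "y \<notin> S" using that S(2) D'D D\<Omega> by blast
      then show ?thesis by (simp add: g0)
    qed
  qed measurable
  also have "\<dots> = (\<Sum>i\<in>UNIV. \<integral>y. flux k H (v' y) $ i * grad \<eta> y $ i \<partial>lborel)"
    using fi by simp
  also have "\<dots> = (\<Sum>i\<in>UNIV. (LBINT y. B i y * grad \<eta> y $ i) - (LBINT y. E i y * \<eta> y))"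
  proof (rule sum.cong[OF refl])
    fix i
    have "(LBINT y. B i y * grad \<eta> y $ i)
        = (LBINT y. flux k H (v' y) $ i * grad \<eta> y $ i - flux k H (Dw y) $ i * grad \<eta> y $ i)"
    proof (intro Bochner_Integration.integral_cong refl)
      fix y show "B i y * grad \<eta> y $ i = flux k H (v' y) $ i * grad \<eta> y $ i - flux k H (Dw y) $ i * grad \<eta> y $ i"
        using S(2) g0[of y] by (cases "y \<in> S") (auto simp: B_def algebra_simps)
    qed
    then show "(LBINT y. flux k H (v' y) $ i * grad \<eta> y $ i)
        = (LBINT y. B i y * grad \<eta> y $ i) - (LBINT y. E i y * \<eta> y)"
      using fi parts by simp
  qed
  also have "\<dots> \<le> (\<Sum>i\<in>(UNIV::'n set). e - (LBINT y. E i y * \<eta> y))"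
  proof (rule sum_mono)
    fix i
    have "(LBINT y. B i y * (bump 2 (z y) * V i y)) \<le> 0"
    proof -
      have "0 \<le> (LBINT y. - (B i y * (bump 2 (z y) * V i y)))"
        by (rule Bochner_Integration.integral_nonneg) (use BV in \<open>simp add: le_minus_iff del: mult_minus_left\<close>)
      then show ?thesis by simp
    qed
    then show "(LBINT y. B i y * grad \<eta> y $ i) - (LBINT y. E i y * \<eta> y) \<le> e - (LBINT y. E i y * \<eta> y)"
      using \<eta>(4)[of i] by linarith
  qed
  also have "\<dots> = N * e - (LBINT y. (\<Sum>i\<in>UNIV. E i y * \<eta> y))"
    using parts(2) by (simp add: sum_subtractf N_def)
  finally have le: "(LBINT y. (\<Sum>i\<in>UNIV. E i y * \<eta> y)) \<le> N * e" by simp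
  have "(LBINT y. c1 * (b / 2) * indicator (cball x r1) y) \<le> (LBINT y. (\<Sum>i\<in>UNIV. E i y * \<eta> y))"
  proof (rule integral_mono)
    fix y
    show "c1 * (b / 2) * indicator (cball x r1) y \<le> (\<Sum>i\<in>UNIV. E i y * \<eta> y)"
    proof (cases "y \<in> S")
      case True
      then have c: "c1 \<le> (\<Sum>i\<in>UNIV. E i y)" using c1(2) S(2) closure_subset[of D'] by blast
      have "(b / 2) * indicator (cball x r1) y \<le> \<eta> y"
      proof (cases "y \<in> cball x r1")
        case True
        then have "b \<le> bump 0 (z y)" using r1(2) \<epsilon>(1) unfolding b_def by (intro bump_0_mono) auto
        then show ?thesis using \<eta>(3)[of y] e(2) True by simp
      qed (use \<eta>(2) in simp)
      then have "c1 * ((b / 2) * indicator (cball x r1) y) \<le> (\<Sum>i\<in>UNIV. E i y) * \<eta> y"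
        using c c1(1) b by (intro mult_mono) auto
      then show ?thesis by (simp add: sum_distrib_right)
    next
      case False
      have "y \<notin> cball x r1"
      proof
        assume y: "y \<in> cball x r1"
        then have "b \<le> bump 0 (z y)" using r1(2) \<epsilon>(1) unfolding b_def by (intro bump_0_mono) auto
        then show False using \<eta>(3)[of y] e(2) S(3)[OF False] b by simp
      qed
      then show ?thesis using S(3)[OF False] by simp
    qed
  next
    show "integrable lborel (\<lambda>y. c1 * (b / 2) * indicator (cball x r1) y)"
      by (intro integrable_mult_right integrable_indicator_cball)
  qed (use parts(2) in simp)
  then have "c1 * (b / 2) * \<mu> \<le> N * e" using le by (simp add: \<mu>_def)
  moreover have "0 < c1 * b * \<mu>" using c1(1) b \<mu> by simp
  ultimately show False using e(3) by simp
qed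

section \<open>The energy density\<close>

text \<open>Away from \<open>0\<close> the differential equation for \<open>f\<close> says exactly that \<open>h s = f (s\<^sup>2) s\<^sup>2\<close> satisfies
  \<open>h'' = 2 g (s\<^sup>2)\<close>. Boundedness of \<open>f\<close> gives \<open>h = O(s\<^sup>2)\<close>; this removes the singularity at \<open>0\<close> and, by
  convexity, bounds \<open>h'\<close> linearly.\<close>

lemma one_dim_flux:
  fixes g f :: "real \<Rightarrow> real"
  assumes G: "assumption_G g f" and g: "continuous_on {0..} g" "\<forall>t\<ge>0. 0 \<le> g t"
  obtains H C where "\<And>s. ((\<lambda>s. f (s\<^sup>2) * s\<^sup>2) has_real_derivative 2 * H s) (at s)"
    "\<And>s. (H has_real_derivative g (s\<^sup>2)) (at s)" "mono H" "\<And>s. \<bar>H s\<bar> \<le> C * \<bar>s\<bar>"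
proof -
  obtain f' f'' where "\<forall>t>0. (f has_real_derivative f' t) (at t) \<and> (f' has_real_derivative f'' t) (at t) \<and>
     g t = f t + 5 * t * f' t + 2 * t\<^sup>2 * f'' t"
    using G unfolding assumption_G_def ode_solution_def by blast
  then have ode: "\<And>t. 0 < t \<Longrightarrow> (f has_real_derivative f' t) (at t)"
     "\<And>t. 0 < t \<Longrightarrow> (f' has_real_derivative f'' t) (at t)"
     "\<And>t. 0 < t \<Longrightarrow> g t = f t + 5 * t * f' t + 2 * t\<^sup>2 * f'' t"
    by blast+
  obtain B where B: "\<And>t. 0 \<le> t \<Longrightarrow> \<bar>f t\<bar> \<le> B"
    using G unfolding assumption_G_def bounded_iff by auto
  define h where "h s = f (s\<^sup>2) * s\<^sup>2" for s
  define H where "H s = f (s\<^sup>2) * s + f' (s\<^sup>2) * s ^ 3" for s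
  have hB: "\<bar>h s\<bar> \<le> B * s\<^sup>2" for s
    using mult_right_mono[OF B[of "s\<^sup>2"], of "s\<^sup>2"] by (simp add: h_def abs_mult)
  have B0: "0 \<le> B" using B[of 0] by linarith
  have dh: "(h has_real_derivative 2 * H s) (at s)" for s
  proof (cases "s = 0")
    case True
    have "((\<lambda>x. h x / x) \<longlongrightarrow> 0) (at 0)"
    proof (rule Lim_null_comparison[where g="\<lambda>x. B * \<bar>x\<bar>"])
      show "\<forall>\<^sub>F x in at 0. norm (h x / x) \<le> B * \<bar>x\<bar>"
      proof (rule eventually_at_topological[THEN iffD2], intro exI[of _ UNIV] conjI ballI impI)
        fix x :: real assume "x \<noteq> 0"
        then show "norm (h x / x) \<le> B * \<bar>x\<bar>"
          using hB[of x] by (simp add: divide_le_eq power2_eq_square mult.assoc)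
      qed auto
      show "((\<lambda>x. B * \<bar>x\<bar>) \<longlongrightarrow> 0) (at 0)" by (auto intro!: tendsto_eq_intros)
    qed
    then show ?thesis using True by (simp add: DERIV_def h_def H_def)
  next
    case False
    have "((\<lambda>s. f (s\<^sup>2)) has_real_derivative f' (s\<^sup>2) * (2 * s)) (at s)"
      by (rule DERIV_chain2[OF ode(1)]) (use False in \<open>auto intro!: derivative_eq_intros\<close>)
    then have "(h has_real_derivative f' (s\<^sup>2) * (2 * s) * s\<^sup>2 + f (s\<^sup>2) * (2 * s)) (at s)"
      unfolding h_def by (auto intro!: derivative_eq_intros)
    then show ?thesis by (simp add: H_def algebra_simps power2_eq_square power3_eq_cube)
  qed
  have dH: "(H has_real_derivative g (s\<^sup>2)) (at s)" if "s \<noteq> 0" for s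
  proof -
    have c: "((\<lambda>s. f (s\<^sup>2)) has_real_derivative f' (s\<^sup>2) * (2 * s)) (at s)"
      by (rule DERIV_chain2[OF ode(1)]) (use that in \<open>auto intro!: derivative_eq_intros\<close>)
    have c': "((\<lambda>s. f' (s\<^sup>2)) has_real_derivative f'' (s\<^sup>2) * (2 * s)) (at s)"
      by (rule DERIV_chain2[OF ode(2)]) (use that in \<open>auto intro!: derivative_eq_intros\<close>)
    have "(H has_real_derivative (f' (s\<^sup>2) * (2 * s) * s + f (s\<^sup>2)) + (f'' (s\<^sup>2) * (2 * s) * s ^ 3 + f' (s\<^sup>2) * (3 * s\<^sup>2))) (at s)"
      unfolding H_def using c c' by (auto intro!: derivative_eq_intros)
    moreover have "(f' (s\<^sup>2) * (2 * s) * s + f (s\<^sup>2)) + (f'' (s\<^sup>2) * (2 * s) * s ^ 3 + f' (s\<^sup>2) * (3 * s\<^sup>2)) = g (s\<^sup>2)"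
      using ode(3)[of "s\<^sup>2", unfolded zero_less_power2, OF that] by (simp add: power2_eq_square power3_eq_cube algebra_simps)
    ultimately show ?thesis by simp
  qed
  have gc: "continuous_on UNIV (\<lambda>s. g (s\<^sup>2))"
    by (rule continuous_on_compose2[OF g(1)]) (auto intro!: continuous_intros)
  \<comment> \<open>\<open>H\<close> is continuous at \<open>0\<close> because \<open>h s / s\<close>, a value of \<open>2 H\<close> between \<open>0\<close> and \<open>s\<close>, tends to \<open>0\<close>,
    while \<open>H\<close> is Lipschitz on either side of \<open>0\<close>.\<close>
  obtain A where A: "\<And>s. \<bar>s\<bar> \<le> 1 \<Longrightarrow> \<bar>g (s\<^sup>2)\<bar> \<le> A" "0 \<le> A"
  proof -
    have "compact ((\<lambda>s. g (s\<^sup>2)) ` {-1..1})"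
      by (intro compact_continuous_image continuous_on_subset[OF gc]) auto
    then obtain A where "\<And>s. s \<in> {-1..1} \<Longrightarrow> \<bar>g (s\<^sup>2)\<bar> \<le> A"
      by (metis bounded_real compact_imp_bounded imageI)
    then show ?thesis using that[of A] by (force simp: abs_le_iff)
  qed
  have HL: "\<bar>H s\<bar> \<le> (B + A) * \<bar>s\<bar>" if "\<bar>s\<bar> \<le> 1" "s \<noteq> 0" for s
  proof -
    have "\<exists>x. x \<noteq> 0 \<and> \<bar>x\<bar> \<le> \<bar>s\<bar> \<and> \<bar>s - x\<bar> \<le> \<bar>s\<bar> \<and> (\<forall>y. min x s \<le> y \<and> y \<le> max x s \<longrightarrow> y \<noteq> 0 \<and> \<bar>y\<bar> \<le> 1) \<and> h s = s * (2 * H x)"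
    proof (cases "0 < s")
      case True
      obtain x where "0 < x" "x < s" "h s - h 0 = (s - 0) * (2 * H x)"
        using MVT2[OF True, of h "\<lambda>x. 2 * H x"] dh by blast
      then show ?thesis using that by (intro exI[of _ x]) (auto simp: h_def)
    next
      case False
      then have s: "s < 0" using that by simp
      obtain x where "s < x" "x < 0" "h 0 - h s = (0 - s) * (2 * H x)"
        using MVT2[OF s, of h "\<lambda>x. 2 * H x"] dh by blast
      then show ?thesis using that by (intro exI[of _ x]) (auto simp: h_def)
    qed
    then obtain x where x: "x \<noteq> 0" "\<bar>x\<bar> \<le> \<bar>s\<bar>" "\<bar>s - x\<bar> \<le> \<bar>s\<bar>" "h s = s * (2 * H x)"
       "\<And>y. min x s \<le> y \<Longrightarrow> y \<le> max x s \<Longrightarrow> y \<noteq> 0 \<and> \<bar>y\<bar> \<le> 1" by blast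
    have "\<bar>s\<bar> * (2 * \<bar>H x\<bar>) \<le> B * s\<^sup>2" using hB[of s] x(4) by (simp add: abs_mult)
    then have "\<bar>s\<bar> * (2 * \<bar>H x\<bar>) \<le> \<bar>s\<bar> * (B * \<bar>s\<bar>)" by (simp add: power2_eq_square mult_ac flip: abs_mult)
    then have 1: "2 * \<bar>H x\<bar> \<le> B * \<bar>s\<bar>" using that(2) by (simp add: mult_le_cancel_left)
    have "\<bar>H s - H x\<bar> \<le> A * \<bar>s - x\<bar>"
    proof -
      have "norm (H s - H x) \<le> A * norm (s - x)"
      proof (rule field_differentiable_bound[where S="{min x s..max x s}" and f'="\<lambda>y. g (y\<^sup>2)"])
        fix y assume "y \<in> {min x s..max x s}"
        then have y: "y \<noteq> 0" "\<bar>y\<bar> \<le> 1" using x(5)[of y] by auto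
        show "(H has_field_derivative g (y\<^sup>2)) (at y within {min x s..max x s})"
          using dH[OF y(1)] by (rule has_field_derivative_at_within)
        show "norm (g (y\<^sup>2)) \<le> A" using A(1)[OF y(2)] by simp
      qed auto
      then show ?thesis by simp
    qed
    also have "\<dots> \<le> A * \<bar>s\<bar>" using x(3) A(2) by (rule mult_left_mono)
    finally have "\<bar>H s - H x\<bar> \<le> A * \<bar>s\<bar>" .
    moreover have "0 \<le> B * \<bar>s\<bar>" using B0 by simp
    ultimately show ?thesis using 1 by (simp add: distrib_right)
  qed
  have Hc: "isCont H s" for s
  proof (cases "s = 0")
    case True
    have "(H \<longlongrightarrow> 0) (at 0)"
    proof (rule Lim_null_comparison[where g="\<lambda>x. (B + A) * \<bar>x\<bar>"])
      show "\<forall>\<^sub>F x in at 0. norm (H x) \<le> (B + A) * \<bar>x\<bar>"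
        unfolding eventually_at using HL by (intro exI[of _ 1]) (auto simp: dist_real_def)
      show "((\<lambda>x. (B + A) * \<bar>x\<bar>) \<longlongrightarrow> 0) (at 0)" by (auto intro!: tendsto_eq_intros)
    qed
    then show ?thesis using True by (simp add: isCont_def H_def)
  qed (use dH in \<open>auto intro: DERIV_isCont\<close>)
  have gt: "((\<lambda>s. g (s\<^sup>2)) \<longlongrightarrow> g ((0::real)\<^sup>2)) (at 0)"
  proof -
    have "isCont (\<lambda>s. g (s\<^sup>2)) (0::real)" using gc by (simp add: continuous_on_eq_continuous_at)
    then show ?thesis by (simp add: isCont_def)
  qed
  have cont: "continuous_on S H" for S using Hc by (simp add: continuous_at_imp_continuous_on)
  have diff: "H differentiable (at y)" if "y \<noteq> 0" for y
    using dH[OF that] real_differentiable_def by blast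
  have dH0: "(H has_real_derivative g (0\<^sup>2)) (at 0)"
  proof -
    have "((\<lambda>x. (H x - H 0) / (x - 0)) \<longlongrightarrow> g (0\<^sup>2)) (at 0)"
      unfolding tendsto_iff
    proof (intro allI impI)
      fix e :: real assume "0 < e"
      then have "\<forall>\<^sub>F s in at 0. dist (g (s\<^sup>2)) (g ((0::real)\<^sup>2)) < e" using gt unfolding tendsto_iff by blast
      then obtain d where d: "0 < d" "\<And>s. s \<noteq> 0 \<Longrightarrow> \<bar>s\<bar> < d \<Longrightarrow> dist (g (s\<^sup>2)) (g ((0::real)\<^sup>2)) < e"
        unfolding eventually_at by (auto simp: dist_real_def)
      have "dist ((H x - H 0) / (x - 0)) (g (0\<^sup>2)) < e" if x: "x \<noteq> 0" "\<bar>x\<bar> < d" for x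
      proof -
        have "\<exists>y. y \<noteq> 0 \<and> \<bar>y\<bar> < d \<and> (H x - H 0) / (x - 0) = g (y\<^sup>2)"
        proof (cases "0 < x")
          case True
          obtain l y where y: "0 < y" "y < x" "DERIV H y :> l" "H x - H 0 = (x - 0) * l"
            using MVT[OF True cont diff] by (metis less_irrefl)
          have "l = g (y\<^sup>2)" using DERIV_unique[OF y(3) dH] y(1,2) by simp
          then show ?thesis using x y by (intro exI[of _ y]) (auto simp: field_simps)
        next
          case False
          then have "x < 0" using x by simp
          obtain l y where y: "x < y" "y < 0" "DERIV H y :> l" "H 0 - H x = (0 - x) * l"
            using MVT[OF \<open>x < 0\<close> cont diff] by (metis less_irrefl)
          have "l = g (y\<^sup>2)" using DERIV_unique[OF y(3) dH] y(1,2) by simp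
          then show ?thesis using x y by (intro exI[of _ y]) (auto simp: field_simps)
        qed
        then show ?thesis using d(2) by metis
      qed
      then show "\<forall>\<^sub>F x in at 0. dist ((H x - H 0) / (x - 0)) (g (0\<^sup>2)) < e"
        unfolding eventually_at using d(1) by (intro exI[of _ d]) (auto simp: dist_real_def)
    qed
    then show ?thesis by (simp add: has_field_derivative_iff)
  qed
  have dHall: "(H has_real_derivative g (s\<^sup>2)) (at s)" for s
    using dH dH0 by (cases "s = 0") auto
  have mono: "mono H"
  proof (rule monoI)
    fix a b :: real assume "a \<le> b"
    then show "H a \<le> H b"
      by (rule DERIV_nonneg_imp_nondecreasing) (meson dHall g(2) zero_le_power2)
  qed
  have H0: "H 0 = 0" by (simp add: H_def)
  \<comment> \<open>Boundedness of \<open>f\<close> enters through \<open>s H s \<le> (h (2 s) - h s) / 2\<close>, a consequence of convexity.\<close>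
  have bd: "\<bar>H s\<bar> \<le> (3 * B) * \<bar>s\<bar>" for s
  proof -
    consider "s = 0" | "0 < s" | "s < 0" by linarith
    then show ?thesis
    proof cases
      case 2
      then have "s < 2 * s" by simp
      then obtain x where x: "s < x" "x < 2 * s" "h (2 * s) - h s = (2 * s - s) * (2 * H x)"
        using MVT2[of s "2 * s" h "\<lambda>x. 2 * H x"] dh by blast
      have "H s \<le> H x" "0 \<le> H s" using mono x(1) 2 H0 unfolding mono_def by (metis less_imp_le)+
      then have "s * (2 * H s) \<le> h (2 * s) - h s" using x(3) 2 by simp
      also have "\<dots> \<le> B * (2 * s)\<^sup>2 + B * s\<^sup>2" using hB[of s] hB[of "2 * s"] by linarith
      also have "\<dots> \<le> s * (6 * B * s)" using B0 2 by (simp add: power2_eq_square)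
      finally show ?thesis using 2 \<open>0 \<le> H s\<close> by (simp add: mult_le_cancel_left)
    next
      case 3
      then have "2 * s < s" by simp
      then obtain x where x: "2 * s < x" "x < s" "h s - h (2 * s) = (s - 2 * s) * (2 * H x)"
        using MVT2[of "2 * s" s h "\<lambda>x. 2 * H x"] dh by blast
      have *: "H x \<le> H s" "H s \<le> 0" using mono x(2) 3 H0 unfolding mono_def by (metis less_imp_le)+
      have "(- s) * (2 * - H s) \<le> (- s) * (2 * - H x)" using * 3 by (intro mult_left_mono) auto
      also have "\<dots> = h (2 * s) - h s" using x(3) by (simp add: algebra_simps)
      also have "\<dots> \<le> B * (2 * s)\<^sup>2 + B * s\<^sup>2" using hB[of s] hB[of "2 * s"] by linarith
      also have "\<dots> \<le> (- s) * (6 * B * - s)" using B0 3 by (simp add: power2_eq_square)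
      finally have "(- s) * (2 * - H s) \<le> (- s) * (6 * B * - s)" .
      then have "2 * - H s \<le> 6 * B * - s" using 3 by (subst (asm) mult_le_cancel_left_pos) auto
      then show ?thesis using 3 * by simp
    qed (simp add: H0)
  qed
  show ?thesis using that[of H "3 * B"] dh[unfolded h_def] dHall mono bd by blast
qed

lemma grad_Lagr:
  fixes k :: "'n::finite"
  assumes "\<And>s. ((\<lambda>s. f (s\<^sup>2) * s\<^sup>2) has_real_derivative 2 * H s) (at s)"
  shows "grad (Lagr k f) p = (\<chi> i. if i = k then H (p $ k) else p $ i)"
proof (rule GDERIV_unique_grad)
  let ?h = "\<lambda>s. f (s\<^sup>2) * s\<^sup>2"
  have coord: "((\<lambda>p. p $ i) has_derivative (\<lambda>h. h $ i)) (at p)" for i and p :: "real ^ 'n"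
    by (rule bounded_linear_imp_has_derivative[OF bounded_linear_vec_nth])
  have sq: "((\<lambda>p. (p $ i)\<^sup>2) has_derivative (\<lambda>h. 2 * p $ i * h $ i)) (at p)" for i
    using has_derivative_power[OF coord[of i p], of 2] by (simp add: mult_ac)
  have hk: "((\<lambda>p. ?h (p $ k)) has_derivative (\<lambda>h. 2 * H (p $ k) * h $ k)) (at p)"
    using has_derivative_compose[OF coord[of k p] assms[of "p $ k", unfolded has_field_derivative_def]] .
  have "((\<lambda>p. 1 / 2 * ((\<Sum>i\<in>UNIV - {k}. (p $ i)\<^sup>2) + ?h (p $ k))) has_derivative
      (\<lambda>h. 1 / 2 * ((\<Sum>i\<in>UNIV - {k}. 2 * p $ i * h $ i) + 2 * H (p $ k) * h $ k))) (at p)"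
    by (intro has_derivative_mult_right has_derivative_add has_derivative_sum sq hk)
  moreover have "1 / 2 * ((\<Sum>i\<in>UNIV - {k}. 2 * p $ i * h $ i) + 2 * H (p $ k) * h $ k)
      = h \<bullet> (\<chi> i. if i = k then H (p $ k) else p $ i)" for h
    by (simp add: inner_vec_def sum.remove[of UNIV k] sum_divide_distrib distrib_left mult.commute add_divide_distrib)
  ultimately show "GDERIV (Lagr k f) p :> (\<chi> i. if i = k then H (p $ k) else p $ i)"
    unfolding gderiv_def Lagr_def[abs_def] by simp
qed

section \<open>The one-dimensional profile\<close>

text \<open>If the integral of \<open>sqrt r / s\<close> converged at \<open>0\<close>, with tail
  \<open>E \<zeta>\<close>, then monotonicity of \<open>r\<close> would give \<open>G \<zeta> \<le> sqrt (r \<zeta>) E \<zeta>\<close>, while \<open>sqrt (r \<zeta>) \<le> 2 K G \<zeta>\<close> once \<open>G \<zeta> \<le> 1\<close>.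
  Since \<open>E \<zeta>\<close> tends to \<open>0\<close>, the two are incompatible.\<close>

lemma sqrt_integral_diverges:
  fixes r G :: "real \<Rightarrow> real"
  assumes \<zeta>0: "0 < \<zeta>0" and r: "continuous_on {0<..\<zeta>0} r" "\<And>s. 0 < s \<Longrightarrow> s \<le> \<zeta>0 \<Longrightarrow> 0 < r s"
      "\<And>s t. 0 < s \<Longrightarrow> s \<le> t \<Longrightarrow> t \<le> \<zeta>0 \<Longrightarrow> r s \<le> r t"
    and int: "\<And>\<zeta>. 0 < \<zeta> \<Longrightarrow> \<zeta> \<le> \<zeta>0 \<Longrightarrow> set_integrable lborel {0<..<\<zeta>} (\<lambda>s. r s / s)"
    and G: "\<And>\<zeta>. 0 < \<zeta> \<Longrightarrow> \<zeta> \<le> \<zeta>0 \<Longrightarrow> G \<zeta> = (LINT s:{0<..<\<zeta>}|lborel. r s / s)"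
    and K: "0 < K" "\<And>\<zeta>. 0 < \<zeta> \<Longrightarrow> \<zeta> \<le> \<zeta>0 \<Longrightarrow> sqrt (r \<zeta>) \<le> K * (exp (G \<zeta>) - 1)"
  shows "\<exists>\<epsilon>>0. \<epsilon> \<le> \<zeta>0 \<and> B \<le> integral {\<epsilon>..\<zeta>0} (\<lambda>s. sqrt (r s) / s)"
proof (rule ccontr)
  assume neg: "\<not> ?thesis"
  define Y where "Y \<epsilon> = integral {\<epsilon>..\<zeta>0} (\<lambda>s. sqrt (r s) / s)" for \<epsilon>
  have YB: "Y \<epsilon> < B" if "0 < \<epsilon>" "\<epsilon> \<le> \<zeta>0" for \<epsilon> using neg that by (force simp: Y_def)
  have c: "continuous_on {\<epsilon>..\<zeta>} (\<lambda>s. sqrt (r s) / s)" if "0 < \<epsilon>" "\<zeta> \<le> \<zeta>0" for \<epsilon> \<zeta>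
    using that by (intro continuous_intros continuous_on_subset[OF r(1)]) auto
  have nn: "0 \<le> sqrt (r s) / s" if "0 < s" "s \<le> \<zeta>0" for s using r(2)[OF that] that by simp
  have split: "integral {\<epsilon>..\<zeta>} (\<lambda>s. sqrt (r s) / s) = Y \<epsilon> - Y \<zeta>" if "0 < \<epsilon>" "\<epsilon> \<le> \<zeta>" "\<zeta> \<le> \<zeta>0" for \<epsilon> \<zeta>
    using Henstock_Kurzweil_Integration.integral_combine[OF that(2,3), of "\<lambda>s. sqrt (r s) / s"]
      integrable_continuous_real[OF c[of \<epsilon> \<zeta>0]] that by (simp add: Y_def)
  \<comment> \<open>The first bound will contradict \<open>sqrt (r \<zeta>) \<le> 2 K G \<zeta>\<close>; the second ensures \<open>G \<zeta> \<le> 1\<close>, where \<open>exp x - 1 \<le> 2 x\<close>.\<close>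
  define c0 where "c0 = min (1 / (4 * K)) (1 / sqrt (r \<zeta>0))"
  have c0: "0 < c0" "c0 * (4 * K) \<le> 1" "c0 * sqrt (r \<zeta>0) \<le> 1"
  proof -
    have "0 < sqrt (r \<zeta>0)" using r(2)[of \<zeta>0] \<zeta>0 by simp
    then show "0 < c0" "c0 * (4 * K) \<le> 1" "c0 * sqrt (r \<zeta>0) \<le> 1" using K(1)
      by (auto simp: c0_def min_def field_simps)
  qed
  \<comment> \<open>Between \<open>0\<close> and this point the integral gains at most \<open>c0\<close>.\<close>
  obtain \<zeta> where \<zeta>: "0 < \<zeta>" "\<zeta> \<le> \<zeta>0" "\<And>\<epsilon>. 0 < \<epsilon> \<Longrightarrow> \<epsilon> \<le> \<zeta> \<Longrightarrow> Y \<epsilon> - Y \<zeta> \<le> c0"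
  proof -
    have bdd: "bdd_above (Y ` {0<..\<zeta>0})" using YB by (intro bdd_aboveI[of _ B]) (auto intro: less_imp_le)
    have "Sup (Y ` {0<..\<zeta>0}) - c0 < Sup (Y ` {0<..\<zeta>0})" using c0 by simp
    then obtain \<zeta> where "0 < \<zeta>" "\<zeta> \<le> \<zeta>0" "Sup (Y ` {0<..\<zeta>0}) - c0 < Y \<zeta>"
      using \<zeta>0 by (subst (asm) less_cSup_iff[OF _ bdd]) auto
    moreover have "Y \<epsilon> \<le> Sup (Y ` {0<..\<zeta>0})" if "0 < \<epsilon>" "\<epsilon> \<le> \<zeta>0" for \<epsilon>
      using that bdd by (intro cSup_upper) auto
    ultimately show ?thesis using that[of \<zeta>] by force
  qed
  have r\<zeta>: "0 < r \<zeta>" using r(2) \<zeta> by simp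
  define F where "F s = indicator {0<..<\<zeta>} s * (r s / s)" for s
  have G\<zeta>: "G \<zeta> = (LBINT s. F s)"
    using G[OF \<zeta>(1,2)] by (simp add: set_lebesgue_integral_def F_def)
  have iG: "integrable lborel F"
    using int[OF \<zeta>(1,2)] by (simp add: set_integrable_def F_def[abs_def])
  define \<epsilon> where "\<epsilon> n = \<zeta> / real (n + 2)" for n :: nat
  have \<epsilon>: "0 < \<epsilon> n" "\<epsilon> n \<le> \<zeta>" for n using \<zeta> by (auto simp: \<epsilon>_def field_simps)
  have "(\<lambda>n. \<integral>s. indicator {\<epsilon> n..\<zeta>} s * F s \<partial>lborel) \<longlonglongrightarrow> G \<zeta>"
    unfolding G\<zeta>
  proof (rule integral_dominated_convergence[where w="\<lambda>s. \<bar>F s\<bar>"])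
    have "(\<lambda>n. indicator {\<epsilon> n..\<zeta>} s * F s) \<longlonglongrightarrow> F s" for s
    proof (rule tendsto_eventually)
      have "\<epsilon> \<longlonglongrightarrow> 0" unfolding \<epsilon>_def by real_asymp
      show "\<forall>\<^sub>F n in sequentially. indicator {\<epsilon> n..\<zeta>} s * F s = F s"
      proof (cases "0 < s \<and> s < \<zeta>")
        case True
        then have "\<forall>\<^sub>F n in sequentially. \<epsilon> n < s" using \<open>\<epsilon> \<longlonglongrightarrow> 0\<close> by (intro order_tendstoD(2)[of \<epsilon> 0]) auto
        then show ?thesis by eventually_elim (use True in auto)
      qed (auto simp: F_def)
    qed
    then show "AE s in lborel. (\<lambda>n. indicator {\<epsilon> n..\<zeta>} s * F s) \<longlonglongrightarrow> F s"
      by simp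
    show "AE s in lborel. norm (indicator {\<epsilon> n..\<zeta>} s * F s) \<le> \<bar>F s\<bar>" for n
      by (rule AE_I2) (auto simp: indicator_def)
  qed (use iG in auto)
  moreover have "(LBINT s. indicator {\<epsilon> n..\<zeta>} s * F s) \<le> sqrt (r \<zeta>) * c0" for n
  proof -
    have si: "set_integrable lborel {\<epsilon> n..\<zeta>} (\<lambda>s. sqrt (r s) / s)"
      by (rule borel_integrable_atLeastAtMost'[OF c[OF \<epsilon>(1) \<zeta>(2)]])
    have "(LBINT s. indicator {\<epsilon> n..\<zeta>} s * F s)
        \<le> (LBINT s. sqrt (r \<zeta>) * (indicator {\<epsilon> n..\<zeta>} s * (sqrt (r s) / s)))"
    proof (rule integral_mono)
      show "integrable lborel (\<lambda>s. indicator {\<epsilon> n..\<zeta>} s * F s)"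
        using integrable_mult_indicator[OF _ iG, of "{\<epsilon> n..\<zeta>}"] by simp
      show "integrable lborel (\<lambda>s. sqrt (r \<zeta>) * (indicator {\<epsilon> n..\<zeta>} s * (sqrt (r s) / s)))"
        by (rule integrable_mult_right) (use si in \<open>simp add: set_integrable_def\<close>)
      fix s
      show "indicator {\<epsilon> n..\<zeta>} s * F s \<le> sqrt (r \<zeta>) * (indicator {\<epsilon> n..\<zeta>} s * (sqrt (r s) / s))"
      proof (cases "\<epsilon> n \<le> s \<and> s \<le> \<zeta>")
        case True
        then have s: "0 < s" "s \<le> \<zeta>" using \<epsilon>(1)[of n] by auto
        then have rs: "0 < r s" "r s \<le> r \<zeta>" using r \<zeta> by auto
        have "r s / s = sqrt (r s) * (sqrt (r s) / s)" using rs by simp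
        also have "\<dots> \<le> sqrt (r \<zeta>) * (sqrt (r s) / s)"
          using rs s by (intro mult_right_mono) auto
        finally have le: "r s / s \<le> sqrt (r \<zeta>) * (sqrt (r s) / s)" .
        have "F s \<le> r s / s"
          using rs s by (auto simp: F_def indicator_def)
        then show ?thesis using le True by simp
      qed simp
    qed
    also have "\<dots> = sqrt (r \<zeta>) * (LINT s:{\<epsilon> n..\<zeta>}|lborel. sqrt (r s) / s)"
      by (simp only: set_lebesgue_integral_def real_scaleR_def integral_mult_right_zero)
    also have "(LINT s:{\<epsilon> n..\<zeta>}|lborel. sqrt (r s) / s) = Y (\<epsilon> n) - Y \<zeta>"
      using set_borel_integral_eq_integral(2)[OF si] split[OF \<epsilon>(1) \<epsilon>(2) \<zeta>(2)] by simp
    also have "sqrt (r \<zeta>) * (Y (\<epsilon> n) - Y \<zeta>) \<le> sqrt (r \<zeta>) * c0"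
      using \<zeta>(3)[OF \<epsilon>] r\<zeta> by (intro mult_left_mono) auto
    finally show ?thesis .
  qed
  ultimately have Gle: "G \<zeta> \<le> sqrt (r \<zeta>) * c0" by (meson LIMSEQ_le_const2)
  have "sqrt (r \<zeta>) \<le> sqrt (r \<zeta>0)" using r(3)[of \<zeta> \<zeta>0] \<zeta> by simp
  then have "sqrt (r \<zeta>) * c0 \<le> sqrt (r \<zeta>0) * c0" using c0(1) by (intro mult_right_mono) auto
  then have G1: "G \<zeta> \<le> 1" using Gle c0(3) by (simp add: mult.commute)
  have G0: "0 \<le> G \<zeta>" unfolding G\<zeta>
    using r(2) \<zeta> by (intro Bochner_Integration.integral_nonneg) (auto simp: F_def indicator_def less_imp_le)
  have "exp (G \<zeta>) \<le> 1 + G \<zeta> + (G \<zeta>)\<^sup>2" by (rule exp_bound[OF G0 G1])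
  also have "(G \<zeta>)\<^sup>2 \<le> G \<zeta>" using mult_left_le[OF G1 G0] by (simp add: power2_eq_square)
  finally have "K * (exp (G \<zeta>) - 1) \<le> K * (2 * G \<zeta>)" using K(1) by (intro mult_left_mono) auto
  then have "sqrt (r \<zeta>) \<le> 2 * K * G \<zeta>" using K(2)[OF \<zeta>(1,2)] by simp
  also have "\<dots> \<le> 2 * K * (sqrt (r \<zeta>) * c0)" using Gle K(1) by (intro mult_left_mono) auto
  also have "\<dots> = sqrt (r \<zeta>) * (c0 * (4 * K)) / 2" by simp
  also have "\<dots> \<le> sqrt (r \<zeta>) * 1 / 2" using c0(2) r\<zeta> by (intro divide_right_mono mult_left_mono) auto
  finally show False using r\<zeta> by simp
qed

text \<open>A positive, increasing and arbitrarily small solution of \<open>\<phi>'' \<gamma> (\<phi>') = M \<phi>\<close> on an interval of any prescribed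
  length. Multiplying by \<open>p = \<phi>'\<close> gives \<open>M \<phi>\<^sup>2 / 2 = Q p\<close> with \<open>Q p\<close> the integral of \<open>s \<gamma> s\<close> over \<open>[0, p]\<close>, so
  the slope can serve as the parameter: \<open>dy = \<gamma> p / (M \<psi> p) dp\<close>, where \<open>\<psi> p = sqrt (2 Q p / M)\<close> is the height.
  As \<open>Q p \<le> p\<^sup>2 \<gamma> p / 2\<close>, the length available before the slope reaches \<open>0\<close> is at least a multiple of the
  integral of \<open>sqrt (\<gamma> p) / p\<close>, hence infinite.\<close>

lemma profile_exists:
  fixes \<gamma> :: "real \<Rightarrow> real"
  assumes P: "0 < P" and \<gamma>: "continuous_on {0..P} \<gamma>" "\<And>s. 0 < s \<Longrightarrow> s \<le> P \<Longrightarrow> 0 < \<gamma> s"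
      "\<And>s t. 0 \<le> s \<Longrightarrow> s \<le> t \<Longrightarrow> t \<le> P \<Longrightarrow> \<gamma> s \<le> \<gamma> t"
    and div: "\<And>B. \<exists>\<epsilon>>0. \<epsilon> \<le> P \<and> B \<le> integral {\<epsilon>..P} (\<lambda>s. sqrt (\<gamma> s) / s)"
    and pos: "0 < M" "0 < l" "0 < c"
  obtains \<phi> p d where
    "\<And>y. 0 \<le> y \<Longrightarrow> y \<le> l \<Longrightarrow> (\<phi> has_real_derivative p y) (at y) \<and> (p has_real_derivative d y) (at y) \<and>
       0 < p y \<and> p y < c \<and> p y \<le> P \<and> 0 < \<phi> y \<and> \<phi> y < c \<and> 0 < d y \<and> d y * \<gamma> (p y) = M * \<phi> y"
    "continuous_on {0..l} d"
proof -
  have \<gamma>nn: "0 \<le> \<gamma> s" if "0 \<le> s" "s \<le> P" for s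
  proof (cases "s = 0")
    case True
    have "(\<gamma> \<longlongrightarrow> \<gamma> 0) (at 0 within {0..P})" using \<gamma>(1) P by (auto simp: continuous_on)
    moreover have "at 0 within {0..P} \<noteq> bot" using P by (simp add: trivial_limit_within islimpt_Icc)
    moreover have "\<forall>\<^sub>F x in at 0 within {0..P}. 0 \<le> \<gamma> x"
      unfolding eventually_at_filter using \<gamma>(2) by (auto intro!: always_eventually less_imp_le)
    ultimately have "0 \<le> \<gamma> 0" by (metis tendsto_lowerbound)
    then show ?thesis using True by simp
  qed (use \<gamma>(2)[of s] that in auto)
  have sc: "continuous_on {0..P} (\<lambda>s. s * \<gamma> s)" by (intro continuous_intros \<gamma>)
  define Q where "Q p = integral {0..p} (\<lambda>s. s * \<gamma> s)" for p
  have dQ: "(Q has_real_derivative p * \<gamma> p) (at p)" if "0 < p" "p < P" for p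
  proof -
    have "(Q has_real_derivative p * \<gamma> p) (at p within {0..P})"
      unfolding Q_def by (rule integral_has_real_derivative[OF sc]) (use that in auto)
    then show ?thesis using that by (simp add: at_within_Icc_at)
  qed
  have ilin: "((\<lambda>s. s * a) has_integral (p\<^sup>2 / 2 * a)) {0..p}" if "0 \<le> p" for a p :: real
    using fundamental_theorem_of_calculus[of 0 p "\<lambda>s. s\<^sup>2 / 2 * a" "\<lambda>s. s * a"] that
    by (force intro!: derivative_eq_intros simp: has_real_derivative_iff_has_vector_derivative[symmetric])
  have Qle: "Q p \<le> p\<^sup>2 / 2 * \<gamma> p" if "0 \<le> p" "p \<le> P" for p
  proof -
    have "Q p \<le> integral {0..p} (\<lambda>s. s * \<gamma> p)"
      unfolding Q_def
    proof (rule integral_le)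
      show "(\<lambda>s. s * \<gamma> s) integrable_on {0..p}"
        using that by (intro integrable_continuous_real continuous_on_subset[OF sc]) auto
      show "(\<lambda>s. s * \<gamma> p) integrable_on {0..p}" using ilin that by blast
      show "s * \<gamma> s \<le> s * \<gamma> p" if "s \<in> {0..p}" for s
        using that \<gamma>(3)[of s p] \<open>p \<le> P\<close> by (auto intro: mult_left_mono)
    qed
    also have "\<dots> = p\<^sup>2 / 2 * \<gamma> p" by (rule integral_unique[OF ilin[OF that(1)]])
    finally show ?thesis .
  qed
  have Qmono: "Q a < Q b" if "0 < a" "a < b" "b < P" for a b
  proof (rule DERIV_pos_imp_increasing[OF that(2)])
    fix x assume "a \<le> x" "x \<le> b"
    then show "\<exists>y. (Q has_real_derivative y) (at x) \<and> 0 < y"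
      using that dQ[of x] \<gamma>(2)[of x] by (intro exI[of _ "x * \<gamma> x"]) auto
  qed
  have Qnn: "0 \<le> Q p" if "0 \<le> p" "p \<le> P" for p
    unfolding Q_def using that \<gamma>nn by (intro integral_nonneg integrable_continuous_real continuous_on_subset[OF sc]) auto
  have Qpos: "0 < Q p" if "0 < p" "p < P" for p
    using Qmono[of "p/2" p] Qnn[of "p/2"] that by simp
  define \<psi> where "\<psi> p = sqrt (2 * Q p / M)" for p
  have \<psi>pos: "0 < \<psi> p" if "0 < p" "p < P" for p using Qpos[OF that] pos by (simp add: \<psi>_def)
  have d\<psi>: "(\<psi> has_real_derivative p * \<gamma> p / (M * \<psi> p)) (at p)" if "0 < p" "p < P" for p
  proof -
    have "((\<lambda>p. 2 * Q p / M) has_real_derivative 2 * (p * \<gamma> p) / M) (at p)"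
      using dQ[OF that] pos by (auto intro!: derivative_eq_intros)
    from DERIV_chain2[OF DERIV_real_sqrt this]
    have "(\<psi> has_real_derivative inverse (\<psi> p) / 2 * (2 * (p * \<gamma> p) / M)) (at p)"
      using Qpos[OF that] pos by (simp add: \<psi>_def[abs_def])
    then show ?thesis by (simp add: field_simps)
  qed
  have \<psi>le: "\<psi> p \<le> p * sqrt (\<gamma> p) / sqrt M" if "0 < p" "p < P" for p
  proof -
    have "2 * Q p / M \<le> p\<^sup>2 * \<gamma> p / M" using Qle[of p] that pos by (intro divide_right_mono) auto
    then have "\<psi> p \<le> sqrt (p\<^sup>2 * \<gamma> p / M)" unfolding \<psi>_def by (rule real_sqrt_le_mono)
    then show ?thesis using that by (simp add: real_sqrt_mult real_sqrt_divide)
  qed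
  \<comment> \<open>The largest slope, chosen so that both slope and height stay below \<open>c\<close>.\<close>
  define p1 where "p1 = min (min (P / 2) (c / 2)) (c * sqrt M / (2 * (sqrt (\<gamma> P) + 1)))"
  have \<gamma>P: "0 < \<gamma> P" using \<gamma>(2)[of P] P by simp
  have p1: "0 < p1" "p1 < P" "p1 < c" "p1 * sqrt (\<gamma> P) / sqrt M < c"
  proof -
    show "0 < p1" "p1 < P" "p1 < c" using P pos \<gamma>P by (auto simp: p1_def intro!: mult_pos_pos divide_pos_pos add_pos_pos)
    have sg: "0 < sqrt (\<gamma> P)" using \<gamma>P by simp
    have "p1 * sqrt (\<gamma> P) \<le> (c * sqrt M / (2 * (sqrt (\<gamma> P) + 1))) * sqrt (\<gamma> P)"
      using sg by (intro mult_right_mono) (auto simp: p1_def)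
    also have "\<dots> = c * sqrt M * (sqrt (\<gamma> P) / (2 * (sqrt (\<gamma> P) + 1)))" by simp
    also have "\<dots> < c * sqrt M * 1"
    proof (rule mult_strict_left_mono)
      have "x / (2 * (x + 1)) < 1" if "0 < x" for x :: real using that by (simp add: divide_less_eq)
      then show "sqrt (\<gamma> P) / (2 * (sqrt (\<gamma> P) + 1)) < 1" using sg by blast
    qed (use pos in simp)
    finally show "p1 * sqrt (\<gamma> P) / sqrt M < c" using pos by (simp add: divide_less_eq)
  qed
  have gsc: "continuous_on {a..P} (\<lambda>s. sqrt (\<gamma> s) / s)" if "0 < a" for a
    using that by (intro continuous_intros continuous_on_subset[OF \<gamma>(1)]) auto
  obtain p0 where p0: "0 < p0" "p0 < p1" "sqrt M * (l + 2) + 1 \<le> integral {p0..p1} (\<lambda>s. sqrt (\<gamma> s) / s)"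
  proof -
    define I where "I = integral {p1..P} (\<lambda>s. sqrt (\<gamma> s) / s)"
    have I: "0 \<le> I" unfolding I_def
      using \<gamma>nn p1 by (intro integral_nonneg integrable_continuous_real gsc) auto
    obtain \<epsilon> where \<epsilon>: "0 < \<epsilon>" "\<epsilon> \<le> P" "I + sqrt M * (l + 2) + 1 \<le> integral {\<epsilon>..P} (\<lambda>s. sqrt (\<gamma> s) / s)"
      using div by blast
    have lt: "\<epsilon> < p1"
    proof (rule ccontr)
      assume "\<not> \<epsilon> < p1"
      then have "integral {\<epsilon>..P} (\<lambda>s. sqrt (\<gamma> s) / s) \<le> I" unfolding I_def
        using p1 \<epsilon> \<gamma>nn by (intro integral_subset_le integrable_continuous_real gsc) auto
      moreover have "0 < sqrt M * (l + 2)" using pos by simp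
      ultimately show False using \<epsilon>(3) by linarith
    qed
    have "integral {\<epsilon>..p1} (\<lambda>s. sqrt (\<gamma> s) / s) + I = integral {\<epsilon>..P} (\<lambda>s. sqrt (\<gamma> s) / s)"
      unfolding I_def using lt p1 \<epsilon>
      by (intro Henstock_Kurzweil_Integration.integral_combine integrable_continuous_real gsc) auto
    then show ?thesis using that[of \<epsilon>] \<epsilon> lt by simp
  qed
  have in_range: "0 < p" "p < P" if "p \<in> {p0..p1}" for p using that p0 p1 by auto
  have \<psi>c: "continuous_on {p0..p1} \<psi>"
    by (meson DERIV_isCont continuous_at_imp_continuous_on d\<psi> in_range)
  have \<gamma>c: "continuous_on {p0..p1} \<gamma>" using in_range by (intro continuous_on_subset[OF \<gamma>(1)]) force
  \<comment> \<open>The position as a function of the slope.\<close>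
  define T where "T p = integral {p0..p} (\<lambda>s. \<gamma> s / (M * \<psi> s))" for p
  have Tc0: "continuous_on {p0..p1} (\<lambda>s. \<gamma> s / (M * \<psi> s))"
    using \<psi>pos in_range pos by (intro continuous_intros \<gamma>c \<psi>c) force
  have dTw: "(T has_real_derivative \<gamma> p / (M * \<psi> p)) (at p within {p0..p1})" if "p \<in> {p0..p1}" for p
    unfolding T_def by (rule integral_has_real_derivative[OF Tc0 that])
  have dT: "(T has_real_derivative \<gamma> p / (M * \<psi> p)) (at p)" if "p0 < p" "p < p1" for p
    using dTw[of p] that by (simp add: at_within_Icc_at)
  have Tc: "continuous_on {p0..p1} T" using dTw by (rule DERIV_continuous_on)
  have Tpos: "0 < \<gamma> p / (M * \<psi> p)" if "p \<in> {p0..p1}" for p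
    using \<gamma>(2)[of p] \<psi>pos[of p] in_range[OF that] pos by simp
  have Tmono: "T a < T b" if "a \<in> {p0..p1}" "b \<in> {p0..p1}" "a < b" for a b
  proof (rule DERIV_pos_imp_increasing_open[OF that(3)])
    show "continuous_on {a..b} T" using that by (intro continuous_on_subset[OF Tc]) auto
    fix x assume "a < x" "x < b"
    then have "p0 < x" "x < p1" using that by auto
    then show "\<exists>y. (T has_real_derivative y) (at x) \<and> 0 < y"
      using dT[of x] Tpos[of x] by (intro exI conjI) auto
  qed
  have Tinj: "inj_on T {p0..p1}" by (rule linorder_inj_onI) (use Tmono in force)+
  have T0: "T p0 = 0" by (simp add: T_def)
  define L where "L = T p1"
  have L: "l + 2 \<le> L"
  proof -
    have "sqrt M * (l + 2) \<le> integral {p0..p1} (\<lambda>s. sqrt (\<gamma> s) / s)" using p0(3) by simp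
    then have "l + 2 \<le> integral {p0..p1} (\<lambda>s. sqrt (\<gamma> s) / s) / sqrt M"
      using pos by (simp add: field_simps)
    also have "\<dots> = integral {p0..p1} (\<lambda>s. sqrt (\<gamma> s) / s / sqrt M)"
      by (simp only: integral_divide)
    also have "\<dots> \<le> L" unfolding L_def T_def
    proof (rule integral_le)
      have "continuous_on {p0..p1} (\<lambda>s. sqrt (\<gamma> s) / s)"
        by (rule continuous_on_subset[OF gsc[OF p0(1)]]) (use p1 in auto)
      then show "(\<lambda>s. sqrt (\<gamma> s) / s / sqrt M) integrable_on {p0..p1}"
        using pos \<gamma>c p0(1) by (intro integrable_continuous_real continuous_intros) auto
      show "(\<lambda>s. \<gamma> s / (M * \<psi> s)) integrable_on {p0..p1}" by (rule integrable_continuous_real[OF Tc0])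
      fix s assume "s \<in> {p0..p1}"
      note s = in_range[OF this]
      have g: "0 < \<gamma> s" using \<gamma>(2) s by simp
      have "\<gamma> s / (M * (s * sqrt (\<gamma> s) / sqrt M)) \<le> \<gamma> s / (M * \<psi> s)"
        using \<psi>le[OF s] \<psi>pos[OF s] g pos s by (intro divide_left_mono mult_left_mono mult_pos_pos) auto
      moreover have "\<gamma> s / (M * (s * sqrt (\<gamma> s) / sqrt M)) = sqrt (\<gamma> s) / s / sqrt M"
      proof -
        have "a * a / ((m * m) * (s * a / m)) = a / s / m" if "0 < a" "0 < m" for a m
          using that s by (simp add: field_simps)
        from this[of "sqrt (\<gamma> s)" "sqrt M"] show ?thesis using g pos by simp
      qed
      ultimately show "sqrt (\<gamma> s) / s / sqrt M \<le> \<gamma> s / (M * \<psi> s)" by simp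
    qed
    finally show ?thesis .
  qed
  define q where "q = the_inv_into {p0..p1} T"
  have Tim: "T ` {p0..p1} = {0..L}"
  proof
    have "0 \<le> T p" "T p \<le> L" if "p \<in> {p0..p1}" for p
    proof -
      show "0 \<le> T p" using Tmono[of p0 p] T0 that p0 by (cases "p = p0") auto
      show "T p \<le> L" using Tmono[of p p1] that p0 by (cases "p = p1") (auto simp: L_def)
    qed
    then show "T ` {p0..p1} \<subseteq> {0..L}" by auto
    show "{0..L} \<subseteq> T ` {p0..p1}"
    proof
      fix y assume "y \<in> {0..L}"
      then have "\<exists>p\<ge>p0. p \<le> p1 \<and> T p = y"
        using T0 p0 by (intro IVT' Tc) (auto simp: L_def)
      then show "y \<in> T ` {p0..p1}" by auto
    qed
  qed
  have q: "q y \<in> {p0..p1}" "T (q y) = y" if "0 \<le> y" "y \<le> L" for y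
  proof -
    have "y \<in> T ` {p0..p1}" using that Tim by simp
    then obtain x where x: "x \<in> {p0..p1}" "T x = y" by blast
    then have "q y = x" unfolding q_def using the_inv_into_f_f[OF Tinj] by blast
    then show "q y \<in> {p0..p1}" "T (q y) = y" using x by auto
  qed
  have qc: "continuous_on {0..L} q"
    unfolding Tim[symmetric] q_def
    by (rule continuous_on_inv_into[OF Tc compact_Icc Tinj])
  have q_int: "p0 < q y" "q y < p1" if "0 < y" "y < L" for y
  proof -
    have "q y \<noteq> p0" "q y \<noteq> p1" using q(2)[of y] that T0 by (auto simp: L_def)
    then show "p0 < q y" "q y < p1" using q(1)[of y] that by auto
  qed
  have dq: "(q has_real_derivative M * \<psi> (q y) / \<gamma> (q y)) (at y)" if "0 < y" "y < L" for y
  proof -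
    have "(q has_real_derivative inverse (\<gamma> (q y) / (M * \<psi> (q y)))) (at y)"
    proof (rule DERIV_inverse_function[where f=T and a=0 and b=L])
      show "(T has_real_derivative \<gamma> (q y) / (M * \<psi> (q y))) (at (q y))" by (rule dT[OF q_int[OF that]])
      show "\<gamma> (q y) / (M * \<psi> (q y)) \<noteq> 0" using Tpos[OF q(1)[of y]] that by force
      show "isCont q y" using qc that by (simp add: continuous_on_interior)
      show "\<And>y. 0 < y \<Longrightarrow> y < L \<Longrightarrow> T (q y) = y" using q(2) by simp
    qed (use that in auto)
    then show ?thesis by simp
  qed
  have y1: "0 < y + 1" "y + 1 < L" if "0 \<le> y" "y \<le> l" for y using that L by auto
  \<comment> \<open>The shift by \<open>1\<close>, together with \<open>l + 2 \<le> L\<close>, places \<open>[0, l]\<close> in the interior of the range of \<open>T\<close>, where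
    the inverse is differentiable on both sides.\<close>
  define p where "p y = q (y + 1)" for y
  have pin: "p y \<in> {p0..p1}" if "0 \<le> y" "y \<le> l" for y
    unfolding p_def using q(1)[of "y+1"] y1[OF that] by simp
  have dp: "(p has_real_derivative M * \<psi> (p y) / \<gamma> (p y)) (at y)" if "0 \<le> y" "y \<le> l" for y
    unfolding p_def using DERIV_shift[of q _ y 1] dq[OF y1[OF that]] by simp
  show ?thesis
  proof (rule that[of "\<lambda>y. \<psi> (p y)" p "\<lambda>y. M * \<psi> (p y) / \<gamma> (p y)"])
    fix y assume y: "0 \<le> y" "y \<le> l"
    note pr = in_range[OF pin[OF y]]
    have g: "0 < \<gamma> (p y)" using \<gamma>(2) pr by simp
    have ps: "0 < \<psi> (p y)" by (rule \<psi>pos[OF pr])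
    have "((\<lambda>y. \<psi> (p y)) has_real_derivative p y * \<gamma> (p y) / (M * \<psi> (p y)) * (M * \<psi> (p y) / \<gamma> (p y))) (at y)"
      by (rule DERIV_chain2[OF d\<psi>[OF pr] dp[OF y]])
    then have "((\<lambda>y. \<psi> (p y)) has_real_derivative p y) (at y)" using g ps pos by simp
    moreover have "\<psi> (p y) < c"
    proof -
      have "\<psi> (p y) \<le> p y * sqrt (\<gamma> (p y)) / sqrt M" by (rule \<psi>le[OF pr])
      also have "\<dots> \<le> p1 * sqrt (\<gamma> P) / sqrt M"
        using pin[OF y] p1 pos pr \<gamma>(3)[of "p y" P] g by (intro divide_right_mono mult_mono) auto
      finally show ?thesis using p1(4) by simp
    qed
    moreover have "p y < c" using pin[OF y] p1 by simp
    ultimately show "((\<lambda>y. \<psi> (p y)) has_real_derivative p y) (at y) \<and>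
        (p has_real_derivative M * \<psi> (p y) / \<gamma> (p y)) (at y) \<and> 0 < p y \<and> p y < c \<and> p y \<le> P \<and> 0 < \<psi> (p y) \<and> \<psi> (p y) < c \<and>
        0 < M * \<psi> (p y) / \<gamma> (p y) \<and> M * \<psi> (p y) / \<gamma> (p y) * \<gamma> (p y) = M * \<psi> (p y)"
      using dp[OF y] pr g ps pos by simp
  next
    have pc: "continuous_on {0..l} p"
      by (meson DERIV_isCont continuous_at_imp_continuous_on dp atLeastAtMost_iff)
    have im: "p ` {0..l} \<subseteq> {p0..p1}" using pin by auto
    show "continuous_on {0..l} (\<lambda>y. M * \<psi> (p y) / \<gamma> (p y))"
      using pin in_range \<gamma>(2)
      by (intro continuous_intros continuous_on_compose2[OF \<psi>c pc im] continuous_on_compose2[OF \<gamma>c pc im])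
        (metis atLeastAtMost_iff less_imp_le less_irrefl)
  qed
qed

section \<open>Propagation in the nondegenerate directions\<close>

text \<open>The conclusion of \<open>comparison_principle\<close> as a property of \<open>u\<close>: comparison with strict
  classical subsolutions is all that the barrier arguments use. Here \<open>a s\<close> stands for \<open>g (s\<^sup>2)\<close>.\<close>

definition admits_comparison ::
    "'n \<Rightarrow> (real \<Rightarrow> real) \<Rightarrow> (real ^ 'n::finite) set \<Rightarrow> (real ^ 'n \<Rightarrow> real) \<Rightarrow> bool" where
  "admits_comparison k a \<Omega> u \<longleftrightarrow> (\<forall>D w Dw D2.
     open D \<longrightarrow> bounded D \<longrightarrow> closure D \<subseteq> \<Omega> \<longrightarrow> continuous_on (closure D) w \<longrightarrow>
     (\<forall>x\<in>closure D - D. w x \<le> u x) \<longrightarrow> (\<forall>x\<in>D. GDERIV w x :> Dw x) \<longrightarrow>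
     (\<forall>i. continuous_on D (\<lambda>x. Dw x $ i)) \<longrightarrow> (\<forall>i. \<forall>x\<in>D. partial i (\<lambda>x. Dw x $ i) x (D2 i x)) \<longrightarrow>
     (\<forall>i. continuous_on D (D2 i)) \<longrightarrow>
     (\<forall>x\<in>D. 0 < (\<Sum>i\<in>UNIV - {k}. D2 i x) + a (Dw x $ k) * D2 k x) \<longrightarrow>
     (\<forall>x\<in>D. w x \<le> u x))"

lemma partial_coordinate: "partial i (\<lambda>x. x $ i) x 1"
  unfolding partial_def by (auto intro!: derivative_eq_intros)

lemma partial_const: "partial i (\<lambda>x. c) x 0"
  by (simp add: partial_def)

lemma partial_mult:
  "partial i F x d \<Longrightarrow> partial i G x e \<Longrightarrow> partial i (\<lambda>x. F x * G x) x (d * G x + F x * e)"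
  unfolding partial_def by (auto intro!: derivative_eq_intros)

lemma partial_diff: "partial i F x d \<Longrightarrow> partial i G x e \<Longrightarrow> partial i (\<lambda>x. F x - G x) x (d - e)"
  unfolding partial_def by (auto intro!: derivative_eq_intros)

lemma partial_chain:
  assumes "(\<phi> has_real_derivative D) (at (F x))" "partial i F x d"
  shows "partial i (\<lambda>x. \<phi> (F x)) x (D * d)"
  unfolding partial_def
  by (rule DERIV_chain2[of \<phi> D "\<lambda>t. F (x + t *\<^sub>R axis i 1)"]) (use assms in \<open>auto simp: partial_def\<close>)

definition quad :: "('n \<Rightarrow> real) \<Rightarrow> real ^ 'n \<Rightarrow> real ^ 'n \<Rightarrow> real" where
  "quad c b x = (\<Sum>i\<in>UNIV. c i * (x $ i - b $ i)\<^sup>2)"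

lemma GDERIV_quad: "GDERIV (quad c b) x :> (\<chi> i. 2 * c i * (x $ i - b $ i))"
proof -
  have "((\<lambda>x. (x $ i - b $ i)\<^sup>2) has_derivative (\<lambda>h. 2 * (x $ i - b $ i) * h $ i)) (at x)" for i
    using has_derivative_power[OF has_derivative_diff[OF bounded_linear_imp_has_derivative[OF bounded_linear_vec_nth[of i]]
        has_derivative_const[of "b $ i"]], of 2]
    by (simp add: mult_ac)
  then have "(quad c b has_derivative (\<lambda>h. \<Sum>i\<in>UNIV. c i * (2 * (x $ i - b $ i) * h $ i))) (at x)"
    unfolding quad_def[abs_def] by (intro has_derivative_sum has_derivative_mult_right)
  then show ?thesis by (simp add: gderiv_def inner_vec_def mult_ac)
qed

lemma partial_quad: "partial i (quad c b) x (2 * c i * (x $ i - b $ i))"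
  using GDERIV_partial[OF GDERIV_quad[of c b x], of i] by simp

lemma continuous_on_quad: "continuous_on S (quad c b)"
  unfolding quad_def[abs_def] by (intro continuous_intros)

text \<open>Locates the barrier domains inside a tube around the segment from \<open>p\<close> in direction \<open>\<tau>\<close> along axis \<open>j\<close>;
  \<open>\<tau>\<close> is \<open>1\<close> or \<open>- 1\<close>.\<close>

lemma axis_tube_in_cball:
  fixes x p :: "real ^ 'n"
  assumes \<tau>: "\<tau>\<^sup>2 = 1" and X: "0 \<le> \<tau> * (x $ j - p $ j)" "\<tau> * (x $ j - p $ j) \<le> t + r / 2"
    and oth: "(\<Sum>i\<in>UNIV - {j}. (x $ i - p $ i)\<^sup>2) \<le> r\<^sup>2 / 4" and r: "0 < r" "0 \<le> t"
  shows "\<exists>s. 0 \<le> s \<and> s \<le> t \<and> x \<in> cball (p + (s * \<tau>) *\<^sub>R axis j 1) r \<and> s \<le> \<tau> * (x $ j - p $ j)"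
proof -
  define X where "X = \<tau> * (x $ j - p $ j)"
  define s where "s = min X t"
  have s: "0 \<le> s" "s \<le> t" "\<bar>X - s\<bar> \<le> r / 2" "s \<le> X" using X r by (auto simp: s_def X_def)
  define y where "y = p + (s * \<tau>) *\<^sub>R axis j (1::real)"
  have tt: "\<tau> * (\<tau> * z) = z" for z using \<tau> by (simp add: power2_eq_square flip: mult.assoc)
  have xj: "x $ j - y $ j = \<tau> * (X - s)"
    by (simp add: y_def X_def algebra_simps tt)
  have "(norm (x - y))\<^sup>2 = (\<Sum>i\<in>UNIV. (x $ i - y $ i)\<^sup>2)"
    unfolding power2_norm_eq_inner inner_vec_def by (simp add: power2_eq_square)
  also have "\<dots> = (x $ j - y $ j)\<^sup>2 + (\<Sum>i\<in>UNIV - {j}. (x $ i - y $ i)\<^sup>2)"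
    by (simp add: sum.remove[of UNIV j])
  also have "(\<Sum>i\<in>UNIV - {j}. (x $ i - y $ i)\<^sup>2) = (\<Sum>i\<in>UNIV - {j}. (x $ i - p $ i)\<^sup>2)"
    by (rule sum.cong) (auto simp: y_def axis_def)
  also have "(x $ j - y $ j)\<^sup>2 = (X - s)\<^sup>2" using \<tau> xj by (simp add: power_mult_distrib)
  also have "(X - s)\<^sup>2 \<le> r\<^sup>2 / 4" using power_mono[OF s(3), of 2] by (simp add: power_divide)
  finally have "(norm (x - y))\<^sup>2 \<le> r\<^sup>2" using oth zero_le_power2[of r] by linarith
  then have "norm (x - y) \<le> r" by (rule power2_le_imp_le) (use r in simp)
  then show ?thesis using s by (intro exI[of _ s]) (simp add: y_def X_def dist_norm norm_minus_commute)
qed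

lemma bounded_tube:
  fixes p :: "real ^ 'n"
  shows "bounded {x. \<exists>s. 0 \<le> s \<and> s \<le> t \<and> x \<in> cball (p + (s * \<tau>) *\<^sub>R axis j 1) r}"
proof -
  define S where "S = (\<lambda>s. p + (s * \<tau>) *\<^sub>R axis j 1) ` {0..t}"
  have "compact S" unfolding S_def
    by (intro compact_continuous_image continuous_intros) auto
  then have "bounded S" by (rule compact_imp_bounded)
  then obtain R where R: "\<forall>y\<in>S. norm y \<le> R" unfolding bounded_iff by blast
  show ?thesis
  proof (rule boundedI)
    fix x assume "x \<in> {x. \<exists>s. 0 \<le> s \<and> s \<le> t \<and> x \<in> cball (p + (s * \<tau>) *\<^sub>R axis j 1) r}"
    then obtain s where s: "0 \<le> s" "s \<le> t" "dist (p + (s * \<tau>) *\<^sub>R axis j 1) x \<le> r" by auto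
    have "norm x \<le> norm (p + (s * \<tau>) *\<^sub>R axis j 1) + dist (p + (s * \<tau>) *\<^sub>R axis j 1) x"
      by (metis dist_norm norm_minus_commute norm_triangle_sub)
    moreover have "norm (p + (s * \<tau>) *\<^sub>R axis j 1) \<le> R" using R s(1,2) by (simp add: S_def)
    ultimately show "norm x \<le> R + r" using s(3) by linarith
  qed
qed

text \<open>Compactness of the segment, and continuity of \<open>u\<close> at its starting point.\<close>

lemma tube_radius:
  fixes \<Omega> :: "(real ^ 'n) set" and u :: "real ^ 'n \<Rightarrow> real"
  assumes \<Omega>: "open \<Omega>" "continuous_on \<Omega> u" and p: "m < u p" "0 \<le> t"
    and seg: "\<And>s. 0 \<le> s \<Longrightarrow> s \<le> t \<Longrightarrow> p + (s * \<tau>) *\<^sub>R axis j 1 \<in> \<Omega>"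
  shows "\<exists>r>0. \<exists>c>0. (\<forall>s. 0 \<le> s \<longrightarrow> s \<le> t \<longrightarrow> cball (p + (s * \<tau>) *\<^sub>R axis j 1) r \<subseteq> \<Omega>) \<and>
    (\<forall>x\<in>cball p r. m + c \<le> u x)"
proof -
  define S where "S = (\<lambda>s. p + (s * \<tau>) *\<^sub>R axis j 1) ` {0..t}"
  have "compact S" unfolding S_def
    by (intro compact_continuous_image continuous_intros) auto
  moreover have "S \<subseteq> \<Omega>" using seg by (auto simp: S_def)
  ultimately obtain r1 where r1: "0 < r1" "(\<Union>x\<in>S. cball x r1) \<subseteq> \<Omega>"
    using compact_subset_open_imp_cball_epsilon_subset[OF _ \<Omega>(1)] by metis
  have p\<Omega>: "p \<in> \<Omega>" using seg[of 0] p by simp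
  define c where "c = (u p - m) / 2"
  have "isCont u p" using \<Omega> p\<Omega> by (simp add: continuous_on_eq_continuous_at)
  then have "\<forall>\<^sub>F x in nhds p. m + c < u x"
    using p by (intro order_tendstoD(1)[of u "u p"]) (auto simp: isCont_def tendsto_at_iff_tendsto_nhds c_def field_simps)
  then obtain d where d: "0 < d" "\<And>x. dist x p < d \<Longrightarrow> m + c < u x"
    unfolding eventually_nhds_metric by blast
  show ?thesis
  proof (rule exI[of _ "min r1 (d/2)"], intro exI[of _ c] conjI allI impI ballI)
    show "0 < min r1 (d/2)" "0 < c" using r1 d p by (auto simp: c_def)
    show "cball (p + (s * \<tau>) *\<^sub>R axis j 1) (min r1 (d/2)) \<subseteq> \<Omega>" if "0 \<le> s" "s \<le> t" for s
    proof -
      have "p + (s * \<tau>) *\<^sub>R axis j 1 \<in> S" using that by (auto simp: S_def)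
      then have "cball (p + (s * \<tau>) *\<^sub>R axis j 1) r1 \<subseteq> \<Omega>" using r1(2) by blast
      then show ?thesis by auto
    qed
    show "m + c \<le> u x" if "x \<in> cball p (min r1 (d/2))" for x
      using d(2)[of x] that d(1) by (force simp: dist_commute)
  qed
qed

text \<open>A Hopf type barrier. The function \<open>exp (- \<alpha> q)\<close>, with \<open>q\<close> a quadratic form centred one unit behind \<open>p\<close>,
  is for large \<open>\<alpha>\<close> a strict subsolution ahead of \<open>p\<close>, because \<open>q\<close> has slope at least \<open>2\<close> along axis \<open>j\<close>, where the operator
  does not degenerate. The ellipsoid \<open>q < R\<^sup>2\<close> is thin enough across the axis, by the choice of \<open>\<kappa>\<close>,
  for its part ahead of \<open>p\<close> to stay in the tube.\<close>

lemma positivity_horizontal: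
  fixes \<Omega> :: "(real ^ 'n) set"
  assumes cmp: "admits_comparison k a \<Omega> u" and a: "0 < s0" "\<And>s. \<bar>s\<bar> \<le> s0 \<Longrightarrow> 0 \<le> a s \<and> a s \<le> 1"
    and \<Omega>: "open \<Omega>" "continuous_on \<Omega> u" "\<And>x. x \<in> \<Omega> \<Longrightarrow> m \<le> u x"
    and jk: "j \<noteq> k" and \<tau>: "\<tau>\<^sup>2 = 1" and p: "m < u p" "0 < t"
    and seg: "\<And>s. 0 \<le> s \<Longrightarrow> s \<le> t \<Longrightarrow> p + (s * \<tau>) *\<^sub>R axis j 1 \<in> \<Omega>"
  shows "m < u (p + (t * \<tau>) *\<^sub>R axis j 1)"
proof -
  obtain r c where r: "0 < r" "0 < c" and tube: "\<And>s. 0 \<le> s \<Longrightarrow> s \<le> t \<Longrightarrow> cball (p + (s * \<tau>) *\<^sub>R axis j 1) r \<subseteq> \<Omega>"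
    and near: "\<And>x. x \<in> cball p r \<Longrightarrow> m + c \<le> u x"
    using tube_radius[of \<Omega> u m p t \<tau> j, OF \<Omega>(1,2) p(1) less_imp_le[OF p(2)] seg] by blast
  define X where "X x = \<tau> * (x $ j - p $ j)" for x :: "real ^ 'n"
  have tt: "\<tau> * (\<tau> * z) = z" for z using \<tau> by (simp add: power2_eq_square flip: mult.assoc)
  define R where "R = t + 1 + r / 2"
  have R: "1 < R" using p r by (simp add: R_def)
  have R2: "1 < R\<^sup>2" using R power_strict_mono[of 1 R 2] by simp
  \<comment> \<open>Ahead of \<open>p\<close> the first square is at least \<open>1\<close>, which leaves \<open>r\<^sup>2 / 4\<close> for the squared distance to the axis.\<close>
  define \<kappa> where "\<kappa> = (R\<^sup>2 - 1) * 4 / r\<^sup>2"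
  have \<kappa>: "0 < \<kappa>" using R2 r by (simp add: \<kappa>_def)
  define co where "co i = (if i = j then 1 else \<kappa>)" for i
  define b where "b = (\<chi> i. if i = j then p $ j - \<tau> else p $ i)"
  define q where "q = quad co b"
  have q_eq: "q x = (X x + 1)\<^sup>2 + \<kappa> * (\<Sum>i\<in>UNIV - {j}. (x $ i - p $ i)\<^sup>2)" for x
  proof -
    have "(x $ j - (p $ j - \<tau>))\<^sup>2 = (X x + 1)\<^sup>2"
    proof -
      have "x $ j - (p $ j - \<tau>) = \<tau> * (X x + 1)"
        by (simp add: X_def algebra_simps tt)
      then show ?thesis using \<tau> by (simp add: power_mult_distrib)
    qed
    moreover have "(\<Sum>i\<in>UNIV - {j}. co i * (x $ i - b $ i)\<^sup>2) = \<kappa> * (\<Sum>i\<in>UNIV - {j}. (x $ i - p $ i)\<^sup>2)"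
      unfolding sum_distrib_left by (rule sum.cong) (auto simp: co_def b_def)
    ultimately show ?thesis by (simp add: q_def quad_def sum.remove[of UNIV j] co_def b_def)
  qed
  have in_tube: "\<exists>s. 0 \<le> s \<and> s \<le> t \<and> x \<in> cball (p + (s * \<tau>) *\<^sub>R axis j 1) r \<and> s \<le> X x"
      "(\<Sum>i\<in>UNIV - {j}. (x $ i - p $ i)\<^sup>2) \<le> r\<^sup>2 / 4" if x: "0 \<le> X x" "q x \<le> R\<^sup>2" for x
  proof -
    define S where "S = (\<Sum>i\<in>UNIV - {j}. (x $ i - p $ i)\<^sup>2)"
    have S: "0 \<le> S" by (simp add: S_def sum_nonneg)
    have le: "(X x + 1)\<^sup>2 + \<kappa> * S \<le> R\<^sup>2" using x(2) by (simp add: q_eq S_def)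
    have "(X x + 1)\<^sup>2 \<le> R\<^sup>2" using le S \<kappa> by (smt (verit) mult_nonneg_nonneg)
    then have "X x + 1 \<le> R" by (rule power2_le_imp_le) (use R in simp)
    then have Xle: "X x \<le> t + r / 2" by (simp add: R_def)
    have "1 \<le> (X x + 1)\<^sup>2" using x(1) by (simp add: power2_eq_square algebra_simps)
    moreover have "\<kappa> * (r\<^sup>2 / 4) = R\<^sup>2 - 1" using r by (simp add: \<kappa>_def)
    ultimately have "\<kappa> * S \<le> \<kappa> * (r\<^sup>2 / 4)" using le by linarith
    then have Sle: "S \<le> r\<^sup>2 / 4" using \<kappa> by (simp add: mult_le_cancel_left)
    show "\<exists>s. 0 \<le> s \<and> s \<le> t \<and> x \<in> cball (p + (s * \<tau>) *\<^sub>R axis j 1) r \<and> s \<le> X x"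
      unfolding X_def
      by (rule axis_tube_in_cball[OF \<tau>]) (use x(1) Xle Sle r p in \<open>simp_all add: X_def S_def\<close>)
    show "(\<Sum>i\<in>UNIV - {j}. (x $ i - p $ i)\<^sup>2) \<le> r\<^sup>2 / 4" using Sle by (simp add: S_def)
  qed
  define n where "n = real CARD('n)"
  \<comment> \<open>Beats the second derivatives of \<open>q\<close> in all directions.\<close>
  define \<alpha> where "\<alpha> = 1 + \<kappa> * (n + 1)"
  have \<alpha>: "0 < \<alpha>" using \<kappa> by (simp add: \<alpha>_def n_def add_pos_nonneg)
  \<comment> \<open>Small amplitude: the barrier stays below \<open>m + c\<close>, and its slopes lie where \<open>a \<le> 1\<close>.\<close>
  define \<sigma> where "\<sigma> = min c (s0 / (2 * \<alpha> * \<kappa> * r + 1))"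
  have pos: "0 < 2 * \<alpha> * \<kappa> * r + 1" using \<alpha> \<kappa> r by (simp add: add_pos_pos)
  have \<sigma>: "0 < \<sigma>" "\<sigma> \<le> c" "\<sigma> * (2 * \<alpha> * \<kappa> * r) \<le> s0"
  proof -
    show "0 < \<sigma>" "\<sigma> \<le> c" using r a(1) pos by (auto simp: \<sigma>_def)
    have "\<sigma> * (2 * \<alpha> * \<kappa> * r) \<le> \<sigma> * (2 * \<alpha> * \<kappa> * r + 1)" using \<open>0 < \<sigma>\<close> by simp
    also have "\<dots> \<le> s0 / (2 * \<alpha> * \<kappa> * r + 1) * (2 * \<alpha> * \<kappa> * r + 1)"
      using pos by (intro mult_right_mono) (auto simp: \<sigma>_def)
    also have "\<dots> = s0" using pos by simp
    finally show "\<sigma> * (2 * \<alpha> * \<kappa> * r) \<le> s0" .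
  qed
  define D where "D = {x. 0 < X x \<and> q x < R\<^sup>2}"
  define w where "w x = m + \<sigma> * (exp (- \<alpha> * q x) - exp (- \<alpha> * R\<^sup>2))" for x
  define Dq where "Dq i x = 2 * co i * (x $ i - b $ i)" for i and x :: "real ^ 'n"
  define Dw where "Dw x = (\<chi> i. \<sigma> * (exp (- \<alpha> * q x) * - \<alpha>) * Dq i x)" for x
  define D2 where "D2 i x = \<sigma> * exp (- \<alpha> * q x) * (\<alpha>\<^sup>2 * (Dq i x)\<^sup>2 - \<alpha> * (2 * co i))" for i x
  have Xc: "continuous_on S X" for S unfolding X_def[abs_def] by (intro continuous_intros)
  have qc: "continuous_on S q" for S unfolding q_def by (rule continuous_on_quad)
  have oD: "open D" unfolding D_def by (intro open_Collect_conj open_Collect_less Xc qc continuous_intros)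
  have "closed {x. 0 \<le> X x \<and> q x \<le> R\<^sup>2}" by (intro closed_Collect_conj closed_Collect_le Xc qc continuous_intros)
  then have clD: "closure D \<subseteq> {x. 0 \<le> X x \<and> q x \<le> R\<^sup>2}" by (rule closure_minimal[rotated]) (auto simp: D_def)
  have cl\<Omega>: "closure D \<subseteq> \<Omega>" using clD in_tube(1) tube by blast
  have bD: "bounded D"
  proof (rule bounded_subset[OF bounded_tube[of t p \<tau> j r]], intro subsetI CollectI)
    fix x assume "x \<in> D"
    then have "0 \<le> X x" "q x \<le> R\<^sup>2" by (auto simp: D_def)
    then show "\<exists>s. 0 \<le> s \<and> s \<le> t \<and> x \<in> cball (p + (s * \<tau>) *\<^sub>R axis j 1) r" using in_tube(1)[of x] by blast
  qed
  have Dq_sq: "(Dq j x)\<^sup>2 = 4 * (X x + 1)\<^sup>2" for x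
  proof -
    have "Dq j x = 2 * (\<tau> * (X x + 1))"
      by (simp add: Dq_def co_def b_def X_def algebra_simps tt)
    then show ?thesis using \<tau> by (simp add: power_mult_distrib)
  qed
  have GDw: "GDERIV w x :> Dw x" for x
  proof -
    have "((\<lambda>s. m + \<sigma> * (exp (- \<alpha> * s) - exp (- \<alpha> * R\<^sup>2))) has_real_derivative \<sigma> * (exp (- \<alpha> * q x) * - \<alpha>)) (at (q x))"
      by (auto intro!: derivative_eq_intros)
    from GDERIV_DERIV_compose[OF GDERIV_quad[of co b x, folded q_def] this]
    show ?thesis by (simp add: w_def[abs_def] Dw_def Dq_def vec_eq_iff scaleR_vec_def)
  qed
  have pD2: "partial i (\<lambda>x. Dw x $ i) x (D2 i x)" for i x
  proof -
    have 1: "partial i q x (Dq i x)" unfolding q_def Dq_def by (rule partial_quad)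
    have "((\<lambda>s. \<sigma> * (exp (- \<alpha> * s) * - \<alpha>)) has_real_derivative \<sigma> * (exp (- \<alpha> * q x) * - \<alpha> * - \<alpha>)) (at (q x))"
      by (auto intro!: derivative_eq_intros)
    note 2 = partial_chain[OF this 1]
    have 3: "partial i (Dq i) x (2 * co i)"
      using partial_mult[OF partial_const[of i "2 * co i" x] partial_diff[OF partial_coordinate partial_const[of i "b $ i"]]]
      by (simp add: Dq_def[abs_def])
    from partial_mult[OF 2 3] show ?thesis
      by (simp add: Dw_def D2_def algebra_simps power2_eq_square)
  qed
  have Dqc: "continuous_on S (Dq i)" for S i unfolding Dq_def[abs_def] by (intro continuous_intros)
  have sub: "0 < (\<Sum>i\<in>UNIV - {k}. D2 i x) + a (Dw x $ k) * D2 k x" if xD: "x \<in> D" for x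
  proof -
    have x: "0 < X x" "q x < R\<^sup>2" using xD by (auto simp: D_def)
    define e where "e = \<sigma> * exp (- \<alpha> * q x)"
    have e: "0 < e" using \<sigma> by (simp add: e_def)
    have q0: "0 \<le> q x" using \<kappa> by (simp add: q_eq sum_nonneg)
    have e\<sigma>: "e \<le> \<sigma>" using q0 \<alpha> \<sigma>(1) by (simp add: e_def mult_le_cancel_left1)
    have D2_ge: "- (e * \<alpha> * (2 * co i)) \<le> D2 i x" for i
    proof -
      have "0 \<le> e * (\<alpha>\<^sup>2 * (Dq i x)\<^sup>2)" using e by simp
      then show ?thesis by (simp add: D2_def e_def algebra_simps)
    qed
    have ak: "0 \<le> a (Dw x $ k)" "a (Dw x $ k) \<le> 1"
    proof -
      have "(x $ k - p $ k)\<^sup>2 \<le> (\<Sum>i\<in>UNIV - {j}. (x $ i - p $ i)\<^sup>2)"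
        using jk by (intro member_le_sum) auto
      also have "\<dots> \<le> r\<^sup>2" using in_tube(2)[of x] x zero_le_power2[of r] by linarith
      finally have xk: "\<bar>x $ k - p $ k\<bar> \<le> r" using r abs_le_square_iff[of "x $ k - p $ k" r] by simp
      have "\<bar>Dw x $ k\<bar> = e * \<alpha> * (2 * \<kappa>) * \<bar>x $ k - p $ k\<bar>"
        using jk e \<alpha> \<kappa> \<sigma> by (simp add: Dw_def Dq_def co_def b_def abs_mult e_def)
      also have "\<dots> \<le> \<sigma> * \<alpha> * (2 * \<kappa>) * r"
        using e\<sigma> xk \<alpha> \<kappa> \<sigma> r by (intro mult_mono) auto
      also have "\<dots> \<le> s0" using \<sigma>(3) by (simp add: mult_ac)
      finally show "0 \<le> a (Dw x $ k)" "a (Dw x $ k) \<le> 1" using a(2) by auto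
    qed
    have "- (e * \<alpha> * (2 * \<kappa>)) \<le> a (Dw x $ k) * D2 k x"
    proof -
      have "a (Dw x $ k) * (e * \<alpha> * (2 * \<kappa>)) \<le> 1 * (e * \<alpha> * (2 * \<kappa>))"
        using ak e \<alpha> \<kappa> by (intro mult_right_mono) auto
      then have "a (Dw x $ k) * (e * \<alpha> * (2 * \<kappa>)) \<le> e * \<alpha> * (2 * \<kappa>)" by (simp only: mult_1)
      moreover have "- (a (Dw x $ k) * (e * \<alpha> * (2 * \<kappa>))) \<le> a (Dw x $ k) * D2 k x"
        using mult_left_mono[OF D2_ge[of k] ak(1)] jk by (simp add: co_def)
      ultimately show ?thesis by linarith
    qed
    moreover have "D2 j x \<ge> e * (4 * \<alpha>\<^sup>2 - 2 * \<alpha>)"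
    proof -
      have "1 \<le> (X x + 1)\<^sup>2" using x(1) by (simp add: power2_eq_square algebra_simps)
      then have "4 * \<alpha>\<^sup>2 \<le> \<alpha>\<^sup>2 * (4 * (X x + 1)\<^sup>2)" by (simp add: mult_le_cancel_left1)
      then have "4 * \<alpha>\<^sup>2 - 2 * \<alpha> \<le> \<alpha>\<^sup>2 * (Dq j x)\<^sup>2 - \<alpha> * (2 * co j)" by (simp add: Dq_sq co_def)
      then show ?thesis unfolding D2_def e_def[symmetric] using e by (intro mult_left_mono) auto
    qed
    moreover have "- (n * (e * \<alpha> * (2 * \<kappa>))) \<le> (\<Sum>i\<in>UNIV - {k} - {j}. D2 i x)"
    proof -
      have "(\<Sum>i\<in>UNIV - {k} - {j}. - (e * \<alpha> * (2 * \<kappa>))) \<le> (\<Sum>i\<in>UNIV - {k} - {j}. D2 i x)"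
      proof (rule sum_mono)
        fix i assume "i \<in> UNIV - {k} - {j}"
        then show "- (e * \<alpha> * (2 * \<kappa>)) \<le> D2 i x" using D2_ge[of i] by (simp add: co_def)
      qed
      moreover have "real (card (UNIV - {k} - {j})) \<le> n" unfolding n_def by (intro of_nat_mono card_mono) auto
      then have "real (card (UNIV - {k} - {j})) * (e * \<alpha> * (2 * \<kappa>)) \<le> n * (e * \<alpha> * (2 * \<kappa>))"
        using e \<alpha> \<kappa> by (intro mult_right_mono) auto
      moreover have "(\<Sum>i\<in>UNIV - {k} - {j}. - (e * \<alpha> * (2 * \<kappa>)))
          = - (real (card (UNIV - {k} - {j})) * (e * \<alpha> * (2 * \<kappa>)))"
        by simp
      ultimately show ?thesis by linarith
    qed
    moreover have "(\<Sum>i\<in>UNIV - {k}. D2 i x) = D2 j x + (\<Sum>i\<in>UNIV - {k} - {j}. D2 i x)"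
      using jk by (intro sum.remove) auto
    moreover have "0 < e * (4 * \<alpha>\<^sup>2 - 2 * \<alpha>) - n * (e * \<alpha> * (2 * \<kappa>)) - e * \<alpha> * (2 * \<kappa>)"
    proof -
      have "e * (4 * \<alpha>\<^sup>2 - 2 * \<alpha>) - n * (e * \<alpha> * (2 * \<kappa>)) - e * \<alpha> * (2 * \<kappa>)
          = e * \<alpha> * (2 * (\<alpha> - 1 - \<kappa> * (n + 1)) + 2 * \<alpha>)"
        by (simp add: algebra_simps power2_eq_square)
      also have "\<dots> = e * \<alpha> * (2 * \<alpha>)" by (simp add: \<alpha>_def)
      finally show ?thesis using e \<alpha> by simp
    qed
    ultimately show ?thesis by linarith
  qed
  have bdry: "w x \<le> u x" if "x \<in> closure D" "x \<notin> D" for x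
  proof -
    have x: "0 \<le> X x" "q x \<le> R\<^sup>2" using that clD by auto
    have x\<Omega>: "x \<in> \<Omega>" using that cl\<Omega> by auto
    show ?thesis
    proof (cases "q x = R\<^sup>2")
      case True
      then show ?thesis using \<Omega>(3)[OF x\<Omega>] by (simp add: w_def)
    next
      case False
      then have "X x = 0" using that(2) x by (auto simp: D_def)
      then have "x \<in> cball p r" using in_tube(1)[OF x] by force
      then have "m + c \<le> u x" by (rule near)
      moreover have "w x \<le> m + \<sigma> * (1 - 0)" unfolding w_def
        using \<sigma>(1) \<alpha> \<kappa> by (intro add_left_mono mult_left_mono diff_mono) (auto simp: q_eq sum_nonneg)
      ultimately show ?thesis using \<sigma>(2) by simp
    qed
  qed
  define x1 where "x1 = p + (t * \<tau>) *\<^sub>R axis j (1::real)"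
  have X1: "X x1 = t" using tt[of 1] by (simp add: X_def x1_def mult.left_commute[of \<tau> t])
  have q1: "q x1 = (t + 1)\<^sup>2"
  proof -
    have "(\<Sum>i\<in>UNIV - {j}. (x1 $ i - p $ i)\<^sup>2) = 0" by (rule sum.neutral) (auto simp: x1_def axis_def)
    then show ?thesis by (simp add: q_eq X1)
  qed
  have q1R: "q x1 < R\<^sup>2" unfolding q1 using p r by (intro power_strict_mono) (auto simp: R_def)
  have x1D: "x1 \<in> D" using X1 q1R p by (simp add: D_def)
  have wc: "continuous_on (closure D) w" unfolding w_def[abs_def] by (intro continuous_intros qc)
  have Dwc: "continuous_on D (\<lambda>x. Dw x $ i)" for i
    unfolding Dw_def by (simp, intro continuous_intros qc Dqc)
  have D2c: "continuous_on D (D2 i)" for i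
    unfolding D2_def[abs_def] by (intro continuous_intros qc Dqc)
  have "w x1 \<le> u x1"
    using cmp[unfolded admits_comparison_def, rule_format, OF oD bD cl\<Omega> wc _ GDw Dwc pD2 D2c sub x1D] bdry by blast
  moreover have "m < w x1" using q1R \<alpha> \<sigma>(1) by (simp add: w_def)
  ultimately show ?thesis by (simp add: x1_def)
qed

section \<open>Propagation in the degenerate direction\<close>

text \<open>The Osgood condition for \<open>a (\<phi>') \<phi>'' = \<phi>\<close>: followed
  downwards, the positive increasing solutions never reach \<open>0\<close>.\<close>

definition osgood :: "(real \<Rightarrow> real) \<Rightarrow> real \<Rightarrow> bool" where
  "osgood a P \<longleftrightarrow> (\<forall>B. \<exists>\<epsilon>>0. \<epsilon> \<le> P \<and> B \<le> integral {\<epsilon>..P} (\<lambda>s. sqrt (a s) / s))"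

text \<open>A linear substitution; the part of the integral away from \<open>0\<close> is finite and hence irrelevant.\<close>

lemma osgood_scale:
  assumes o: "osgood a s0" and a: "continuous_on {0<..s0} a" "\<And>s. 0 < s \<Longrightarrow> s \<le> s0 \<Longrightarrow> 0 \<le> a s"
    and l: "0 < l" "0 < P" "l * P \<le> s0"
  shows "osgood (\<lambda>s. a (l * s)) P"
  unfolding osgood_def
proof
  fix B
  let ?f = "\<lambda>s. sqrt (a s) / s"
  have c: "continuous_on {x..y} ?f" if "0 < x" "y \<le> s0" for x y
    using that by (intro continuous_intros continuous_on_subset[OF a(1)]) auto
  have nn: "0 \<le> ?f s" if "0 < s" "s \<le> s0" for s using a(2) that by simp
  have lP: "0 < l * P" using l by simp
  define I where "I = integral {l * P..s0} ?f"
  have I: "0 \<le> I" unfolding I_def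
    using nn lP by (intro integral_nonneg integrable_continuous_real c) auto
  obtain \<epsilon> where \<epsilon>: "0 < \<epsilon>" "\<epsilon> \<le> s0" "I + max B 0 + 1 \<le> integral {\<epsilon>..s0} ?f"
    using o unfolding osgood_def by blast
  have lt: "\<epsilon> < l * P"
  proof (rule ccontr)
    assume "\<not> \<epsilon> < l * P"
    then have "integral {\<epsilon>..s0} ?f \<le> I" unfolding I_def
      using lP \<epsilon> nn by (intro integral_subset_le integrable_continuous_real c) auto
    then show False using \<epsilon>(3) by linarith
  qed
  have "integral {\<epsilon>..l * P} ?f + I = integral {\<epsilon>..s0} ?f"
    unfolding I_def using lt l \<epsilon>
    by (intro Henstock_Kurzweil_Integration.integral_combine integrable_continuous_real c) auto
  then have B: "B \<le> integral {\<epsilon>..l * P} ?f" using \<epsilon>(3) by linarith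
  have "(?f has_integral integral {\<epsilon>..l * P} ?f) {\<epsilon>..l * P}"
    using \<epsilon> l by (intro integrable_integral integrable_continuous_real c) auto
  then have "((\<lambda>s. l * ?f (l * s)) has_integral integral {\<epsilon>..l * P} ?f) {\<epsilon> / l..P}"
  proof -
    assume "(?f has_integral integral {\<epsilon>..l * P} ?f) {\<epsilon>..l * P}"
    from has_integral_affinity'[OF this[folded cbox_interval] l(1), of 0]
    have "((\<lambda>x. ?f (l * x)) has_integral (integral {\<epsilon>..l * P} ?f / l)) {\<epsilon> / l..P}"
      using l by (simp add: field_simps)
    from has_integral_mult_right[OF this, of l] show ?thesis using l by simp
  qed
  moreover have "(\<lambda>s. l * ?f (l * s)) = (\<lambda>s. sqrt (a (l * s)) / s)" using l by auto
  ultimately have "integral {\<epsilon> / l..P} (\<lambda>s. sqrt (a (l * s)) / s) = integral {\<epsilon>..l * P} ?f"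
    by (metis integral_unique)
  then show "\<exists>\<epsilon>>0. \<epsilon> \<le> P \<and> B \<le> integral {\<epsilon>..P} (\<lambda>s. sqrt (a (l * s)) / s)"
    using B \<epsilon>(1) lt l by (intro exI[of _ "\<epsilon> / l"]) (simp add: divide_le_eq mult.commute)
qed

text \<open>Barriers with level sets of fixed curvature reach only a limited depth in this direction. The level sets of the barrier used
  here flatten as it decreases: it is \<open>\<phi> (\<eta>) (\<rho>\<^sup>2 - q)\<^sup>2\<close> minus a constant, on a cylinder of radius \<open>\<rho>\<close> around the segment, \<open>\<eta>\<close> being the
  height above its bottom and \<open>q\<close> the squared distance to its axis. Near the lateral boundary the
  quartic factor has positive Laplacian. Elsewhere its Laplacian is at least a negative constant,
  and \<open>\<phi>''\<close> compensates, by the choice of the profile. The constant is the value of the product at the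
  centre of the bottom, so the barrier is at most the minimum \<open>m\<close> on the bottom and on the lateral
  boundary, while it exceeds \<open>m\<close> on the axis above the bottom, as \<open>\<phi>\<close> is strictly increasing.\<close>

lemma positivity_vertical:
  fixes \<Omega> :: "(real ^ 'n) set"
  assumes cmp: "admits_comparison k a \<Omega> u"
    and a: "0 < s0" "continuous_on {0..s0} a" "\<And>s. 0 < s \<Longrightarrow> s \<le> s0 \<Longrightarrow> 0 < a s" "\<And>s. a (- s) = a s"
      "\<And>s t. 0 \<le> s \<Longrightarrow> s \<le> t \<Longrightarrow> t \<le> s0 \<Longrightarrow> a s \<le> a t" "osgood a s0"
    and \<Omega>: "open \<Omega>" "continuous_on \<Omega> u" "\<And>x. x \<in> \<Omega> \<Longrightarrow> m \<le> u x"
    and \<tau>: "\<tau>\<^sup>2 = 1" and p: "m < u p" "0 < t"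
    and seg: "\<And>s. 0 \<le> s \<Longrightarrow> s \<le> t \<Longrightarrow> p + (s * \<tau>) *\<^sub>R axis k 1 \<in> \<Omega>"
  shows "m < u (p + (t * \<tau>) *\<^sub>R axis k 1)"
proof -
  obtain r c where r: "0 < r" "0 < c" and tube: "\<And>s. 0 \<le> s \<Longrightarrow> s \<le> t \<Longrightarrow> cball (p + (s * \<tau>) *\<^sub>R axis k 1) r \<subseteq> \<Omega>"
    and near: "\<And>x. x \<in> cball p r \<Longrightarrow> m + c \<le> u x"
    using tube_radius[of \<Omega> u m p t \<tau> k, OF \<Omega>(1,2) p(1) less_imp_le[OF p(2)] seg] by blast
  have tt: "\<tau> * (\<tau> * z) = z" for z using \<tau> by (simp add: power2_eq_square flip: mult.assoc)
  define X where "X x = \<tau> * (x $ k - p $ k)" for x :: "real ^ 'n"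
  define l where "l = t + r / 2"
  have l: "0 < l" "r / 2 < l" using p r by (auto simp: l_def)
  define \<rho> where "\<rho> = r / 2"
  have \<rho>: "0 < \<rho>" using r by (simp add: \<rho>_def)
  define n where "n = real (card (UNIV - {k}))"
  have n: "0 \<le> n" by (simp add: n_def)
  define co where "co i = (if i = k then 0 else 1::real)" for i
  define q where "q = quad co p"
  have q_eq: "q x = (\<Sum>i\<in>UNIV - {k}. (x $ i - p $ i)\<^sup>2)" for x
    by (simp add: q_def quad_def sum.remove[of UNIV k] co_def)
  have q0: "0 \<le> q x" for x by (simp add: q_eq sum_nonneg)
  \<comment> \<open>The Laplacian of \<open>(\<rho>\<^sup>2 - q)\<^sup>2\<close> is \<open>8 \<rho>\<^sup>2 - (8 + 4 n) (\<rho>\<^sup>2 - q)\<close>, positive when \<open>\<rho>\<^sup>2 - q < m0\<close>.\<close>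
  define m0 where "m0 = 2 * \<rho>\<^sup>2 / (2 + n)"
  have m0: "0 < m0" "m0 \<le> \<rho>\<^sup>2" "(8 + 4 * n) * m0 = 8 * \<rho>\<^sup>2"
    using \<rho> n by (auto simp: m0_def field_simps add_nonneg_eq_0_iff)
  define M where "M = (8 + 4 * n) * \<rho>\<^sup>2 / m0\<^sup>2"
  have M: "0 < M" using m0 n \<rho> by (simp add: M_def add_pos_nonneg)
  \<comment> \<open>Slopes \<open>\<le> P\<close> of the profile give slopes \<open>\<le> s0\<close> of the barrier, where \<open>a\<close> is monotone.\<close>
  define P where "P = s0 / \<rho> ^ 4"
  have P: "0 < P" "P * \<rho> ^ 4 = s0" using a(1) \<rho> by (auto simp: P_def)
  have m0P: "m0\<^sup>2 * P \<le> s0"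
  proof -
    have "m0\<^sup>2 \<le> (\<rho>\<^sup>2)\<^sup>2" using m0 by (intro power_mono) auto
    then have "m0\<^sup>2 * P \<le> \<rho> ^ 4 * P" using P by (intro mult_right_mono) auto
    then show ?thesis using P by (simp add: mult.commute)
  qed
  have m0s: "0 < m0\<^sup>2" using m0 by simp
  have le_s0: "m0\<^sup>2 * s \<le> s0" if "s \<le> P" for s
    using m0P mult_left_mono[OF that, of "m0\<^sup>2"] by simp
  define \<gamma> where "\<gamma> s = a (m0\<^sup>2 * s)" for s
  have \<gamma>c: "continuous_on {0..P} \<gamma>" unfolding \<gamma>_def
    by (rule continuous_on_compose2[OF a(2)]) (use le_s0 in \<open>auto intro!: continuous_intros\<close>)
  have \<gamma>pos: "0 < \<gamma> s" if "0 < s" "s \<le> P" for s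
    unfolding \<gamma>_def using that m0s le_s0 by (intro a(3)) auto
  have \<gamma>mono: "\<gamma> s \<le> \<gamma> s'" if "0 \<le> s" "s \<le> s'" "s' \<le> P" for s s'
    unfolding \<gamma>_def using that m0s le_s0 by (intro a(5)) (auto intro: mult_left_mono)
  have "osgood \<gamma> P" unfolding \<gamma>_def[abs_def]
    by (rule osgood_scale[OF a(6) _ _ m0s P(1) m0P])
      (use a(3) in \<open>auto intro: continuous_on_subset[OF a(2)] less_imp_le\<close>)
  then have div: "\<exists>\<epsilon>>0. \<epsilon> \<le> P \<and> B \<le> integral {\<epsilon>..P} (\<lambda>s. sqrt (\<gamma> s) / s)" for B
    unfolding osgood_def by blast
  define c' where "c' = c / \<rho> ^ 4"
  have c': "0 < c'" "c' * \<rho> ^ 4 = c" using r \<rho> by (auto simp: c'_def)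
  obtain \<phi> ps d where prof: "\<And>y. 0 \<le> y \<Longrightarrow> y \<le> l \<Longrightarrow> (\<phi> has_real_derivative ps y) (at y) \<and> (ps has_real_derivative d y) (at y) \<and>
       0 < ps y \<and> ps y < c' \<and> ps y \<le> P \<and> 0 < \<phi> y \<and> \<phi> y < c' \<and> 0 < d y \<and> d y * \<gamma> (ps y) = M * \<phi> y"
    and dc: "continuous_on {0..l} d"
  proof (rule profile_exists[OF P(1) \<gamma>c _ _ div M l(1) c'(1)])
    fix \<phi> ps d
    assume "\<And>y. 0 \<le> y \<Longrightarrow> y \<le> l \<Longrightarrow> (\<phi> has_real_derivative ps y) (at y) \<and> (ps has_real_derivative d y) (at y) \<and>
       0 < ps y \<and> ps y < c' \<and> ps y \<le> P \<and> 0 < \<phi> y \<and> \<phi> y < c' \<and> 0 < d y \<and> d y * \<gamma> (ps y) = M * \<phi> y"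
      "continuous_on {0..l} d"
    then show thesis by (rule that)
  qed (rule \<gamma>pos \<gamma>mono; assumption)+
  have \<phi>c: "continuous_on {0..l} \<phi>" and psc: "continuous_on {0..l} ps"
    using prof by (meson DERIV_isCont continuous_at_imp_continuous_on atLeastAtMost_iff)+
  define \<eta> where "\<eta> x = l - X x" for x
  define D where "D = {x. 0 < \<eta> x \<and> \<eta> x < l \<and> q x < \<rho>\<^sup>2}"
  define \<mu> where "\<mu> x = \<rho>\<^sup>2 - q x" for x
  define w where "w x = m + (\<phi> (\<eta> x) * (\<mu> x)\<^sup>2 - \<phi> 0 * \<rho> ^ 4)" for x
  define Dw where "Dw x = (\<chi> i. if i = k then - \<tau> * ps (\<eta> x) * (\<mu> x)\<^sup>2 else - 4 * \<phi> (\<eta> x) * (\<mu> x * (x $ i - p $ i)))" for x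
  define D2 where "D2 i x = (if i = k then d (\<eta> x) * (\<mu> x)\<^sup>2 else \<phi> (\<eta> x) * (8 * (x $ i - p $ i)\<^sup>2 - 4 * \<mu> x))" for i x
  have Xc: "continuous_on S X" for S unfolding X_def[abs_def] by (intro continuous_intros)
  have \<eta>c: "continuous_on S \<eta>" for S unfolding \<eta>_def[abs_def] by (intro continuous_intros Xc)
  have qc: "continuous_on S q" for S unfolding q_def by (rule continuous_on_quad)
  have \<mu>c: "continuous_on S \<mu>" for S unfolding \<mu>_def[abs_def] by (intro continuous_intros qc)
  have oD: "open D" unfolding D_def by (intro open_Collect_conj open_Collect_less \<eta>c qc continuous_intros)
  have "closed {x. 0 \<le> \<eta> x \<and> \<eta> x \<le> l \<and> q x \<le> \<rho>\<^sup>2}" by (intro closed_Collect_conj closed_Collect_le \<eta>c qc continuous_intros)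
  then have clD: "closure D \<subseteq> {x. 0 \<le> \<eta> x \<and> \<eta> x \<le> l \<and> q x \<le> \<rho>\<^sup>2}"
    by (rule closure_minimal[rotated]) (auto simp: D_def)
  have in_tube: "\<exists>s. 0 \<le> s \<and> s \<le> t \<and> x \<in> cball (p + (s * \<tau>) *\<^sub>R axis k 1) r \<and> s \<le> X x"
    if "0 \<le> \<eta> x" "\<eta> x \<le> l" "q x \<le> \<rho>\<^sup>2" for x
    unfolding X_def
    by (rule axis_tube_in_cball[OF \<tau>]) (use that r p in \<open>simp_all add: \<eta>_def X_def l_def q_eq \<rho>_def power_divide\<close>)
  have cl\<Omega>: "closure D \<subseteq> \<Omega>" using clD in_tube tube by blast
  have bD: "bounded D"
  proof (rule bounded_subset[OF bounded_tube[of t p \<tau> k r]], intro subsetI CollectI)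
    fix x assume "x \<in> D"
    then have "0 \<le> \<eta> x" "\<eta> x \<le> l" "q x \<le> \<rho>\<^sup>2" by (auto simp: D_def)
    then show "\<exists>s. 0 \<le> s \<and> s \<le> t \<and> x \<in> cball (p + (s * \<tau>) *\<^sub>R axis k 1) r" using in_tube[of x] by blast
  qed
  have G\<eta>: "GDERIV \<eta> x :> - \<tau> *\<^sub>R axis k 1" for x
  proof -
    have "GDERIV (\<lambda>x. (l + \<tau> * p $ k) - \<tau> * x $ k) x :> 0 - (\<tau> *\<^sub>R axis k 1 + (x $ k) *\<^sub>R 0)"
      by (intro GDERIV_diff GDERIV_const GDERIV_mult GDERIV_coordinate)
    moreover have "(\<lambda>x. (l + \<tau> * p $ k) - \<tau> * x $ k) = \<eta>"
      by (auto simp: \<eta>_def X_def algebra_simps)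
    ultimately show ?thesis by simp
  qed
  have Gq: "GDERIV q x :> (\<chi> i. 2 * co i * (x $ i - p $ i))" for x
    unfolding q_def by (rule GDERIV_quad)
  have in_range: "0 \<le> \<eta> x" "\<eta> x \<le> l" if "x \<in> closure D" for x using that clD by auto
  have Dcl: "x \<in> D \<Longrightarrow> x \<in> closure D" for x using closure_subset by auto
  have GDw: "GDERIV w x :> Dw x" if "x \<in> D" for x
  proof -
    note y = in_range[OF Dcl[OF that]]
    have 1: "GDERIV (\<lambda>x. \<phi> (\<eta> x)) x :> ps (\<eta> x) *\<^sub>R (- \<tau> *\<^sub>R axis k 1)"
      by (rule GDERIV_DERIV_compose[OF G\<eta>]) (use prof[OF y] in blast)
    have 2: "GDERIV (\<lambda>x. (\<mu> x)\<^sup>2) x :> (- 2 * \<mu> x) *\<^sub>R (\<chi> i. 2 * co i * (x $ i - p $ i))"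
      unfolding \<mu>_def
      by (rule GDERIV_DERIV_compose[OF Gq, of "\<lambda>s. (\<rho>\<^sup>2 - s)\<^sup>2"]) (auto intro!: derivative_eq_intros)
    have "GDERIV (\<lambda>x. m + (\<phi> (\<eta> x) * (\<mu> x)\<^sup>2 - \<phi> 0 * \<rho> ^ 4)) x :>
       0 + ((\<phi> (\<eta> x) *\<^sub>R ((- 2 * \<mu> x) *\<^sub>R (\<chi> i. 2 * co i * (x $ i - p $ i)))
          + (\<mu> x)\<^sup>2 *\<^sub>R (ps (\<eta> x) *\<^sub>R (- \<tau> *\<^sub>R axis k 1))) - 0)"
      by (intro GDERIV_add GDERIV_diff GDERIV_const GDERIV_mult[OF 1 2])
    then show ?thesis unfolding w_def[abs_def]
      by (rule GDERIV_subst) (simp add: Dw_def vec_eq_iff co_def axis_def)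
  qed
  have pD2: "partial i (\<lambda>x. Dw x $ i) x (D2 i x)" if "x \<in> D" for i x
  proof -
    note y = in_range[OF Dcl[OF that]]
    have p\<eta>: "partial i \<eta> x (- \<tau> * axis k 1 $ i)"
      using GDERIV_partial[OF G\<eta>, of i] by simp
    have pq: "partial i q x (2 * co i * (x $ i - p $ i))" unfolding q_def by (rule partial_quad)
    show ?thesis
    proof (cases "i = k")
      case True
      have 1: "partial k (\<lambda>x. ps (\<eta> x)) x (d (\<eta> x) * - \<tau>)"
        using partial_chain[of ps "d (\<eta> x)" \<eta> x i, OF _ p\<eta>] prof[OF y] True by (simp add: axis_def)
      have 2: "partial k (\<lambda>x. (\<mu> x)\<^sup>2) x 0"
      proof -
        have "((\<lambda>s. (\<rho>\<^sup>2 - s)\<^sup>2) has_real_derivative - 2 * (\<rho>\<^sup>2 - q x)) (at (q x))"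
          by (auto intro!: derivative_eq_intros)
        from partial_chain[of "\<lambda>s. (\<rho>\<^sup>2 - s)\<^sup>2", OF this pq] show ?thesis
          using True by (simp add: co_def \<mu>_def)
      qed
      have "partial k (\<lambda>x. - \<tau> * (ps (\<eta> x) * (\<mu> x)\<^sup>2)) x (0 * (ps (\<eta> x) * (\<mu> x)\<^sup>2) + - \<tau> * (d (\<eta> x) * - \<tau> * (\<mu> x)\<^sup>2 + ps (\<eta> x) * 0))"
        by (intro partial_mult partial_const 1 2)
      then show ?thesis using True by (simp add: Dw_def D2_def mult.assoc tt mult.left_commute[of \<tau> "d (\<eta> x)"])
    next
      case False
      have 1: "partial i (\<lambda>x. \<phi> (\<eta> x)) x 0"
        using partial_chain[of \<phi> "ps (\<eta> x)" \<eta> x i, OF _ p\<eta>] prof[OF y] False by (simp add: axis_def)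
      have 2: "partial i \<mu> x (0 - 2 * (x $ i - p $ i))"
        unfolding \<mu>_def[abs_def] using partial_diff[OF partial_const pq] False by (simp add: co_def)
      have "partial i (\<lambda>x. - 4 * (\<phi> (\<eta> x) * (\<mu> x * (x $ i - p $ i)))) x
          (0 * (\<phi> (\<eta> x) * (\<mu> x * (x $ i - p $ i))) + - 4 * (0 * (\<mu> x * (x $ i - p $ i))
            + \<phi> (\<eta> x) * ((0 - 2 * (x $ i - p $ i)) * (x $ i - p $ i) + \<mu> x * (1 - 0))))"
        by (intro partial_mult partial_const partial_diff partial_coordinate 1 2)
      then show ?thesis using False
        by (simp add: Dw_def D2_def algebra_simps power2_eq_square)
    qed
  qed
  have sub: "0 < (\<Sum>i\<in>UNIV - {k}. D2 i x) + a (Dw x $ k) * D2 k x" if xD: "x \<in> D" for x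
  proof -
    note y = in_range[OF Dcl[OF xD]]
    define f where "f = \<phi> (\<eta> x)"
    define s where "s = ps (\<eta> x)"
    define e where "e = d (\<eta> x)"
    have pr: "0 < s" "s \<le> P" "0 < f" "0 < e" "e * \<gamma> s = M * f"
      using prof[OF y] by (auto simp: f_def s_def e_def)
    have \<mu>: "0 < \<mu> x" "\<mu> x \<le> \<rho>\<^sup>2" using xD q0[of x] by (auto simp: D_def \<mu>_def)
    have ak: "a (Dw x $ k) = a (s * (\<mu> x)\<^sup>2)"
    proof -
      have "\<tau> = 1 \<or> \<tau> = - 1" using \<tau> by (simp add: power2_eq_1_iff)
      then show ?thesis using a(4)[of "s * (\<mu> x)\<^sup>2"] by (auto simp: Dw_def s_def)
    qed
    have \<mu>4: "(\<mu> x)\<^sup>2 \<le> \<rho> ^ 4" using power_mono[OF \<mu>(2), of 2] \<mu>(1) by simp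
    have arg: "0 < s * (\<mu> x)\<^sup>2" "s * (\<mu> x)\<^sup>2 \<le> s0"
    proof -
      show "0 < s * (\<mu> x)\<^sup>2" using pr \<mu> by simp
      have "s * (\<mu> x)\<^sup>2 \<le> P * \<rho> ^ 4" using pr P(1) \<mu>4 by (intro mult_mono) auto
      then show "s * (\<mu> x)\<^sup>2 \<le> s0" using P by simp
    qed
    have apos: "0 < a (s * (\<mu> x)\<^sup>2)" by (rule a(3)[OF arg])
    have sum: "(\<Sum>i\<in>UNIV - {k}. D2 i x) = f * (8 * \<rho>\<^sup>2 - (8 + 4 * n) * \<mu> x)"
    proof -
      have "(\<Sum>i\<in>UNIV - {k}. D2 i x) = (\<Sum>i\<in>UNIV - {k}. f * (8 * (x $ i - p $ i)\<^sup>2 - 4 * \<mu> x))"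
        by (rule sum.cong) (auto simp: D2_def f_def)
      also have "\<dots> = f * (8 * q x - 4 * n * \<mu> x)"
        by (simp add: sum_subtractf flip: sum_distrib_left) (simp add: q_eq n_def sum_distrib_left)
      also have "\<dots> = f * (8 * \<rho>\<^sup>2 - (8 + 4 * n) * \<mu> x)" by (simp add: \<mu>_def algebra_simps)
      finally show ?thesis .
    qed
    have D2k: "D2 k x = e * (\<mu> x)\<^sup>2" by (simp add: D2_def e_def)
    show ?thesis
    proof (cases "\<mu> x < m0")
      case True
      have "(8 + 4 * n) * \<mu> x < 8 * \<rho>\<^sup>2"
        using mult_strict_left_mono[OF True, of "8 + 4 * n"] m0(3) n by simp
      then have "0 < f * (8 * \<rho>\<^sup>2 - (8 + 4 * n) * \<mu> x)" using pr by simp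
      moreover have "0 \<le> a (s * (\<mu> x)\<^sup>2) * (e * (\<mu> x)\<^sup>2)" using apos pr by simp
      ultimately show ?thesis unfolding sum ak D2k by linarith
    next
      case False
      have m2: "m0\<^sup>2 \<le> (\<mu> x)\<^sup>2" using False m0 by (intro power_mono) auto
      have "\<gamma> s \<le> a (s * (\<mu> x)\<^sup>2)" unfolding \<gamma>_def
        using m2 pr m0s arg by (intro a(5)) (auto simp: mult.commute)
      then have "\<gamma> s * (e * m0\<^sup>2) \<le> a (s * (\<mu> x)\<^sup>2) * (e * (\<mu> x)\<^sup>2)"
        using m2 pr apos by (intro mult_mono) auto
      moreover have "\<gamma> s * (e * m0\<^sup>2) = f * ((8 + 4 * n) * \<rho>\<^sup>2)"
      proof -
        have "\<gamma> s * (e * m0\<^sup>2) = M * f * m0\<^sup>2" using pr(5) by (simp add: mult_ac)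
        also have "\<dots> = f * ((8 + 4 * n) * \<rho>\<^sup>2)" using m0 by (simp add: M_def)
        finally show ?thesis .
      qed
      moreover have "f * ((8 + 4 * n) * \<mu> x) \<le> f * ((8 + 4 * n) * \<rho>\<^sup>2)"
        using \<mu>(2) pr n by (intro mult_left_mono) auto
      moreover have "0 < f * (8 * \<rho>\<^sup>2)" using pr \<rho> by simp
      ultimately show ?thesis unfolding sum ak D2k right_diff_distrib by linarith
    qed
  qed
  have \<phi>0: "0 < \<phi> 0" using prof[of 0] l by simp
  have bdry: "w x \<le> u x" if "x \<in> closure D" "x \<notin> D" for x
  proof -
    have x: "0 \<le> \<eta> x" "\<eta> x \<le> l" "q x \<le> \<rho>\<^sup>2" using that clD by auto
    have x\<Omega>: "x \<in> \<Omega>" using that cl\<Omega> by auto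
    have \<mu>: "0 \<le> \<mu> x" "\<mu> x \<le> \<rho>\<^sup>2" using x q0[of x] by (auto simp: \<mu>_def)
    have \<mu>4: "(\<mu> x)\<^sup>2 \<le> \<rho> ^ 4" using power_mono[OF \<mu>(2,1), of 2] by simp
    have "\<not> (0 < \<eta> x \<and> \<eta> x < l \<and> q x < \<rho>\<^sup>2)" using that(2) by (simp add: D_def)
    then consider "\<eta> x = 0" | "\<eta> x = l" | "q x = \<rho>\<^sup>2" using x by linarith
    then show ?thesis
    proof cases
      case 1
      have "\<phi> 0 * (\<mu> x)\<^sup>2 \<le> \<phi> 0 * \<rho> ^ 4" using \<mu>4 \<phi>0 by simp
      then show ?thesis using 1 \<Omega>(3)[OF x\<Omega>] by (simp add: w_def)
    next
      case 2
      then have "X x = 0" by (simp add: \<eta>_def)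
      then have "x \<in> cball p r" using in_tube[OF x] by force
      then have "m + c \<le> u x" by (rule near)
      moreover have "\<phi> (\<eta> x) * (\<mu> x)\<^sup>2 \<le> c' * \<rho> ^ 4"
        using prof[OF x(1,2)] \<mu>4 c' by (intro mult_mono) auto
      moreover have "0 \<le> \<phi> 0 * \<rho> ^ 4" using \<phi>0 by simp
      ultimately show ?thesis using c' by (simp add: w_def)
    next
      case 3
      have "0 \<le> \<phi> 0 * \<rho> ^ 4" using \<phi>0 by simp
      then show ?thesis using 3 \<Omega>(3)[OF x\<Omega>] by (simp add: w_def \<mu>_def)
    qed
  qed
  define x1 where "x1 = p + (t * \<tau>) *\<^sub>R axis k (1::real)"
  have X1: "X x1 = t" using tt[of 1] by (simp add: X_def x1_def mult.left_commute[of \<tau> t])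
  have \<eta>1: "\<eta> x1 = \<rho>" by (simp add: \<eta>_def X1 l_def \<rho>_def)
  have q1: "q x1 = 0" unfolding q_eq by (rule sum.neutral) (auto simp: x1_def axis_def)
  have x1D: "x1 \<in> D" using \<eta>1 q1 \<rho> l by (simp add: D_def \<rho>_def)
  have im: "\<eta> ` closure D \<subseteq> {0..l}" using in_range by auto
  have imD: "\<eta> ` D \<subseteq> {0..l}" using in_range Dcl by auto
  have wc: "continuous_on (closure D) w" unfolding w_def[abs_def]
    by (intro continuous_intros continuous_on_compose2[OF \<phi>c \<eta>c im] \<mu>c)
  have Dwc: "continuous_on D (\<lambda>x. Dw x $ i)" for i
    unfolding Dw_def
    by (cases "i = k")
      (simp_all, (intro continuous_intros continuous_on_compose2[OF \<phi>c \<eta>c imD] continuous_on_compose2[OF psc \<eta>c imD] \<mu>c)+)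
  have D2c: "continuous_on D (D2 i)" for i
    unfolding D2_def[abs_def]
    by (cases "i = k")
      (simp_all, (intro continuous_intros continuous_on_compose2[OF \<phi>c \<eta>c imD] continuous_on_compose2[OF dc \<eta>c imD] \<mu>c)+)
  have "w x1 \<le> u x1"
    using cmp[unfolded admits_comparison_def, rule_format, OF oD bD cl\<Omega> wc _ GDw Dwc pD2 D2c sub x1D] bdry by blast
  moreover have "m < w x1"
  proof -
    have "\<phi> 0 < \<phi> \<rho>"
    proof (rule DERIV_pos_imp_increasing[OF \<rho>])
      fix y assume "0 \<le> y" "y \<le> \<rho>"
      then have "0 \<le> y" "y \<le> l" using l by (auto simp: \<rho>_def)
      then show "\<exists>z. (\<phi> has_real_derivative z) (at y) \<and> 0 < z" using prof by blast
    qed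
    then show ?thesis using \<rho> by (simp add: w_def \<eta>1 \<mu>_def q1)
  qed
  ultimately show ?thesis by (simp add: x1_def)
qed

section \<open>Connectedness and the strong maximum principle\<close>

text \<open>Change the coordinates of \<open>y\<close> into those of \<open>x\<close> one at a time; the distance to \<open>x\<close> never increases, so
  all segments stay in the ball.\<close>

lemma ball_subset_propagation:
  fixes \<Omega> :: "(real ^ 'n) set"
  assumes spread: "\<And>j \<tau> p t. \<lbrakk>\<tau>\<^sup>2 = 1; m < u p; 0 < t;
      \<And>s. 0 \<le> s \<Longrightarrow> s \<le> t \<Longrightarrow> p + (s * \<tau>) *\<^sub>R axis j 1 \<in> \<Omega>\<rbrakk> \<Longrightarrow> m < u (p + (t * \<tau>) *\<^sub>R axis j 1)"
    and ball: "ball x r \<subseteq> \<Omega>" and y: "y \<in> ball x r" "m < u y"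
  shows "m < u x"
proof -
  define z where "z S = (\<chi> i. if i \<in> S then x $ i else y $ i)" for S
  have "m < u (z S)" if "finite S" for S using that
  proof (induction S rule: finite_induct)
    case empty
    have "z {} = y" by (simp add: z_def vec_eq_iff)
    then show ?case using y by simp
  next
    case (insert j S)
    define t where "t = \<bar>x $ j - y $ j\<bar>"
    define \<tau> where "\<tau> = (if y $ j \<le> x $ j then 1 else - 1 :: real)"
    have t\<tau>: "t * \<tau> = x $ j - y $ j" by (auto simp: t_def \<tau>_def)
    have zins: "z (insert j S) = z S + (t * \<tau>) *\<^sub>R axis j 1"
      using insert(2) by (auto simp: z_def vec_eq_iff axis_def t\<tau>)
    show ?case
    proof (cases "t = 0")
      case True
      then show ?thesis using insert zins by simp
    next
      case False
      have "m < u (z S + (t * \<tau>) *\<^sub>R axis j 1)"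
      proof (rule spread)
        show "\<tau>\<^sup>2 = 1" by (simp add: \<tau>_def)
        show "m < u (z S)" by (rule insert.IH)
        show "0 < t" using False by (simp add: t_def)
        fix s assume s: "0 \<le> s" "s \<le> t"
        have "norm (x - (z S + (s * \<tau>) *\<^sub>R axis j 1)) \<le> norm (x - y)"
        proof (rule norm_le_componentwise_cart)
          fix i
          show "norm ((x - (z S + (s * \<tau>) *\<^sub>R axis j 1)) $ i) \<le> norm ((x - y) $ i)"
          proof (cases "i = j")
            case True
            have "\<bar>x $ j - (y $ j + s * \<tau>)\<bar> = \<bar>(t - s) * \<tau>\<bar>" using t\<tau> by (simp add: left_diff_distrib)
            also have "\<dots> \<le> t" using s by (auto simp: \<tau>_def)
            finally show ?thesis using True insert(2) by (simp add: z_def t_def axis_def)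
          qed (auto simp: z_def axis_def)
        qed
        then have "z S + (s * \<tau>) *\<^sub>R axis j 1 \<in> ball x r" using y(1) by (simp add: dist_norm)
        then show "z S + (s * \<tau>) *\<^sub>R axis j 1 \<in> \<Omega>" using ball by blast
      qed
      then show ?thesis using zins by simp
    qed
  qed
  from this[of UNIV] have "m < u (z UNIV)" by simp
  moreover have "z UNIV = x" by (simp add: z_def vec_eq_iff)
  ultimately show ?thesis by simp
qed

theorem theorem3:
  fixes \<Omega> :: "(real ^ 'n) set"
    and k :: 'n
    and g g' f :: "real \<Rightarrow> real"
    and tbar :: real
    and u :: "real ^ 'n \<Rightarrow> real"
  assumes "CARD('n) \<ge> 2"
    and "connected \<Omega>" and "open \<Omega>" and "bounded \<Omega>"
    and "continuous_on {0..} g" and "\<forall>t\<ge>0. 0 \<le> g t"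
    and "assumption_L g g' tbar"
    and "assumption_G g f"
    and "\<forall>t\<in>{0<..tbar}. 0 \<le> g' t \<and> g t + g' t * t \<le> 1"
    and "\<forall>\<xi>>0. set_integrable lborel {0<..<\<xi>} (G_integrand CARD('n) g)"
    and "\<exists>K>0. \<forall>\<xi>>0. \<xi>\<^sup>2 / real CARD('n) \<le> tbar \<longrightarrow>
           sqrt (g (\<xi>\<^sup>2 / real CARD('n))) \<le> K * (exp (G_fun CARD('n) g \<xi>) - 1)"
    and "u \<in> W12 \<Omega>" and "continuous_on (closure \<Omega>) u"
    and "weak_supersolution k f \<Omega> u"
    and "\<exists>x0\<in>\<Omega>. \<forall>x\<in>closure \<Omega>. u x0 \<le> u x"
  shows "u constant_on closure \<Omega>"
proof -
  note conn = assms(2) and op = assms(3) and gc = assms(5) and gnn = assms(6)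
  define N where "N = real CARD('n)"
  have N: "0 < N" by (simp add: N_def)
  have tb: "0 < tbar" and g1: "\<And>t. 0 \<le> t \<Longrightarrow> t \<le> tbar \<Longrightarrow> g t \<le> 1"
    and gpos: "\<And>t. 0 < t \<Longrightarrow> t \<le> tbar \<Longrightarrow> 0 < g t"
    and gd: "\<And>t. 0 < t \<Longrightarrow> t \<le> tbar \<Longrightarrow> (g has_real_derivative g' t) (at t within {0<..tbar})"
    using assms(7) unfolding assumption_L_def by auto
  have gmono: "g s \<le> g t" if st: "0 \<le> s" "s \<le> t" "t \<le> tbar" for s t
  proof (cases "s = t")
    case False
    have "continuous_on {s..t} g" using st by (intro continuous_on_subset[OF gc]) auto
    moreover have "\<exists>y. (g has_real_derivative y) (at x) \<and> 0 \<le> y" if "s < x" "x < t" for x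
    proof -
      have x: "0 < x" "x < tbar" using that st by auto
      have "at x within {0<..tbar} = at x"
        by (rule at_within_nhd[of x "{0<..<tbar}"]) (use x in auto)
      then show ?thesis using gd[of x] assms(9) x by (intro exI[of _ "g' x"]) auto
    qed
    ultimately show ?thesis
      using False st by (intro DERIV_nonneg_imp_increasing_open[of s t g]) auto
  qed simp
  define a where "a s = g (s\<^sup>2)" for s
  define s0 where "s0 = sqrt tbar"
  have s0: "0 < s0" using tb by (simp add: s0_def)
  have sq: "s\<^sup>2 \<le> tbar" if "\<bar>s\<bar> \<le> s0" for s
    using power_mono[OF that, of 2] tb by (simp add: s0_def)
  have ac: "continuous_on S a" for S
    unfolding a_def by (rule continuous_on_compose2[OF gc]) (auto intro!: continuous_intros)
  have apos: "0 < a s" if "0 < s" "s \<le> s0" for s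
    unfolding a_def using that sq[of s] by (intro gpos) auto
  have amono: "a s \<le> a t" if "0 \<le> s" "s \<le> t" "t \<le> s0" for s t
    unfolding a_def using that sq[of t] by (intro gmono power_mono) auto
  have a01: "0 \<le> a s \<and> a s \<le> 1" if "\<bar>s\<bar> \<le> s0" for s
    unfolding a_def using gnn g1[of "s\<^sup>2"] sq[OF that] by simp
  \<comment> \<open>Rescaling from the arguments \<open>\<zeta>\<^sup>2 / N\<close> of the hypothesis to \<open>s\<^sup>2\<close>.\<close>
  have osg: "osgood a s0"
  proof -
    define r where "r \<zeta> = g (\<zeta>\<^sup>2 / N)" for \<zeta>
    define \<zeta>0 where "\<zeta>0 = sqrt N * s0"
    have \<zeta>0: "0 < \<zeta>0" using N s0 by (simp add: \<zeta>0_def)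
    have \<zeta>N: "\<zeta>\<^sup>2 / N \<le> tbar" if "0 < \<zeta>" "\<zeta> \<le> \<zeta>0" for \<zeta>
    proof -
      have "\<zeta>\<^sup>2 \<le> N * tbar" using power_mono[OF that(2), of 2] that N tb
        by (simp add: \<zeta>0_def s0_def power_mult_distrib)
      then show ?thesis using N by (simp add: divide_le_eq mult.commute)
    qed
    have rc: "continuous_on S r" for S
      unfolding r_def using N by (intro continuous_on_compose2[OF gc]) (auto intro!: continuous_intros)
    have rpos: "0 < r s" if "0 < s" "s \<le> \<zeta>0" for s
      unfolding r_def using that N \<zeta>N[OF that] by (intro gpos) auto
    have rmono: "r s \<le> r t" if "0 < s" "s \<le> t" "t \<le> \<zeta>0" for s t
      unfolding r_def using that N \<zeta>N[of t] by (intro gmono divide_right_mono power_mono) auto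
    have int: "set_integrable lborel {0<..<\<zeta>} (\<lambda>s. r s / s)" if "0 < \<zeta>" for \<zeta>
    proof -
      have "(\<lambda>s. r s / s) = G_integrand CARD('n) g" by (simp add: fun_eq_iff r_def G_integrand_def N_def)
      then show ?thesis using assms(10) that by simp
    qed
    have Geq: "G_fun CARD('n) g \<zeta> = (LINT s:{0<..<\<zeta>}|lborel. r s / s)" for \<zeta>
      by (simp add: G_fun_def r_def G_integrand_def[abs_def] N_def)
    obtain K where K: "0 < K" "\<And>\<xi>. 0 < \<xi> \<Longrightarrow> \<xi>\<^sup>2 / N \<le> tbar \<Longrightarrow> sqrt (r \<xi>) \<le> K * (exp (G_fun CARD('n) g \<xi>) - 1)"
      using assms(11) unfolding r_def N_def by blast
    have "osgood r \<zeta>0" unfolding osgood_def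
    proof
      fix B
      show "\<exists>\<epsilon>>0. \<epsilon> \<le> \<zeta>0 \<and> B \<le> integral {\<epsilon>..\<zeta>0} (\<lambda>s. sqrt (r s) / s)"
        by (rule sqrt_integral_diverges[OF \<zeta>0 rc rpos rmono int Geq K(1) K(2)]) (use \<zeta>N in auto)
    qed
    then have "osgood (\<lambda>s. r (sqrt N * s)) s0"
      by (rule osgood_scale[OF _ rc]) (use rpos N s0 in \<open>auto simp: \<zeta>0_def less_imp_le\<close>)
    moreover have "(\<lambda>s. r (sqrt N * s)) = a" using N by (auto simp: r_def a_def power_mult_distrib)
    ultimately show ?thesis by simp
  qed
  obtain H C where H: "\<And>s. ((\<lambda>s. f (s\<^sup>2) * s\<^sup>2) has_real_derivative 2 * H s) (at s)"
    "\<And>s. (H has_real_derivative a s) (at s)" "mono H" "\<And>s. \<bar>H s\<bar> \<le> C * \<bar>s\<bar>"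
    unfolding a_def by (rule one_dim_flux[OF assms(8) gc gnn]) blast
  have flux: "grad (Lagr k f) p = flux k H p" for p
    unfolding flux_def by (rule grad_Lagr[OF H(1)])
  obtain v where v: "v \<in> L2 \<Omega>" "weak_gradient \<Omega> u v"
    "\<And>\<eta>. \<eta> \<in> test_functions \<Omega> \<Longrightarrow> (\<And>x. 0 \<le> \<eta> x) \<Longrightarrow>
       0 \<le> integral\<^sup>L (lebesgue_on \<Omega>) (\<lambda>x. flux k H (v x) \<bullet> grad \<eta> x)"
    using assms(14) unfolding weak_supersolution_def flux by blast
  have uc: "continuous_on \<Omega> u" using assms(13) closure_subset by (rule continuous_on_subset)
  have cmp: "admits_comparison k a \<Omega> u"
    unfolding admits_comparison_def
  proof (intro allI impI ballI)
    fix D w Dw D2 x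
    assume *: "open D" "bounded D" "closure D \<subseteq> \<Omega>" "continuous_on (closure D) w"
      "\<forall>x\<in>closure D - D. w x \<le> u x" "\<forall>x\<in>D. GDERIV w x :> Dw x"
      "\<forall>i. continuous_on D (\<lambda>x. Dw x $ i)" "\<forall>i. \<forall>x\<in>D. partial i (\<lambda>x. Dw x $ i) x (D2 i x)"
      "\<forall>i. continuous_on D (D2 i)"
      "\<forall>x\<in>D. 0 < (\<Sum>i\<in>UNIV - {k}. D2 i x) + a (Dw x $ k) * D2 k x" "x \<in> D"
    show "w x \<le> u x"
      by (rule comparison_principle[OF op uc v H(3,2) ac H(4) *(1,2,3,4)]) (use * in blast)+
  qed
  obtain x0 where x0: "x0 \<in> \<Omega>" "\<And>x. x \<in> closure \<Omega> \<Longrightarrow> u x0 \<le> u x" using assms(15) by blast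
  define m where "m = u x0"
  have um: "m \<le> u x" if "x \<in> \<Omega>" for x using x0(2)[of x] that closure_subset by (auto simp: m_def)
  have spread: "m < u (p + (t * \<tau>) *\<^sub>R axis j 1)"
    if "\<tau>\<^sup>2 = 1" "m < u p" "0 < t" "\<And>s. 0 \<le> s \<Longrightarrow> s \<le> t \<Longrightarrow> p + (s * \<tau>) *\<^sub>R axis j 1 \<in> \<Omega>" for j \<tau> p t
  proof (cases "j = k")
    case True
    have sym: "a (- s) = a s" for s by (simp add: a_def)
    show ?thesis using positivity_vertical[OF cmp s0 ac apos sym amono osg op uc um that(1-3)] that(4) True by blast
  next
    case False
    show ?thesis using positivity_horizontal[OF cmp s0 a01 op uc um False that(1-3)] that(4) by blast
  qed
  have "u x = m" if x: "x \<in> \<Omega>" for x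
  proof (rule ccontr)
    assume "u x \<noteq> m"
    then have "m < u x" using um[OF x] by simp
    define A where "A = {x \<in> \<Omega>. m < u x}"
    define Z where "Z = {x \<in> \<Omega>. u x = m}"
    have "open A"
    proof -
      have "A = \<Omega> \<inter> u -` {m<..}" by (auto simp: A_def)
      then show ?thesis using continuous_open_preimage[OF uc op, of "{m<..}"] by simp
    qed
    moreover have "open Z"
      unfolding open_contains_ball
    proof
      fix y assume "y \<in> Z"
      then have y: "y \<in> \<Omega>" "u y = m" by (auto simp: Z_def)
      obtain r where r: "0 < r" "ball y r \<subseteq> \<Omega>" using op y(1) open_contains_ball by blast
      have "u z = m" if "z \<in> ball y r" for z
      proof (rule ccontr)
        assume "u z \<noteq> m"
        then have "m < u z" using um[of z] that r(2) by force
        then have "m < u y" using ball_subset_propagation[of m u \<Omega>, OF spread r(2) that] by blast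
        then show False using y by simp
      qed
      then show "\<exists>e>0. ball y e \<subseteq> Z" using r by (auto simp: Z_def)
    qed
    moreover have "A \<inter> Z \<inter> \<Omega> = {}" "\<Omega> \<subseteq> A \<union> Z"
      using um by (force simp: A_def Z_def)+
    moreover have "x \<in> A \<inter> \<Omega>" "x0 \<in> Z \<inter> \<Omega>" using x \<open>m < u x\<close> x0 by (auto simp: A_def Z_def m_def)
    ultimately show False using connectedD[OF conn, of A Z] by blast
  qed
  then have "u x = m" if "x \<in> closure \<Omega>" for x
    using continuous_constant_on_closure[OF assms(13), of m] that by blast
  then show ?thesis unfolding constant_on_def by blast
qed

end
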